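(* Let $\mu$ be a finite non-negative Borel measure on $\mathbb T$ and $n\in\mathbb N$. Then $\mathcal H_{\mu,n}\cap\mathrm{Mult}(\mathcal H_{\sigma,n-1})$ is an algebra under pointwise multiplication.
   Context: $\mathbb D$ is the open unit disc, $\mathbb T$ the unit circle, $dA$ normalized area measure on $\mathbb D$, $\sigma$ normalized arc-length measure on $\mathbb T$, $\mathcal O(\mathbb D)$ the holomorphic functions on $\mathbb D$, $H^2$ the Hardy space. $P_\mu(z)=\int_{\mathbb T}\frac{1-|z|^2}{|z-\zeta|^2}d\mu(\zeta)$. For $n\ge1$, $D_{\mu,n}(f)=\frac{1}{n!(n-1)!}\int_{\mathbb D}|f^{(n)}(z)|^2P_\mu(z)(1-|z|^2)^{n-1}dA(z)$. If $\mu\neq0$, $\mathcal H_{\mu,n}=\{f\in\mathcal O(\mathbb D):D_{\mu,n}(f)<\infty\}$; if $\mu=0$, $\mathcal H_{\mu,n}:=H^2$. For $f=\sum_k a_kz^k$ and $j\ge0$, $D_{\sigma,j}(f)=\sum_{k\ge j}\binom{k}{j}|a_k|^2$ and $\mathcal H_{\sigma,j}=\{f:D_{\sigma,j}(f)<\infty\}$ (so $\mathcal H_{\sigma,0}=H^2$). For a space $\mathcal H\subseteq\mathcal O(\mathbb D)$, $\mathrm{Mult}(\mathcal H)=\{\varphi\in\mathcal O(\mathbb D):\varphi f\in\mathcal H\text{ for all }f\in\mathcal H\}$. *)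

theory Defs
  imports "HOL-Complex_Analysis.Complex_Analysis"
begin

definition taylor_coeff :: "(complex \<Rightarrow> complex) \<Rightarrow> nat \<Rightarrow> complex" where
  "taylor_coeff f k = (deriv ^^ k) f 0 / of_nat (fact k)"

definition H2 :: "(complex \<Rightarrow> complex) set" where
  "H2 = {f. f holomorphic_on ball 0 1 \<and> summable (\<lambda>k. (cmod (taylor_coeff f k))\<^sup>2)}"

text \<open>D_{sigma,j}(f) = sum_{k >= j} (k choose j) |a_k|^2 (terms with k < j vanish),
  and H_{sigma,j} = {f holomorphic : D_{sigma,j}(f) < infinity}.\<close>
definition D_sigma :: "nat \<Rightarrow> (complex \<Rightarrow> complex) \<Rightarrow> ennreal" where
  "D_sigma j f = (\<Sum>k. ennreal (real (k choose j) * (cmod (taylor_coeff f k))\<^sup>2))"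

definition H_sigma :: "nat \<Rightarrow> (complex \<Rightarrow> complex) set" where
  "H_sigma j = {f. f holomorphic_on ball 0 1 \<and> D_sigma j f < \<infinity>}"

definition poisson :: "complex measure \<Rightarrow> complex \<Rightarrow> ennreal" where
  "poisson \<mu> z = (\<integral>\<^sup>+ \<zeta>. ennreal ((1 - (cmod z)\<^sup>2) / (cmod (z - \<zeta>))\<^sup>2) \<partial>\<mu>)"

text \<open>Normalized area measure on the disc: dA = (1/pi) d(Lebesgue).\<close>
definition D_mu :: "complex measure \<Rightarrow> nat \<Rightarrow> (complex \<Rightarrow> complex) \<Rightarrow> ennreal" where
  "D_mu \<mu> n f = (\<integral>\<^sup>+ z \<in> ball 0 1.
      ennreal ((cmod ((deriv ^^ n) f z))\<^sup>2 * (1 - (cmod z)\<^sup>2) ^ (n - 1)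
               / (fact n * fact (n - 1) * pi)) * poisson \<mu> z \<partial>lborel)"

definition H_mu :: "complex measure \<Rightarrow> nat \<Rightarrow> (complex \<Rightarrow> complex) set" where
  "H_mu \<mu> n = (if emeasure \<mu> (space \<mu>) = 0 then H2
               else {f. f holomorphic_on ball 0 1 \<and> D_mu \<mu> n f < \<infinity>})"

definition Mult :: "(complex \<Rightarrow> complex) set \<Rightarrow> (complex \<Rightarrow> complex) set" where
  "Mult H = {\<phi>. \<phi> holomorphic_on ball 0 1 \<and> (\<forall>f\<in>H. (\<lambda>z. \<phi> z * f z) \<in> H)}"

end

(* Write D_zeta for the integral D_{mu,n} with mu replaced by the point mass at zeta. For f = sum a_k z^k
   holomorphic across the closed disc, a Parseval computation and a summation by parts give the
   Douglas-type formula D_zeta(f) = D_{sigma,n-1}((f - f(zeta)) / (z - zeta)). If F and G are such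
   functions, F G - F(zeta) G(zeta) = F (G - G(zeta)) + G(zeta) (F - F(zeta)), so D_zeta(F G) is
   controlled by D_zeta(F) and D_zeta(G) as soon as F multiplies H_{sigma,n-1} boundedly and G is bounded.
   Elements of Mult(H_{sigma,n-1}) have both properties (uniform boundedness, then growth of powers),
   and dilation f_r(z) = f(r z) preserves the multiplier bound: it is the Schur multiplier r^|k-l|.
   For n >= 2 the weights at z and r z are comparable, whence D_{mu,n}(f_r) <= 9 D_{mu,n}(f), and
   Fatou's lemma as r -> 1 concludes. For n = 1 the product rule suffices. *)
theory Submission
  imports Defs
begin

section \<open>Area integrals over the disc\<close>

text \<open>Tail sums on the circle need absolute convergence there, which a general element of the
  space does not give; hence the estimates for n >= 2 are made for dilations, with constants
  independent of the radius and of the boundary point. The binomial weights vanish on the first n -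
  1 coefficients, so the Douglas formula controls only a seminorm of the difference quotient.
  \<open>sigma_weight\<close> makes it a norm, and the missing terms are bounded through the sup
  norm. A multiplier is only known to map the space into itself; the quantitative bound is extracted
  by a gliding hump on coefficient sequences. The constant 9 is 3 squared: (1 - |z|^2) / |z -
  \<zeta>| at z is at most 3 times its value at r z. Squaring takes two factors 1 - |z|^2, one from
  the area weight and one from the Poisson kernel. For n = 1 only the Poisson kernel is left, and it
  is not comparable: on the radius to \<zeta> it is unbounded at z but bounded at r z for fixed
  r.\<close>

lemma distr_lborel_complex_of_vec:
  "distr lborel borel (\<lambda>v::real^2. Complex (v$1) (v$2)) = lborel"
proof (rule lborel_eqI[symmetric])
  have meas: "(\<lambda>v::real^2. Complex (v$1) (v$2)) \<in> borel_measurable borel"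
    by (auto intro!: borel_measurable_continuous_onI continuous_intros simp: complex_eq_iff Complex_eq)
  fix l u :: complex
  assume lu: "\<And>b. b \<in> Basis \<Longrightarrow> l \<bullet> b \<le> u \<bullet> b"
  have "Re l \<le> Re u" "Im l \<le> Im u"
    using lu[of 1] lu[of \<i>] by (auto simp: Basis_complex_def inner_complex_def)
  have "(\<lambda>v::real^2. Complex (v$1) (v$2)) -` box l u
      = box (vector [Re l, Im l]) (vector [Re u, Im u])"
    by (auto simp: box_def Basis_complex_def inner_complex_def Basis_vec_def UNIV_2 inner_axis)
  then have "emeasure (distr lborel borel (\<lambda>v::real^2. Complex (v$1) (v$2))) (box l u)
     = emeasure lborel (box (vector [Re l, Im l]) (vector [Re u, Im u] :: real^2))"
    using meas by (simp add: emeasure_distr)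
  also have "\<dots> = ennreal (\<Prod>b\<in>Basis. (vector [Re u, Im u] - vector [Re l, Im l] :: real^2) \<bullet> b)"
    using \<open>Re l \<le> Re u\<close> \<open>Im l \<le> Im u\<close>
    by (intro emeasure_lborel_box) (auto simp: Basis_vec_def inner_axis UNIV_2)
  also have "(\<Prod>b\<in>Basis. (vector [Re u, Im u] - vector [Re l, Im l] :: real^2) \<bullet> b) 
     = (Re u - Re l) * (Im u - Im l)"
  proof -
    have B: "(Basis :: (real^2) set) = {axis 1 1, axis 2 1}"
      by (auto simp: Basis_vec_def UNIV_2)
    have "axis 1 (1::real) \<noteq> (axis 2 1 :: real^2)"
      by (simp add: axis_eq_axis)
    then show ?thesis unfolding B by (simp add: inner_axis)
  qed
  also have "\<dots> = (\<Prod>b\<in>Basis. (u - l) \<bullet> b)"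
    by (simp add: Basis_complex_def inner_complex_def)
  finally show "emeasure (distr lborel borel (\<lambda>v::real^2. Complex (v$1) (v$2))) (box l u)
     = ennreal (\<Prod>b\<in>Basis. (u - l) \<bullet> b)" .
qed simp

text \<open>Boxes determine the measure. The preimage of a box is its image under the inverse map,
  which is again orthogonal and so preserves Lebesgue measure.\<close>

lemma orthogonal_lborel_distr:
  fixes f :: "real^2 \<Rightarrow> real^2"
  assumes f: "orthogonal_transformation f"
  shows "distr lborel borel f = lborel"
proof (rule lborel_eqI[symmetric])
  have lin: "linear f" and inj: "inj f" and surj: "surj f"
    using f orthogonal_transformation_linear orthogonal_transformation_inj orthogonal_transformation_surj by metis+
  have meas: "f \<in> borel_measurable borel"
    using lin by (intro borel_measurable_continuous_onI linear_continuous_on linear_conv_bounded_linear[THEN iffD1])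
  fix l u :: "real^2"
  assume lu: "\<And>b. b \<in> Basis \<Longrightarrow> l \<bullet> b \<le> u \<bullet> b"
  let ?S = "f -` box l u"
  have im: "f ` ?S = box l u" using surj by auto
  have S: "?S \<in> sets borel" using measurable_sets[OF meas, of "box l u"] by simp
  obtain g where g: "orthogonal_transformation g" and gf: "\<And>x. g (f x) = x" and fg: "\<And>x. f (g x) = x"
    using orthogonal_transformation_inv[OF f] inj surj
    by (metis inv_f_f surj_f_inv_f)
  have S_eq: "?S = g ` box l u"
    using gf fg by (auto simp: image_iff) metis
  have "?S \<in> lmeasurable" unfolding S_eq
    by (rule measurable_orthogonal_image[OF g]) simp
  moreover have "measure lebesgue ?S = measure lebesgue (box l u)" unfolding S_eq
    by (rule measure_orthogonal_image[OF g]) simp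
  ultimately have "emeasure lebesgue ?S = emeasure lebesgue (box l u)"
    by (metis emeasure_eq_measure2 lmeasurable_box fmeasurableD2 emeasure_eq_ennreal_measure)
  then have "emeasure lborel ?S = emeasure lborel (box l u)"
    using S by (simp add: emeasure_completion)
  then show "emeasure (distr lborel borel f) (box l u) = ennreal (\<Prod>b\<in>Basis. (u - l) \<bullet> b)"
    using meas lu by (simp add: emeasure_distr emeasure_lborel_box)
qed simp

text \<open>In the coordinates (Re, Im), multiplication by a unimodular number is an orthogonal map;
  the invariance is carried over from \<open>real^2\<close> by
  \<open>distr_lborel_complex_of_vec\<close>.\<close>

lemma lborel_distr_rotation:
  fixes u :: complex
  assumes u: "cmod u = 1"
  shows "distr lborel borel (\<lambda>z. u * z) = lborel"
proof -
  let ?C = "\<lambda>v::real^2. Complex (v$1) (v$2)"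
  let ?f = "\<lambda>v::real^2. vector [Re u * v$1 - Im u * v$2, Re u * v$2 + Im u * v$1] :: real^2"
  have meas: "?C \<in> borel_measurable borel"
    by (auto intro!: borel_measurable_continuous_onI continuous_intros simp: complex_eq_iff Complex_eq)
  have lin: "linear ?f"
    by (rule linearI) (auto simp: vec_eq_iff forall_2 algebra_simps)
  have uu: "(Re u)\<^sup>2 + (Im u)\<^sup>2 = 1"
    using u by (simp add: cmod_def)
  have "norm (?f v) = norm v" for v
  proof -
    have "(Re u * v$1 - Im u * v$2)\<^sup>2 + (Re u * v$2 + Im u * v$1)\<^sup>2 
       = ((Re u)\<^sup>2 + (Im u)\<^sup>2) * ((v$1)\<^sup>2 + (v$2)\<^sup>2)"
      by (simp add: power2_eq_square algebra_simps)
    then show ?thesis using uu by (simp add: norm_vec_def L2_set_def UNIV_2)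
  qed
  then have ort: "orthogonal_transformation ?f"
    using lin by (simp add: orthogonal_transformation)
  have measf: "?f \<in> borel_measurable borel"
    using lin by (intro borel_measurable_continuous_onI linear_continuous_on linear_conv_bounded_linear[THEN iffD1])
  have comp: "(\<lambda>z. u * z) \<circ> ?C = ?C \<circ> ?f"
    by (auto simp: fun_eq_iff complex_eq_iff)
  have "distr lborel borel (\<lambda>z. u * z) = distr (distr lborel borel ?C) borel (\<lambda>z. u * z)"
    by (simp add: distr_lborel_complex_of_vec)
  also have "\<dots> = distr lborel borel ((\<lambda>z. u * z) \<circ> ?C)"
    using meas by (intro distr_distr) auto
  also have "\<dots> = distr (distr lborel borel ?f) borel ?C"
    unfolding comp using meas measf by (intro distr_distr[symmetric]) auto
  also have "\<dots> = lborel"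
    by (simp add: orthogonal_lborel_distr[OF ort] distr_lborel_complex_of_vec)
  finally show ?thesis .
qed

lemma nn_integral_lborel_rotation:
  fixes f :: "complex \<Rightarrow> ennreal"
  assumes [measurable]: "f \<in> borel_measurable borel" and "cmod u = 1"
  shows "(\<integral>\<^sup>+z. f (u * z) \<partial>lborel) = (\<integral>\<^sup>+z. f z \<partial>lborel)"
proof -
  have "(\<integral>\<^sup>+z. f z \<partial>lborel) = (\<integral>\<^sup>+z. f z \<partial>distr lborel borel (\<lambda>z. u * z))"
    using assms by (simp add: lborel_distr_rotation)
  also have "\<dots> = (\<integral>\<^sup>+z. f (u * z) \<partial>lborel)"
    by (subst nn_integral_distr) auto
  finally show ?thesis by simp
qed

lemma nn_integral_lborel_scale:
  fixes f :: "complex \<Rightarrow> ennreal"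
  assumes [measurable]: "f \<in> borel_measurable borel" and r: "r > 0"
  shows "(\<integral>\<^sup>+z. f z \<partial>lborel) = ennreal (r\<^sup>2) * (\<integral>\<^sup>+z. f (of_real r * z) \<partial>lborel)"
proof -
  have "(\<integral>\<^sup>+z. f z \<partial>lborel) 
    = (\<integral>\<^sup>+z. f z \<partial>density (distr lborel borel (\<lambda>x. 0 + r *\<^sub>R x)) (\<lambda>_. \<bar>r\<bar> ^ DIM(complex)))"
    using r lborel_affine[of r "0::complex"] by simp
  also have "\<dots> = ennreal (r\<^sup>2) * (\<integral>\<^sup>+z. f (of_real r * z) \<partial>lborel)"
    using r by (simp add: nn_integral_density nn_integral_distr nn_integral_cmult scaleR_conv_of_real)
  finally show ?thesis .
qed

text \<open>A substitute for polar coordinates: it is enough to compare the rays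
  \<open>{x<..}\<close>, and for these only the area pi (1 - x) of the annulus between the radii
  sqrt x and 1 is needed.\<close>

lemma distr_norm_square_disc:
  "distr (density lborel (indicator (ball (0::complex) 1))) borel (\<lambda>z. (cmod z)\<^sup>2)
    = density lborel (\<lambda>t. ennreal pi * indicator {0..1} t)" (is "?M = ?N")
proof (rule measure_eqI_lessThan)
  have vol: "emeasure lborel (ball (0::complex) r) = ennreal (pi * r\<^sup>2)"
            "emeasure lborel (cball (0::complex) r) = ennreal (pi * r\<^sup>2)" if "r \<ge> 0" for r
    using that emeasure_ball[of r "0::complex"] emeasure_cball[of r "0::complex"]
    by (simp_all add: eval_unit_ball_vol)
  fix x :: real
  have eqM: "emeasure ?M {x<..} = emeasure lborel ({z. x < (cmod z)\<^sup>2} \<inter> ball (0::complex) 1)"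
  proof -
    have "emeasure ?M {x<..} = emeasure (density lborel (indicator (ball (0::complex) 1))) {z. x < (cmod z)\<^sup>2}"
      by (subst emeasure_distr) (auto simp: vimage_def)
    also have "\<dots> = (\<integral>\<^sup>+z. indicator ({z. x < (cmod z)\<^sup>2} \<inter> ball (0::complex) 1) z \<partial>lborel)"
      by (subst emeasure_density)
        (auto intro!: nn_integral_cong borel_measurable_indicator split: split_indicator simp del: nn_integral_indicator)
    also have "\<dots> = emeasure lborel ({z. x < (cmod z)\<^sup>2} \<inter> ball (0::complex) 1)"
      by (rule nn_integral_indicator) simp
    finally show ?thesis .
  qed
  have eqN: "emeasure ?N {x<..} = ennreal pi * emeasure lborel ({0..1} \<inter> {x<..})"
    by (simp add: emeasure_density nn_integral_cmult mult.assoc flip: indicator_inter_arith)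
  show "emeasure ?M {x<..} < \<infinity>"
  proof -
    have "emeasure ?M {x<..} \<le> emeasure lborel (ball (0::complex) 1)"
      unfolding eqM by (intro emeasure_mono) auto
    also have "\<dots> < \<infinity>" by (simp add: vol)
    finally show ?thesis .
  qed
  consider "x < 0" | "0 \<le> x" "x < 1" | "x \<ge> 1" by linarith
  then show "emeasure ?M {x<..} = emeasure ?N {x<..}"
  proof cases
    case 1
    then have "{z. x < (cmod z)\<^sup>2} \<inter> ball (0::complex) 1 = ball 0 1"
      by (auto intro: less_le_trans)
    moreover have "{0..1} \<inter> {x<..} = {0..1}" using 1 by auto
    ultimately show ?thesis unfolding eqM eqN by (simp add: vol)
  next
    case 2
    have lt: "x < (cmod z)\<^sup>2 \<longleftrightarrow> sqrt x < cmod z" for z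
      using real_sqrt_less_iff[of x "(cmod z)\<^sup>2"] by simp
    have "{z. x < (cmod z)\<^sup>2} \<inter> ball (0::complex) 1 = ball 0 1 - cball 0 (sqrt x)"
      by (auto simp: lt not_le)
    moreover have "emeasure lborel (ball 0 1 - cball (0::complex) (sqrt x)) = ennreal (pi * (1 - x))"
      using 2 real_sqrt_less_iff[of x 1]
      by (subst emeasure_Diff) (auto simp: vol ennreal_minus algebra_simps cball_subset_ball_iff)
    moreover have "{0..1} \<inter> {x<..} = {x<..1}" using 2 by auto
    ultimately show ?thesis unfolding eqM eqN using 2 by (simp add: ennreal_mult')
  next
    case 3
    have "(cmod z)\<^sup>2 < 1" if "cmod z < 1" for z
      using that by (simp add: power_less_one_iff)
    then have "{z. x < (cmod z)\<^sup>2} \<inter> ball (0::complex) 1 = {}" using 3 by force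
    moreover have "{0..1} \<inter> {x<..} = {}" using 3 by auto
    ultimately show ?thesis unfolding eqM eqN by simp
  qed
qed auto

lemma nn_integral_disc_radial:
  fixes h :: "real \<Rightarrow> ennreal"
  assumes [measurable]: "h \<in> borel_measurable borel"
  shows "(\<integral>\<^sup>+z\<in>ball (0::complex) 1. h ((cmod z)\<^sup>2) \<partial>lborel) = ennreal pi * (\<integral>\<^sup>+t\<in>{0..1}. h t \<partial>lborel)"
proof -
  have "(\<integral>\<^sup>+z\<in>ball (0::complex) 1. h ((cmod z)\<^sup>2) \<partial>lborel)
     = (\<integral>\<^sup>+t. h t \<partial>distr (density lborel (indicator (ball (0::complex) 1))) borel (\<lambda>z. (cmod z)\<^sup>2))"
    by (subst nn_integral_distr, simp, simp, subst nn_integral_density)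
      (auto simp: mult.commute intro!: borel_measurable_indicator)
  also have "\<dots> = ennreal pi * (\<integral>\<^sup>+t\<in>{0..1}. h t \<partial>lborel)"
    unfolding distr_norm_square_disc
    by (simp add: nn_integral_density nn_integral_cmult mult_ac)
  finally show ?thesis .
qed

section \<open>Parseval identity for rotation-invariant weights on the disc\<close>

lemma discrete_parseval:
  fixes x :: "nat \<Rightarrow> complex" and N :: nat
  assumes N: "N > 0"
  shows "(\<Sum>m<N. (cmod (\<Sum>k<N. x k * cis (2 * pi * real m / N) ^ k))\<^sup>2) = N * (\<Sum>k<N. (cmod (x k))\<^sup>2)"
proof -
  define w where "w m = cis (2 * pi * real m / N)" for m :: nat
  have ww: "w m * cnj (w m) = 1" for m
    by (simp add: w_def complex_norm_square[symmetric])
  have orth: "(\<Sum>m<N. w m ^ k * cnj (w m ^ l)) = (if k = l then of_nat N else 0)" if "k < N" "l < N" for k l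
  proof (cases "k = l")
    case True
    then show ?thesis by (simp flip: power_mult_distrib add: ww)
  next
    case False
    \<comment> \<open>The ratio of the two characters is an N-th root of unity different from 1,
      because 0 < |k - l| < N; its geometric sum over a full period vanishes.\<close>
    define u where "u = cis (2 * pi * (real k - real l) / N)"
    have eq: "w m ^ k * cnj (w m ^ l) = u ^ m" for m
      by (simp add: w_def u_def Complex.DeMoivre cis_cnj cis_mult algebra_simps diff_divide_distrib)
    have "u ^ N = cis (2 * pi * of_int (int k - int l))"
      using N by (simp add: u_def Complex.DeMoivre)
    also have "\<dots> = 1" by (intro cis_multiple_2pi) auto
    finally have uN: "u ^ N = 1" .
    have "u \<noteq> 1"
    proof
      assume "u = 1"
      then have "cos (2 * pi * (real k - real l) / N) = 1"
        unfolding u_def by (metis cis.sel(1) one_complex.sel(1))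
      then obtain n :: int where "2 * pi * (real k - real l) / N = n * 2 * pi"
        by (auto simp: cos_one_2pi_int)
      then have "2 * pi * (real k - real l - n * real N) = 0" using N by (simp add: field_simps)
      then have "real k - real l = n * real N" by simp
      then have "of_int (int k - int l) = (of_int (n * int N) :: real)" by simp
      then have "int k - int l = n * int N" by (simp only: of_int_eq_iff)
      moreover have "\<bar>int k - int l\<bar> < int N" using that by auto
      ultimately have "\<bar>n\<bar> * int N < int N" by (simp add: abs_mult)
      then have "n = 0" using N by (auto simp: mult_less_cancel_right1)
      then show False using \<open>int k - int l = n * int N\<close> False by simp
    qed
    then show ?thesis unfolding eq using False uN geometric_sum[of u N] by simp
  qed
  have "complex_of_real (\<Sum>m<N. (cmod (\<Sum>k<N. x k * w m ^ k))\<^sup>2)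
      = (\<Sum>m<N. (\<Sum>k<N. x k * w m ^ k) * cnj (\<Sum>l<N. x l * w m ^ l))"
    by (simp only: of_real_sum complex_norm_square)
  also have "\<dots> = (\<Sum>m<N. \<Sum>k<N. \<Sum>l<N. x k * cnj (x l) * (w m ^ k * cnj (w m ^ l)))"
    by (simp add: sum_product mult_ac)
  also have "\<dots> = (\<Sum>k<N. \<Sum>l<N. x k * cnj (x l) * (\<Sum>m<N. w m ^ k * cnj (w m ^ l)))"
  proof -
    have "(\<Sum>m<N. \<Sum>k<N. \<Sum>l<N. h m k l) = (\<Sum>k<N. \<Sum>l<N. \<Sum>m<N. h m k l)" for h :: "nat \<Rightarrow> nat \<Rightarrow> nat \<Rightarrow> complex"
      by (subst sum.swap, rule sum.cong[OF refl], rule sum.swap)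
    then show ?thesis unfolding sum_distrib_left .
  qed
  also have "\<dots> = (\<Sum>k<N. \<Sum>l<N. x k * cnj (x l) * (if k = l then of_nat N else 0))"
    by (intro sum.cong refl arg_cong2[where f="(*)"] orth) auto
  also have "\<dots> = (\<Sum>k<N. x k * cnj (x k) * of_nat N)"
    by (intro sum.cong refl) (simp add: if_distrib sum.delta cong: if_cong)
  also have "\<dots> = complex_of_real (N * (\<Sum>k<N. (cmod (x k))\<^sup>2))"
    by (simp only: of_real_sum complex_norm_square of_real_mult of_real_of_nat_eq sum_distrib_left mult.commute)
  finally show ?thesis unfolding w_def of_real_eq_iff .
qed

text \<open>Averaging over the rotations by N-th roots of unity leaves the integral unchanged, and
  by \<open>discrete_parseval\<close> it removes every cross term of a polynomial of degree below N.
  This replaces integration over the angle.\<close>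

lemma nn_integral_polynomial_rotation_invariant:
  fixes V :: "complex \<Rightarrow> ennreal"
  assumes [measurable]: "V \<in> borel_measurable borel"
    and V: "\<And>u z. cmod u = 1 \<Longrightarrow> V (u * z) = V z"
  shows "(\<integral>\<^sup>+z. ennreal ((cmod (\<Sum>k<N. q k * z ^ k))\<^sup>2) * V z \<partial>lborel)
    = (\<Sum>k<N. ennreal ((cmod (q k))\<^sup>2) * (\<integral>\<^sup>+z. ennreal (cmod z ^ (2 * k)) * V z \<partial>lborel))"
proof (cases "N = 0")
  case False
  define w where "w m = cis (2 * pi * real m / N)" for m :: nat
  define p where "p z = (\<Sum>k<N. q k * z ^ k)" for z
  have [measurable]: "p \<in> borel_measurable borel"
    unfolding p_def by measurable
  have "of_nat N * (\<integral>\<^sup>+z. ennreal ((cmod (p z))\<^sup>2) * V z \<partial>lborel)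
     = (\<Sum>m<N. \<integral>\<^sup>+z. ennreal ((cmod (p (w m * z)))\<^sup>2) * V (w m * z) \<partial>lborel)"
    by (subst nn_integral_lborel_rotation) (auto simp: w_def)
  also have "\<dots> = (\<integral>\<^sup>+z. (\<Sum>m<N. ennreal ((cmod (p (w m * z)))\<^sup>2) * V z) \<partial>lborel)"
    by (subst nn_integral_sum) (auto simp: w_def V)
  also have "\<dots> = (\<integral>\<^sup>+z. (\<Sum>k<N. of_nat N * (ennreal ((cmod (q k))\<^sup>2) * (ennreal (cmod z ^ (2*k)) * V z))) \<partial>lborel)"
  proof (rule nn_integral_cong)
    fix z :: complex
    have "(\<Sum>m<N. (cmod (p (w m * z)))\<^sup>2) = (\<Sum>m<N. (cmod (\<Sum>k<N. (q k * z ^ k) * w m ^ k))\<^sup>2)"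
    proof -
      have "p (w m * z) = (\<Sum>k<N. (q k * z ^ k) * w m ^ k)" for m
        unfolding p_def by (intro sum.cong refl) (simp add: power_mult_distrib)
      then show ?thesis by simp
    qed
    also have "\<dots> = N * (\<Sum>k<N. (cmod (q k * z ^ k))\<^sup>2)"
      using discrete_parseval[of N "\<lambda>k. q k * z ^ k"] False unfolding w_def by simp
    also have "\<dots> = (\<Sum>k<N. N * ((cmod (q k))\<^sup>2 * cmod z ^ (2*k)))"
    proof -
      have "(cmod (q k * z ^ k))\<^sup>2 = (cmod (q k))\<^sup>2 * cmod z ^ (2*k)" for k
        by (simp add: norm_mult norm_power power_mult_distrib power_even_eq)
      then show ?thesis by (simp add: sum_distrib_left)
    qed
    finally have "ennreal (\<Sum>m<N. (cmod (p (w m * z)))\<^sup>2) = ennreal (\<Sum>k<N. N * ((cmod (q k))\<^sup>2 * cmod z ^ (2*k)))"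
      by simp
    then show "(\<Sum>m<N. ennreal ((cmod (p (w m * z)))\<^sup>2) * V z) 
      = (\<Sum>k<N. of_nat N * (ennreal ((cmod (q k))\<^sup>2) * (ennreal (cmod z ^ (2*k)) * V z)))"
      by (simp add: ennreal_mult mult.assoc[symmetric] ennreal_of_nat_eq_real_of_nat
         flip: sum_distrib_right sum_ennreal)
  qed
  also have "\<dots> = of_nat N * (\<Sum>k<N. ennreal ((cmod (q k))\<^sup>2) * (\<integral>\<^sup>+z. ennreal (cmod z ^ (2 * k)) * V z \<partial>lborel))"
    by (simp add: nn_integral_sum nn_integral_cmult sum_distrib_left)
  finally show ?thesis
    unfolding p_def using False by (simp add: ennreal_mult_cancel_left)
qed simp

text \<open>On the support of V the partial sums of Q are bounded by one constant K, so dominated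
  convergence extends the polynomial case.\<close>

lemma parseval_rotation_invariant_compact:
  fixes V :: "complex \<Rightarrow> ennreal"
  assumes [measurable]: "V \<in> borel_measurable borel"
    and V: "\<And>u z. cmod u = 1 \<Longrightarrow> V (u * z) = V z"
    and lt_top: "\<And>z. V z < top"
    and fin: "(\<integral>\<^sup>+z. V z \<partial>lborel) < \<infinity>"
    and supp: "\<And>z. cmod z > \<rho> \<Longrightarrow> V z = 0" and \<rho>: "0 \<le> \<rho>" "\<rho> < 1"
    and Q: "\<And>z. cmod z < 1 \<Longrightarrow> (\<lambda>k. q k * z ^ k) sums Q z"
  shows "(\<lambda>z. ennreal ((cmod (Q z))\<^sup>2) * V z) \<in> borel_measurable borel"
    and "(\<integral>\<^sup>+z. ennreal ((cmod (Q z))\<^sup>2) * V z \<partial>lborel)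
    = (\<Sum>k. ennreal ((cmod (q k))\<^sup>2) * (\<integral>\<^sup>+z. ennreal (cmod z ^ (2 * k)) * V z \<partial>lborel))"
proof -
  \<comment> \<open>A radius strictly between \<rho> and 1: convergence at \<rho>' gives absolute
    convergence at \<rho>.\<close>
  define \<rho>' where "\<rho>' = (1 + \<rho>) / 2"
  have \<rho>': "\<rho> < \<rho>'" "\<rho>' < 1" "0 < \<rho>'" using \<rho> by (auto simp: \<rho>'_def)
  have "summable (\<lambda>k. q k * of_real \<rho>' ^ k)"
    using Q[of "of_real \<rho>'"] \<rho>' by (auto simp: sums_iff)
  then have sm: "summable (\<lambda>k. norm (q k * of_real \<rho> ^ k))"
    by (rule powser_insidea) (use \<rho>' \<rho> in auto)
  define K where "K = (\<Sum>k. norm (q k * of_real \<rho> ^ k))"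
  define p where "p N z = (\<Sum>k<N. q k * z ^ k)" for N z
  have [measurable]: "p N \<in> borel_measurable borel" for N
    unfolding p_def by measurable
  have lim: "(\<lambda>N. ennreal ((cmod (p N z))\<^sup>2) * V z) \<longlonglongrightarrow> ennreal ((cmod (Q z))\<^sup>2) * V z" for z
  proof (cases "V z = 0")
    case False
    then have "cmod z < 1" using supp[of z] \<rho> by force
    then have "(\<lambda>N. p N z) \<longlonglongrightarrow> Q z"
      using Q[of z] by (simp add: p_def sums_def)
    then have "(\<lambda>N. (cmod (p N z))\<^sup>2) \<longlonglongrightarrow> (cmod (Q z))\<^sup>2"
      by (intro tendsto_intros)
    then have "(\<lambda>N. ennreal ((cmod (p N z))\<^sup>2)) \<longlonglongrightarrow> ennreal ((cmod (Q z))\<^sup>2)"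
      by (rule tendsto_ennrealI)
    from ennreal_tendsto_cmult[OF lt_top this, of z] show ?thesis
      by (simp add: mult.commute)
  qed simp
  show meas: "(\<lambda>z. ennreal ((cmod (Q z))\<^sup>2) * V z) \<in> borel_measurable borel"
    by (rule borel_measurable_LIMSEQ_order[OF lim]) measurable
  have bound: "ennreal ((cmod (p N z))\<^sup>2) * V z \<le> ennreal (K\<^sup>2) * V z" for N z
  proof (cases "V z = 0")
    case False
    then have z: "cmod z \<le> \<rho>" using supp[of z] by force
    have "cmod (p N z) \<le> (\<Sum>k<N. norm (q k * of_real \<rho> ^ k))" unfolding p_def
      by (rule order_trans[OF norm_sum]) 
         (use z \<rho> in \<open>auto simp: norm_mult norm_power intro!: sum_mono mult_left_mono power_mono\<close>)
    also have "\<dots> \<le> K" unfolding K_def by (rule sum_le_suminf[OF sm]) auto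
    finally have "(cmod (p N z))\<^sup>2 \<le> K\<^sup>2" by (intro power_mono) auto
    then show ?thesis by (intro mult_right_mono ennreal_leI) auto
  qed simp
  have "(\<lambda>N. \<integral>\<^sup>+z. ennreal ((cmod (p N z))\<^sup>2) * V z \<partial>lborel) \<longlonglongrightarrow> (\<integral>\<^sup>+z. ennreal ((cmod (Q z))\<^sup>2) * V z \<partial>lborel)"
  proof (rule nn_integral_dominated_convergence)
    show "(\<integral>\<^sup>+z. ennreal (K\<^sup>2) * V z \<partial>lborel) < \<infinity>"
      using fin by (simp add: nn_integral_cmult ennreal_mult_less_top)
  qed (use meas lim bound in auto)
  moreover have "(\<lambda>N. \<integral>\<^sup>+z. ennreal ((cmod (p N z))\<^sup>2) * V z \<partial>lborel)
    = (\<lambda>N. \<Sum>k<N. ennreal ((cmod (q k))\<^sup>2) * (\<integral>\<^sup>+z. ennreal (cmod z ^ (2 * k)) * V z \<partial>lborel))"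
    unfolding p_def by (intro ext nn_integral_polynomial_rotation_invariant) (auto simp: V)
  ultimately show "(\<integral>\<^sup>+z. ennreal ((cmod (Q z))\<^sup>2) * V z \<partial>lborel)
    = (\<Sum>k. ennreal ((cmod (q k))\<^sup>2) * (\<integral>\<^sup>+z. ennreal (cmod z ^ (2 * k)) * V z \<partial>lborel))"
    by (auto dest!: sums_unique[unfolded sums_def] simp: sums_def[symmetric] sums_unique)
qed

text \<open>Both sides may be infinite, and nothing bounds Q near the circle. The weight is
  therefore cut off to closed discs of radius \<open>\<rho> i\<close> < 1, and both sides are
  recovered as suprema by monotone convergence.\<close>

lemma parseval_rotation_invariant:
  fixes V :: "complex \<Rightarrow> ennreal"
  assumes [measurable]: "V \<in> borel_measurable borel"
    and V: "\<And>u z. cmod u = 1 \<Longrightarrow> V (u * z) = V z"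
    and lt_top: "\<And>z. V z < top"
    and fin: "(\<integral>\<^sup>+z. V z \<partial>lborel) < \<infinity>"
    and supp: "\<And>z. cmod z \<ge> 1 \<Longrightarrow> V z = 0"
    and Q: "\<And>z. cmod z < 1 \<Longrightarrow> (\<lambda>k. q k * z ^ k) sums Q z"
  shows "(\<integral>\<^sup>+z. ennreal ((cmod (Q z))\<^sup>2) * V z \<partial>lborel)
    = (\<Sum>k. ennreal ((cmod (q k))\<^sup>2) * (\<integral>\<^sup>+z. ennreal (cmod z ^ (2 * k)) * V z \<partial>lborel))"
proof -
  define \<rho> where "\<rho> i = 1 - 1 / (real i + 2)" for i
  have \<rho>: "0 \<le> \<rho> i" "\<rho> i < 1" for i by (auto simp: \<rho>_def field_simps)
  have inc: "\<rho> i \<le> \<rho> j" if "i \<le> j" for i j using that by (auto simp: \<rho>_def field_simps)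
  define W where "W i z = V z * indicator (cball 0 (\<rho> i)) z" for i z
  have [measurable]: "W i \<in> borel_measurable borel" for i unfolding W_def
    by (intro borel_measurable_times_ennreal borel_measurable_indicator) auto
  have incW: "incseq W" unfolding W_def incseq_def le_fun_def
    using inc by (auto split: split_indicator intro: order_trans)
  have SUPW: "(SUP i. W i z) = V z" for z
  proof (rule antisym)
    show "(SUP i. W i z) \<le> V z" by (auto intro!: SUP_least simp: W_def split: split_indicator)
    show "V z \<le> (SUP i. W i z)"
    proof (cases "cmod z < 1")
      case True
      have "\<rho> \<longlonglongrightarrow> 1" unfolding \<rho>_def by real_asymp
      then obtain i where "\<rho> i > cmod z"
        using True by (blast dest: order_tendstoD(1) eventually_happens'[OF sequentially_bot])
      then have "V z = W i z" by (simp add: W_def)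
      then show ?thesis by (metis SUP_upper UNIV_I)
    qed (use supp[of z] in auto)
  qed
  have eq: "(\<lambda>z. ennreal ((cmod (Q z))\<^sup>2) * W i z) \<in> borel_measurable borel"
    "(\<integral>\<^sup>+z. ennreal ((cmod (Q z))\<^sup>2) * W i z \<partial>lborel)
    = (\<Sum>k. ennreal ((cmod (q k))\<^sup>2) * (\<integral>\<^sup>+z. ennreal (cmod z ^ (2 * k)) * W i z \<partial>lborel))" for i
  proof -
    have f: "(\<integral>\<^sup>+z. W i z \<partial>lborel) < \<infinity>"
      by (rule le_less_trans[OF nn_integral_mono fin]) (auto simp: W_def split: split_indicator)
    note * = parseval_rotation_invariant_compact[where V="W i" and \<rho>="\<rho> i" and Q=Q and q=q, OF _ _ _ f _ \<rho> Q]
    show "(\<lambda>z. ennreal ((cmod (Q z))\<^sup>2) * W i z) \<in> borel_measurable borel"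
    "(\<integral>\<^sup>+z. ennreal ((cmod (Q z))\<^sup>2) * W i z \<partial>lborel)
    = (\<Sum>k. ennreal ((cmod (q k))\<^sup>2) * (\<integral>\<^sup>+z. ennreal (cmod z ^ (2 * k)) * W i z \<partial>lborel))"
      by (rule *; auto simp: W_def V lt_top norm_mult split: split_indicator)+
  qed
  have incm: "incseq (\<lambda>i z. c z * W i z)" for c
    using incW by (auto simp: incseq_def le_fun_def intro!: mult_left_mono)
  have "(\<integral>\<^sup>+z. ennreal ((cmod (Q z))\<^sup>2) * V z \<partial>lborel) = (\<integral>\<^sup>+z. (SUP i. ennreal ((cmod (Q z))\<^sup>2) * W i z) \<partial>lborel)"
    by (simp add: SUP_mult_left_ennreal[symmetric] SUPW)
  also have "\<dots> = (SUP i. \<integral>\<^sup>+z. ennreal ((cmod (Q z))\<^sup>2) * W i z \<partial>lborel)"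
    using eq(1) by (intro nn_integral_monotone_convergence_SUP incm) auto
  also have "\<dots> = (SUP i. \<Sum>k. ennreal ((cmod (q k))\<^sup>2) * (\<integral>\<^sup>+z. ennreal (cmod z ^ (2 * k)) * W i z \<partial>lborel))"
    by (simp add: eq(2))
  also have "\<dots> = (\<Sum>k. SUP i. ennreal ((cmod (q k))\<^sup>2) * (\<integral>\<^sup>+z. ennreal (cmod z ^ (2 * k)) * W i z \<partial>lborel))"
    by (intro ennreal_suminf_SUP_eq[symmetric])
       (use incW in \<open>auto simp: incseq_def le_fun_def intro!: mult_left_mono nn_integral_mono\<close>)
  also have "\<dots> = (\<Sum>k. ennreal ((cmod (q k))\<^sup>2) * (SUP i. \<integral>\<^sup>+z. ennreal (cmod z ^ (2 * k)) * W i z \<partial>lborel))"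
    by (simp add: SUP_mult_left_ennreal)
  also have "\<dots> = (\<Sum>k. ennreal ((cmod (q k))\<^sup>2) * (\<integral>\<^sup>+z. (SUP i. ennreal (cmod z ^ (2 * k)) * W i z) \<partial>lborel))"
    by (subst nn_integral_monotone_convergence_SUP[OF incm]) auto
  also have "\<dots> = (\<Sum>k. ennreal ((cmod (q k))\<^sup>2) * (\<integral>\<^sup>+z. ennreal (cmod z ^ (2 * k)) * V z \<partial>lborel))"
    by (simp add: SUP_mult_left_ennreal[symmetric] SUPW)
  finally show ?thesis .
qed

lemma nn_integral_Beta_nat:
  "(\<integral>\<^sup>+t\<in>{0..1}. ennreal (t ^ k * (1 - t) ^ n) \<partial>lborel) = ennreal (fact k * fact n / fact (k + n + 1))"
proof -
  have "((\<lambda>t. t powr (real (k+1) - 1) * (1 - t) powr (real (n+1) - 1)) has_integral Beta (real (k+1)) (real (n+1))) {0<..<1}"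
    using has_integral_Beta_real[of "real (k+1)" "real (n+1)"] by (simp add: has_integral_Icc_iff_Ioo)
  moreover have "Beta (real (k+1)) (real (n+1)) = fact k * fact n / fact (k + n + 1)"
    using Gamma_fact[of k, where 'a=real] Gamma_fact[of n, where 'a=real] Gamma_fact[of "k+n+1", where 'a=real]
    by (simp add: Beta_def add_ac)
  ultimately have "((\<lambda>t. t ^ k * (1 - t) ^ n) has_integral (fact k * fact n / fact (k + n + 1) :: real)) {0<..<1}"
    by (subst has_integral_cong[where g="\<lambda>t. t powr (real (k+1) - 1) * (1 - t) powr (real (n+1) - 1)"])
       (auto simp: powr_realpow)
  then have "((\<lambda>t. t ^ k * (1 - t) ^ n) has_integral (fact k * fact n / fact (k + n + 1) :: real)) {0..1}"
    by (simp add: has_integral_Icc_iff_Ioo)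
  then show ?thesis
    by (intro nn_integral_has_integral_lebesgue') auto
qed

text \<open>With t = |z|^2 the radial moments of the weight become pi times the beta integrals B(k +
  1, n + 1).\<close>

theorem disc_parseval:
  assumes Q: "\<And>z. cmod z < 1 \<Longrightarrow> (\<lambda>k. q k * z ^ k) sums Q z"
  shows "(\<integral>\<^sup>+z\<in>ball 0 1. ennreal ((cmod (Q z))\<^sup>2 * (1 - (cmod z)\<^sup>2) ^ n) \<partial>lborel)
    = (\<Sum>k. ennreal ((cmod (q k))\<^sup>2 * (pi * (fact k * fact n / fact (k + n + 1)))))"
proof -
  define V where "V z = ennreal ((1 - (cmod z)\<^sup>2) ^ n) * indicator (ball 0 1) z" for z :: complex
  have [measurable]: "V \<in> borel_measurable borel" unfolding V_def
    by (intro borel_measurable_times_ennreal borel_measurable_indicator) auto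
  have le1: "(cmod z)\<^sup>2 \<le> 1" if "cmod z < 1" for z
    using that by (simp add: power_le_one)
  have mom: "(\<integral>\<^sup>+z. ennreal (cmod z ^ (2 * k)) * V z \<partial>lborel) = ennreal (pi * (fact k * fact n / fact (k + n + 1)))" for k
  proof -
    have "(\<integral>\<^sup>+z. ennreal (cmod z ^ (2 * k)) * V z \<partial>lborel)
      = (\<integral>\<^sup>+z\<in>ball (0::complex) 1. ennreal (((cmod z)\<^sup>2) ^ k * (1 - (cmod z)\<^sup>2) ^ n) \<partial>lborel)"
      by (intro nn_integral_cong) (auto simp: V_def ennreal_mult power_mult le1 split: split_indicator)
    also have "\<dots> = ennreal pi * ennreal (fact k * fact n / fact (k + n + 1))"
      by (subst nn_integral_disc_radial[where h="\<lambda>t. ennreal (t ^ k * (1 - t) ^ n)"])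
         (simp_all only: nn_integral_Beta_nat, measurable)
    finally show ?thesis by (subst ennreal_mult) auto
  qed
  have "(\<integral>\<^sup>+z\<in>ball 0 1. ennreal ((cmod (Q z))\<^sup>2 * (1 - (cmod z)\<^sup>2) ^ n) \<partial>lborel)
      = (\<integral>\<^sup>+z. ennreal ((cmod (Q z))\<^sup>2) * V z \<partial>lborel)"
    by (intro nn_integral_cong) (auto simp: V_def ennreal_mult le1 split: split_indicator)
  also have "\<dots> = (\<Sum>k. ennreal ((cmod (q k))\<^sup>2) * (\<integral>\<^sup>+z. ennreal (cmod z ^ (2 * k)) * V z \<partial>lborel))"
  proof (rule parseval_rotation_invariant[OF _ _ _ _ _ Q])
    show "V \<in> borel_measurable borel" by measurable
    show "(\<integral>\<^sup>+z. V z \<partial>lborel) < \<infinity>" using mom[of 0] by simp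
  qed (auto simp: V_def norm_mult split: split_indicator)
  also have "\<dots> = (\<Sum>k. ennreal ((cmod (q k))\<^sup>2 * (pi * (fact k * fact n / fact (k + n + 1)))))"
    by (intro suminf_cong, subst mom, subst ennreal_mult) auto
  finally show ?thesis .
qed

section \<open>Summation by parts\<close>

text \<open>An exact identity with a nonnegative remainder. The squares on the right have the shape
  that \<open>sum_rising_factorial_difference\<close> gives to the Taylor coefficients of the
  quotient Q in the Douglas formula; the left side is the desired weighted norm.\<close>

lemma summation_by_parts_identity:
  fixes \<beta> :: "nat \<Rightarrow> complex"
  shows "(\<Sum>i\<le>N. fact i / fact (i + m) * (cmod (\<beta> i))\<^sup>2)
    = (\<Sum>k<N. fact k / fact (k + m + 2) * (cmod (of_nat (Suc m) * (\<Sum>i\<le>k. \<beta> i) - of_nat (Suc k) * \<beta> (Suc k)))\<^sup>2)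
      + of_nat (Suc m) * (fact N / fact (N + m + 1)) * (cmod (\<Sum>i\<le>N. \<beta> i))\<^sup>2"
proof (induction N)
  case 0
  have "real (Suc m) * (fact 0 / fact (0 + m + 1)) = 1 / fact m"
    by (simp del: of_nat_Suc)
  then show ?case by simp
next
  case (Suc N)
  define S where "S = (\<Sum>i\<le>N. \<beta> i)"
  define b where "b = \<beta> (Suc N)"
  \<comment> \<open>The mixed terms in S and b of the two squares cancel, since both have
    coefficient 2 (m + 1) (N + 1) with opposite signs; the coefficients of |S|^2 add up to
    zero.\<close>
  have key: "real (Suc N) * real (N + m + 2) * (cmod b)\<^sup>2 
    = (cmod (of_nat (Suc m) * S - of_nat (Suc N) * b))\<^sup>2 + real (Suc m) * real (Suc N) * (cmod (S + b))\<^sup>2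
      - real (Suc m) * real (N + m + 2) * (cmod S)\<^sup>2"
    unfolding cmod_power2 by (simp add: power2_eq_square algebra_simps)
  define F :: real where "F = fact N / fact (N + m + 2)"
  have F1: "fact (Suc N) / fact (Suc N + m) = F * (real (Suc N) * real (N + m + 2))"
    and F2: "fact (Suc N) / fact (Suc N + m + 1) = F * real (Suc N)"
    and F3: "fact N / fact (N + m + 1) = F * real (N + m + 2)"
    by (simp_all add: F_def)
  have "(\<Sum>i\<le>Suc N. fact i / fact (i + m) * (cmod (\<beta> i))\<^sup>2)
    = (\<Sum>k<N. fact k / fact (k + m + 2) * (cmod (of_nat (Suc m) * (\<Sum>i\<le>k. \<beta> i) - of_nat (Suc k) * \<beta> (Suc k)))\<^sup>2)
      + real (Suc m) * (F * real (N + m + 2)) * (cmod S)\<^sup>2 + F * (real (Suc N) * real (N + m + 2)) * (cmod b)\<^sup>2"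
    unfolding sum.atMost_Suc Suc.IH F1 F3 S_def b_def by simp
  also have "\<dots> = (\<Sum>k<N. fact k / fact (k + m + 2) * (cmod (of_nat (Suc m) * (\<Sum>i\<le>k. \<beta> i) - of_nat (Suc k) * \<beta> (Suc k)))\<^sup>2)
      + F * (cmod (of_nat (Suc m) * S - of_nat (Suc N) * b))\<^sup>2 + real (Suc m) * (F * real (Suc N)) * (cmod (S + b))\<^sup>2"
    using arg_cong[OF key, of "\<lambda>x. F * x"] by (simp only: algebra_simps)
  finally show ?case
    unfolding F2 by (simp only: sum.lessThan_Suc sum.atMost_Suc S_def b_def F_def)
qed

text \<open>The i-th term equals (i + m + 1) \<beta>_i - (i + 1) \<beta>_{i+1}, that is (m + 1)
  \<beta>_i plus the telescoping difference i \<beta>_i - (i + 1) \<beta>_{i+1}.\<close>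

lemma sum_rising_factorial_difference:
  fixes t :: "nat \<Rightarrow> complex" and m :: nat
  defines "\<beta> \<equiv> \<lambda>i. of_real (fact (i + m) / fact i) * t (i + m)"
  shows "(\<Sum>i\<le>k. of_real (fact (i + Suc m) / fact i) * (t (i + m) - t (Suc (i + m))))
    = of_nat (Suc m) * (\<Sum>i\<le>k. \<beta> i) - of_nat (Suc k) * \<beta> (Suc k)"
proof (induction k)
  case 0
  then show ?case by (simp add: \<beta>_def algebra_simps)
next
  case (Suc k)
  have 1: "of_nat (Suc m + Suc k) * \<beta> (Suc k) = of_real (fact (Suc k + Suc m) / fact (Suc k)) * t (Suc k + m)"
    by (simp add: \<beta>_def field_simps)
  have 2: "of_nat (Suc (Suc k)) * \<beta> (Suc (Suc k)) = of_real (fact (Suc k + Suc m) / fact (Suc k)) * t (Suc (Suc k + m))"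
  proof -
    have "real (Suc (Suc k)) * (fact (Suc (Suc k) + m) / fact (Suc (Suc k))) = fact (Suc k + Suc m) / fact (Suc k)"
      by (simp add: fact_Suc[of "Suc k"] del: fact_Suc of_nat_Suc)
    moreover have "of_nat l * (of_real r * x) = of_real (real l * r) * x" for l r and x :: complex
      by simp
    ultimately show ?thesis by (simp only: \<beta>_def) simp
  qed
  have "(\<Sum>i\<le>Suc k. of_real (fact (i + Suc m) / fact i) * (t (i + m) - t (Suc (i + m))))
     = of_nat (Suc m) * (\<Sum>i\<le>k. \<beta> i) - of_nat (Suc k) * \<beta> (Suc k)
      + (of_nat (Suc m + Suc k) * \<beta> (Suc k) - of_nat (Suc (Suc k)) * \<beta> (Suc (Suc k)))"
    unfolding sum.atMost_Suc Suc.IH 1 2 by (simp only: right_diff_distrib)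
  also have "\<dots> = of_nat (Suc m) * (\<Sum>i\<le>Suc k. \<beta> i) - of_nat (Suc (Suc k)) * \<beta> (Suc (Suc k))"
    by (simp add: algebra_simps)
  finally show ?case .
qed

lemma suminf_shift_ennreal:
  fixes f :: "nat \<Rightarrow> ennreal"
  assumes "\<And>i. i < m \<Longrightarrow> f i = 0"
  shows "(\<Sum>i. f (i + m)) = (\<Sum>i. f i)"
  using suminf_offset[of f m] assms by (simp add: summableI)

text \<open>The limit of the finite identity. Absolute summability keeps the partial sums of \<beta>
  bounded, which makes the boundary term \<open>E N\<close> vanish; the weights of the remaining sum
  are m! times binomial coefficients.\<close>

lemma suminf_rising_factorial_difference:
  fixes t :: "nat \<Rightarrow> complex"
  assumes sm: "summable (\<lambda>i. fact (i + m) / fact i * cmod (t (i + m)))"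
  shows "(\<Sum>k. ennreal (fact k / fact (k + m + 2) *
      (cmod (\<Sum>i\<le>k. of_real (fact (i + Suc m) / fact i) * (t (i + m) - t (Suc (i + m)))))\<^sup>2))
    = ennreal (fact m) * (\<Sum>j. ennreal (real (j choose m) * (cmod (t j))\<^sup>2))"
proof -
  define \<beta> where "\<beta> i = of_real (fact (i + m) / fact i) * t (i + m)" for i
  have nb: "cmod (\<beta> i) = fact (i + m) / fact i * cmod (t (i + m))" for i
    by (simp add: \<beta>_def norm_mult norm_divide)
  define K where "K = (\<Sum>i. cmod (\<beta> i))"
  have sb: "summable (\<lambda>i. cmod (\<beta> i))" using sm by (simp add: nb)
  have SK: "cmod (\<Sum>i\<le>N. \<beta> i) \<le> K" for N
    unfolding K_def by (rule order_trans[OF norm_sum sum_le_suminf[OF sb]]) auto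
  define E where "E N = of_nat (Suc m) * (fact N / fact (N + m + 1)) * (cmod (\<Sum>i\<le>N. \<beta> i))\<^sup>2" for N :: nat
  define c where "c k = fact k / fact (k + m + 2) * (cmod (of_nat (Suc m) * (\<Sum>i\<le>k. \<beta> i) - of_nat (Suc k) * \<beta> (Suc k)))\<^sup>2" for k :: nat
  define d where "d i = fact i / fact (i + m) * (cmod (\<beta> i))\<^sup>2" for i :: nat
  have eq: "(\<Sum>i\<le>N. d i) = (\<Sum>k<N. c k) + E N" for N
    unfolding d_def c_def E_def by (rule summation_by_parts_identity)
  \<comment> \<open>From (N + 1)! <= (N + m + 1)! the factorial quotient in \<open>E N\<close> is at
    most 1 / (N + 1).\<close>
  have Ele: "E N \<le> real (Suc m) * K\<^sup>2 / real (N + 1)" for N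
  proof -
    have "(fact (Suc N) :: real) \<le> fact (N + m + 1)" by (intro fact_mono) auto
    moreover have "x / F \<le> 1 / a" if "0 < a" "0 < F" "a * x \<le> F" for a x F :: real
      using that by (simp add: field_simps)
    ultimately have "fact N / fact (N + m + 1) \<le> (1 / real (N + 1) :: real)"
      by (metis Suc_eq_plus1 fact_Suc fact_gt_zero of_nat_0_less_iff zero_less_Suc)
    moreover have "(cmod (\<Sum>i\<le>N. \<beta> i))\<^sup>2 \<le> K\<^sup>2" using SK[of N] by (intro power_mono) auto
    ultimately have "fact N / fact (N + m + 1) * (cmod (\<Sum>i\<le>N. \<beta> i))\<^sup>2 \<le> 1 / real (N + 1) * K\<^sup>2"
      by (intro mult_mono) auto
    then have "real (Suc m) * (fact N / fact (N + m + 1) * (cmod (\<Sum>i\<le>N. \<beta> i))\<^sup>2) \<le> real (Suc m) * (1 / real (N + 1) * K\<^sup>2)"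
      by (intro mult_left_mono) auto
    then show ?thesis unfolding E_def by (simp only: mult.assoc times_divide_eq_left times_divide_eq_right mult_1_left)
  qed
  have E0: "E \<longlonglongrightarrow> 0"
  proof (rule tendsto_sandwich[OF _ _ tendsto_const])
    show "(\<lambda>N. real (Suc m) * K\<^sup>2 / real (N + 1)) \<longlonglongrightarrow> 0" by real_asymp
  qed (use Ele in \<open>auto simp: E_def intro!: always_eventually\<close>)
  have cnn: "c k \<ge> 0" and dnn: "d k \<ge> 0" for k by (auto simp: c_def d_def)
  have "(\<lambda>N. ennreal (\<Sum>k<N. c k) + ennreal (E N)) \<longlonglongrightarrow> (\<Sum>k. ennreal (c k)) + ennreal 0"
    using cnn E0 by (intro tendsto_add tendsto_ennrealI summable_LIMSEQ)
       (auto simp flip: sum_ennreal intro!: summable_LIMSEQ summableI)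
  moreover have "(\<lambda>N. ennreal (\<Sum>i\<le>N. d i)) \<longlonglongrightarrow> (\<Sum>k. ennreal (d k))"
    using dnn by (auto simp flip: sum_ennreal intro!: summable_LIMSEQ' summableI)
  moreover have "ennreal (\<Sum>i\<le>N. d i) = ennreal (\<Sum>k<N. c k) + ennreal (E N)" for N
    unfolding eq using cnn by (intro ennreal_plus) (auto simp: E_def intro!: sum_nonneg)
  ultimately have "(\<Sum>k. ennreal (c k)) = (\<Sum>k. ennreal (d k))"
    using LIMSEQ_unique by fastforce
  also have "\<dots> = (\<Sum>i. ennreal (fact m) * ennreal (real ((i + m) choose m) * (cmod (t (i + m)))\<^sup>2))"
  proof (intro suminf_cong)
    fix i
    have "d i = fact m * (real ((i + m) choose m) * (cmod (t (i + m)))\<^sup>2)"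
      unfolding d_def nb by (simp add: binomial_fact power2_eq_square field_simps)
    then show "ennreal (d i) = ennreal (fact m) * ennreal (real ((i + m) choose m) * (cmod (t (i + m)))\<^sup>2)"
      by (simp add: ennreal_mult)
  qed
  also have "\<dots> = ennreal (fact m) * (\<Sum>j. ennreal (real (j choose m) * (cmod (t j))\<^sup>2))"
    unfolding ennreal_suminf_cmult
    by (subst suminf_shift_ennreal[of m "\<lambda>j. ennreal (real (j choose m) * (cmod (t j))\<^sup>2)"])
       (auto simp: binomial_eq_0)
  finally show ?thesis
    by (simp only: c_def \<beta>_def sum_rising_factorial_difference[of m t])
qed

lemma summable_rising_factorial_geometric:
  fixes x :: real
  assumes "0 \<le> x" "x < 1"
  shows "summable (\<lambda>i. fact (i + m) / fact i * x ^ i)"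
proof -
  define c where "c = (1 + x) / 2"
  have c: "x < c" "c < 1" using assms by (auto simp: c_def)
  have "((\<lambda>i::nat. (real i + real m + 1) / (real i + 1) * x) \<longlongrightarrow> x) sequentially"
    by real_asymp
  then have "eventually (\<lambda>i::nat. (real i + real m + 1) / (real i + 1) * x < c) sequentially"
    using c(1) by (rule order_tendstoD(2))
  then obtain N where N: "\<And>i::nat. i \<ge> N \<Longrightarrow> (real i + real m + 1) / (real i + 1) * x < c"
    by (auto simp: eventually_sequentially)
  show ?thesis
  proof (rule summable_ratio_test[OF \<open>c < 1\<close>])
    fix i assume "N \<le> i"
    have "fact (Suc i + m) / fact (Suc i) * x ^ Suc i = (real i + real m + 1) / (real i + 1) * x * (fact (i + m) / fact i * x ^ i)"
      by (simp add: field_simps)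
    also have "\<dots> \<le> c * (fact (i + m) / fact i * x ^ i)"
      using N[OF \<open>N \<le> i\<close>] assms by (intro mult_right_mono) auto
    finally show "norm (fact (Suc i + m) / fact (Suc i) * x ^ Suc i) \<le> c * norm (fact (i + m) / fact i * x ^ i)"
      using assms by simp
  qed
qed

section \<open>The local Douglas formula\<close>

lemma borel_measurable_ennreal_times_indicator:
  fixes g :: "'a::topological_space \<Rightarrow> real"
  assumes "A \<in> sets borel" "continuous_on A g"
  shows "(\<lambda>z. ennreal (g z) * indicator A z) \<in> borel_measurable borel"
proof -
  have "(\<lambda>z. ennreal (indicator A z *\<^sub>R g z)) \<in> borel_measurable borel"
    using borel_measurable_continuous_on_indicator[OF assms] by measurable
  also have "(\<lambda>z. ennreal (indicator A z *\<^sub>R g z)) = (\<lambda>z. ennreal (g z) * indicator A z)"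
    by (auto simp: fun_eq_iff split: split_indicator)
  finally show ?thesis .
qed

lemma taylor_sums:
  assumes "f holomorphic_on ball 0 1" "cmod z < 1"
  shows "(\<lambda>k. taylor_coeff f k * z ^ k) sums f z"
  using holomorphic_power_series[of f 0 1 z] assms by (simp add: taylor_coeff_def)

lemma taylor_coeff_higher_deriv:
  "taylor_coeff ((deriv ^^ n) f) k = of_real (fact (k + n) / fact k) * taylor_coeff f (k + n)"
  by (simp add: taylor_coeff_def flip: funpow_add[THEN fun_cong, unfolded o_def])

text \<open>The sum over indices strictly greater than j. For y_k = a_k \<zeta>^k it is, up to the
  unimodular factor \<zeta>^(j+1), the j-th Taylor coefficient of (f - f(\<zeta>)) / (z -
  \<zeta>).\<close>

definition tail_sum :: "(nat \<Rightarrow> complex) \<Rightarrow> nat \<Rightarrow> complex" where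
  "tail_sum y j = (\<Sum>k. y (k + Suc j))"

text \<open>This is \<open>D_mu\<close> for the unit point mass at \<zeta>: the Poisson integral is
  replaced by the kernel itself.\<close>

definition local_dirichlet :: "nat \<Rightarrow> (complex \<Rightarrow> complex) \<Rightarrow> complex \<Rightarrow> ennreal" where
  "local_dirichlet n f \<zeta> = (\<integral>\<^sup>+ z \<in> ball 0 1.
      ennreal ((cmod ((deriv ^^ n) f z))\<^sup>2 * (1 - (cmod z)\<^sup>2) ^ (n - 1) / (fact n * fact (n - 1) * pi))
       * ennreal ((1 - (cmod z)\<^sup>2) / (cmod (z - \<zeta>))\<^sup>2) \<partial>lborel)"

lemma tail_sum_diff:
  assumes "summable y"
  shows "tail_sum y j - tail_sum y (Suc j) = y (Suc j)"
proof -
  have "summable (\<lambda>k. y (k + Suc j))" using assms by (subst summable_iff_shift)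
  from suminf_split_head[OF this] show ?thesis by (simp add: tail_sum_def)
qed

text \<open>Convergence at a radius s > 1 turns into geometric decay s^(-j) of the tails; this is
  the form in which holomorphy across the closed disc is used.\<close>

lemma norm_tail_sum_le:
  fixes s :: real
  assumes s: "s > 1" and sm: "summable (\<lambda>k. cmod (y k) * s ^ k)"
  shows "cmod (tail_sum y j) \<le> (\<Sum>k. cmod (y k) * s ^ k) * (1 / s) ^ j"
    and "summable y"
proof -
  have le: "cmod (y k) \<le> cmod (y k) * s ^ k" for k
    using s by (simp add: mult_le_cancel_left1 one_le_power)
  have sy: "summable (\<lambda>k. cmod (y k))"
    by (rule summable_comparison_test'[OF sm, of 0]) (use le in auto)
  then show "summable y" by (rule summable_norm_cancel)
  have sm': "summable (\<lambda>k. cmod (y (k + Suc j)) * s ^ (k + Suc j))"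
    using sm by (subst summable_iff_shift[where f="\<lambda>k. cmod (y k) * s ^ k"])
  have "cmod (tail_sum y j) \<le> (\<Sum>k. cmod (y (k + Suc j)))"
    unfolding tail_sum_def using sy by (intro summable_norm) (subst summable_iff_shift[where f="\<lambda>k. cmod (y k)"])
  also have "\<dots> \<le> (\<Sum>k. (1 / s) ^ j * (cmod (y (k + Suc j)) * s ^ (k + Suc j)))"
  proof (rule suminf_le)
    fix k
    have "1 \<le> (1 / s) ^ j * s ^ (k + Suc j)"
      using s by (simp add: power_add power_divide one_le_power flip: power_Suc)
    then show "cmod (y (k + Suc j)) \<le> (1 / s) ^ j * (cmod (y (k + Suc j)) * s ^ (k + Suc j))"
      by (metis mult.left_commute mult_left_mono mult_1_right norm_ge_zero)
  qed (use sy sm' in \<open>auto simp only: summable_iff_shift[where f="\<lambda>k. cmod (y k)"] intro!: summable_mult\<close>)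
  also have "\<dots> = (1 / s) ^ j * (\<Sum>k. cmod (y (k + Suc j)) * s ^ (k + Suc j))"
    by (rule suminf_mult[OF sm'])
  also have "(\<Sum>k. cmod (y (k + Suc j)) * s ^ (k + Suc j)) \<le> (\<Sum>k. cmod (y k) * s ^ k)"
    using suminf_split_initial_segment[OF sm, of "Suc j"] s by (simp add: sum_nonneg)
  finally show "cmod (tail_sum y j) \<le> (\<Sum>k. cmod (y k) * s ^ k) * (1 / s) ^ j"
    using s by (simp add: mult.commute mult_left_mono)
qed

text \<open>The Cauchy product with the geometric series of 1 / (\<zeta> - z); division by \<zeta> -
  z produces the partial sums of c_i \<zeta>^i.\<close>

lemma power_series_divide_sums:
  fixes c :: "nat \<Rightarrow> complex"
  assumes F: "\<And>z. cmod z < 1 \<Longrightarrow> (\<lambda>k. c k * z ^ k) sums F z"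
    and \<zeta>: "cmod \<zeta> = 1" and z: "cmod z < 1"
  shows "(\<lambda>k. (\<Sum>i\<le>k. c i * \<zeta> ^ i) / \<zeta> ^ Suc k * z ^ k) sums (F z / (\<zeta> - z))"
proof -
  have \<zeta>0: "\<zeta> \<noteq> 0" using \<zeta> by auto
  obtain r where r: "cmod z < r" "r < 1" using z dense by blast
  then have "0 < r" by (meson le_less_trans norm_ge_zero)
  have "summable (\<lambda>k. c k * of_real r ^ k)"
    using F[of "of_real r"] r \<open>0 < r\<close> by (auto simp: sums_iff)
  then have s1: "summable (\<lambda>k. norm (c k * z ^ k))"
    by (rule powser_insidea) (use r \<open>0 < r\<close> in auto)
  have nz: "cmod (z / \<zeta>) < 1" using z \<zeta> by (simp add: norm_divide)
  have g: "(\<lambda>k. (z / \<zeta>) ^ k) sums (1 / (1 - z / \<zeta>))" by (rule geometric_sums[OF nz])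
  have s2: "summable (\<lambda>k. norm ((z / \<zeta>) ^ k / \<zeta>))"
    using nz \<zeta> by (simp add: norm_divide norm_power summable_geometric)
  have "(\<lambda>k. \<Sum>i\<le>k. (c i * z ^ i) * ((z / \<zeta>) ^ (k - i) / \<zeta>)) sums 
      ((\<Sum>k. c k * z ^ k) * (\<Sum>k. (z / \<zeta>) ^ k / \<zeta>))"
    by (rule Cauchy_product_sums[OF s1 s2])
  moreover have "(\<Sum>k. c k * z ^ k) = F z" using F[OF z] by (simp add: sums_iff)
  moreover have "(\<Sum>k. (z / \<zeta>) ^ k / \<zeta>) = 1 / (\<zeta> - z)"
  proof -
    have "\<zeta> - z \<noteq> 0" using z \<zeta> by auto
    then have "1 / (1 - z / \<zeta>) / \<zeta> = 1 / (\<zeta> - z)" using \<zeta>0 by (simp add: divide_simps)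
    then show ?thesis using sums_divide[OF g, of \<zeta>] by (simp add: sums_iff)
  qed
  moreover have "(\<Sum>i\<le>k. (c i * z ^ i) * ((z / \<zeta>) ^ (k - i) / \<zeta>)) = (\<Sum>i\<le>k. c i * \<zeta> ^ i) / \<zeta> ^ Suc k * z ^ k" for k
    unfolding sum_divide_distrib sum_distrib_right
  proof (intro sum.cong refl)
    fix i assume "i \<in> {..k}"
    then have "\<zeta> ^ k = \<zeta> ^ i * \<zeta> ^ (k - i)" "z ^ k = z ^ i * z ^ (k - i)"
      by (auto simp flip: power_add)
    then show "(c i * z ^ i) * ((z / \<zeta>) ^ (k - i) / \<zeta>) = c i * \<zeta> ^ i / \<zeta> ^ Suc k * z ^ k"
      using \<zeta>0 by (simp add: power_divide field_simps)
  qed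
  ultimately show ?thesis by simp
qed

text \<open>Writing the \<open>n\<close>-th derivative as \<open>(\<zeta> - z) * Q z\<close> absorbs the Poisson kernel into
  \<open>(cmod (Q z))\<^sup>2\<close>, so that only the diagonal Parseval identity for \<open>Q\<close> is needed.\<close>
theorem local_dirichlet_eq_tail_sum:
  assumes f: "f holomorphic_on ball 0 1" and s: "s > 1"
    and sm: "summable (\<lambda>k. cmod (taylor_coeff f k) * s ^ k)"
    and \<zeta>: "cmod \<zeta> = 1"
  shows "local_dirichlet (Suc m) f \<zeta>
    = (\<Sum>j. ennreal (real (j choose m) * (cmod (tail_sum (\<lambda>k. taylor_coeff f k * \<zeta> ^ k) j))\<^sup>2))"
proof -
  define n where "n = Suc m"
  define y where "y k = taylor_coeff f k * \<zeta> ^ k" for k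
  define t where "t = tail_sum y"
  have ny: "cmod (y k) = cmod (taylor_coeff f k)" for k
    by (simp add: y_def norm_mult norm_power \<zeta>)
  note nt = norm_tail_sum_le[OF s sm[folded ny]]
  define K where "K = (\<Sum>k. cmod (y k) * s ^ k)"
  have y_t: "y (Suc j) = t j - t (Suc j)" for j
    unfolding t_def by (rule tail_sum_diff[symmetric, OF nt(2)])
  \<comment> \<open>The decay s^(-j) of the tails beats the polynomial factor (i + m)! / i!.\<close>
  have st: "summable (\<lambda>i. fact (i + m) / fact i * cmod (t (i + m)))"
  proof (rule summable_comparison_test')
    show "summable (\<lambda>i. K * (1 / s) ^ m * (fact (i + m) / fact i * (1 / s) ^ i))"
      using s by (intro summable_mult summable_rising_factorial_geometric) auto
    fix i :: nat
    have "fact (i + m) / fact i * cmod (t (i + m)) \<le> fact (i + m) / fact i * (K * (1 / s) ^ (i + m))"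
      unfolding t_def K_def by (intro mult_left_mono nt) auto
    then show "norm (fact (i + m) / fact i * cmod (t (i + m))) \<le> K * (1 / s) ^ m * (fact (i + m) / fact i * (1 / s) ^ i)"
      by (simp add: power_add mult_ac)
  qed
  define c where "c k = taylor_coeff ((deriv ^^ n) f) k" for k
  have hf: "(deriv ^^ n) f holomorphic_on ball 0 1"
    using f by (rule holomorphic_higher_deriv) simp
  have F: "(\<lambda>k. c k * z ^ k) sums (deriv ^^ n) f z" if "cmod z < 1" for z
    unfolding c_def by (rule taylor_sums[OF hf that])
  define q where "q k = (\<Sum>i\<le>k. c i * \<zeta> ^ i) / \<zeta> ^ Suc k" for k
  define Q where "Q z = (deriv ^^ n) f z / (\<zeta> - z)" for z
  have Q: "(\<lambda>k. q k * z ^ k) sums Q z" if "cmod z < 1" for z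
    unfolding q_def Q_def by (rule power_series_divide_sums[OF F \<zeta> that])
  \<comment> \<open>Multiplication by \<zeta>^n does not change the modulus and turns c_i \<zeta>^i
    into (i + n)! / i! times y_{i+n}; since n = m + 1, this y is the difference of the tails at i +
    m and i + m + 1.\<close>
  have nq: "cmod (q k) = cmod (\<Sum>i\<le>k. of_real (fact (i + Suc m) / fact i) * (t (i + m) - t (Suc (i + m))))" for k
  proof -
    have "\<zeta> ^ n * (\<Sum>i\<le>k. c i * \<zeta> ^ i) = (\<Sum>i\<le>k. of_real (fact (i + Suc m) / fact i) * (t (i + m) - t (Suc (i + m))))"
      unfolding sum_distrib_left
    proof (intro sum.cong refl)
      fix i
      show "\<zeta> ^ n * (c i * \<zeta> ^ i) = of_real (fact (i + Suc m) / fact i) * (t (i + m) - t (Suc (i + m)))"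
        unfolding y_t[symmetric] y_def c_def n_def taylor_coeff_higher_deriv
        by (simp add: power_add)
    qed
    then have "cmod (\<zeta> ^ n * (\<Sum>i\<le>k. c i * \<zeta> ^ i)) = cmod (\<Sum>i\<le>k. of_real (fact (i + Suc m) / fact i) * (t (i + m) - t (Suc (i + m))))"
      by simp
    then show ?thesis
      by (simp add: q_def norm_mult norm_divide norm_power \<zeta>)
  qed
  have "local_dirichlet (Suc m) f \<zeta> = (\<integral>\<^sup>+ z \<in> ball 0 1. ennreal (1 / (fact n * fact m * pi)) * 
      ennreal ((cmod (Q z))\<^sup>2 * (1 - (cmod z)\<^sup>2) ^ n) \<partial>lborel)"
    unfolding local_dirichlet_def
  proof (intro nn_integral_cong)
    fix z :: complex
    show "ennreal ((cmod ((deriv ^^ Suc m) f z))\<^sup>2 * (1 - (cmod z)\<^sup>2) ^ (Suc m - 1) / (fact (Suc m) * fact (Suc m - 1) * pi)) *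
         ennreal ((1 - (cmod z)\<^sup>2) / (cmod (z - \<zeta>))\<^sup>2) * indicator (ball 0 1) z =
         ennreal (1 / (fact n * fact m * pi)) * ennreal ((cmod (Q z))\<^sup>2 * (1 - (cmod z)\<^sup>2) ^ n) * indicator (ball 0 1) z"
    proof (cases "cmod z < 1")
      case True
      then have 1: "0 \<le> 1 - (cmod z)\<^sup>2" by (simp add: power_le_one)
      have "cmod (z - \<zeta>) = cmod (\<zeta> - z)" by (rule norm_minus_commute)
      then have "(cmod ((deriv ^^ Suc m) f z))\<^sup>2 * (1 - (cmod z)\<^sup>2) ^ (Suc m - 1) / (fact (Suc m) * fact (Suc m - 1) * pi)
         * ((1 - (cmod z)\<^sup>2) / (cmod (z - \<zeta>))\<^sup>2) = 1 / (fact n * fact m * pi) * ((cmod (Q z))\<^sup>2 * (1 - (cmod z)\<^sup>2) ^ n)"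
        by (simp only: Q_def n_def norm_divide power_divide power_Suc) simp
      then have "ennreal ((cmod ((deriv ^^ Suc m) f z))\<^sup>2 * (1 - (cmod z)\<^sup>2) ^ (Suc m - 1) / (fact (Suc m) * fact (Suc m - 1) * pi)) *
         ennreal ((1 - (cmod z)\<^sup>2) / (cmod (z - \<zeta>))\<^sup>2) =
         ennreal (1 / (fact n * fact m * pi)) * ennreal ((cmod (Q z))\<^sup>2 * (1 - (cmod z)\<^sup>2) ^ n)"
        using 1 by (subst (1 2) ennreal_mult''[symmetric]) auto
      then show ?thesis by simp
    qed simp
  qed
  also have "\<dots> = ennreal (1 / (fact n * fact m * pi)) * (\<integral>\<^sup>+ z \<in> ball 0 1. 
      ennreal ((cmod (Q z))\<^sup>2 * (1 - (cmod z)\<^sup>2) ^ n) \<partial>lborel)"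
  proof -
    have "continuous_on (ball 0 1) (\<lambda>z. (cmod (Q z))\<^sup>2 * (1 - (cmod z)\<^sup>2) ^ n)"
      unfolding Q_def using \<zeta> by (intro continuous_intros holomorphic_on_imp_continuous_on[OF hf]) auto
    from borel_measurable_ennreal_times_indicator[OF _ this] show ?thesis
      by (subst nn_integral_cmult[symmetric]) (auto simp: mult.assoc)
  qed
  also have "\<dots> = ennreal (1 / (fact n * fact m * pi)) * (\<Sum>k. ennreal ((cmod (q k))\<^sup>2 * (pi * (fact k * fact n / fact (k + n + 1)))))"
    by (subst disc_parseval[OF Q]) auto
  also have "\<dots> = (\<Sum>k. ennreal (1 / fact m) * ennreal (fact k / fact (k + m + 2) * (cmod (q k))\<^sup>2))"
    unfolding ennreal_suminf_cmult[symmetric]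
  proof (intro suminf_cong)
    fix k
    have "1 / (fact n * fact m * pi) * ((cmod (q k))\<^sup>2 * (pi * (fact k * fact n / fact (k + n + 1))))
      = 1 / fact m * (fact k / fact (k + m + 2) * (cmod (q k))\<^sup>2)"
    proof -
      have "fact (k + n + 1) = (fact (k + m + 2) :: real)" by (simp add: n_def)
      then show ?thesis by (simp only:) (simp add: divide_simps del: fact_Suc)
    qed
    then show "ennreal (1 / (fact n * fact m * pi)) * ennreal ((cmod (q k))\<^sup>2 * (pi * (fact k * fact n / fact (k + n + 1))))
      = ennreal (1 / fact m) * ennreal (fact k / fact (k + m + 2) * (cmod (q k))\<^sup>2)"
      by (subst (1 2) ennreal_mult''[symmetric]) (simp_all del: fact_Suc of_nat_Suc)
  qed
  also have "\<dots> = ennreal (1 / fact m) * (ennreal (fact m) * (\<Sum>j. ennreal (real (j choose m) * (cmod (t j))\<^sup>2)))"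
    unfolding ennreal_suminf_cmult nq suminf_rising_factorial_difference[OF st] ..
  also have "\<dots> = (\<Sum>j. ennreal (real (j choose m) * (cmod (t j))\<^sup>2))"
    by (simp add: mult.assoc[symmetric] flip: ennreal_mult)
  finally show ?thesis unfolding t_def y_def .
qed

section \<open>Multipliers of weighted sequence spaces\<close>

definition conv :: "(nat \<Rightarrow> complex) \<Rightarrow> (nat \<Rightarrow> complex) \<Rightarrow> nat \<Rightarrow> complex" where
  "conv c a k = (\<Sum>i\<le>k. c i * a (k - i))"

text \<open>The square of a weighted l2 norm. Accordingly the constants C below are squares of
  operator norms, a scalar s enters as |s|^2, and the triangle inequality takes the form
  \<open>wnorm_add_le\<close> with factors 2.\<close>

definition wnorm :: "(nat \<Rightarrow> real) \<Rightarrow> (nat \<Rightarrow> complex) \<Rightarrow> ennreal" where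
  "wnorm w a = (\<Sum>k. ennreal (w k * (cmod (a k))\<^sup>2))"

lemma suminf_ennreal_commute:
  fixes f :: "nat \<Rightarrow> nat \<Rightarrow> ennreal"
  shows "(\<Sum>i. \<Sum>j. f i j) = (\<Sum>j. \<Sum>i. f i j)"
  using nn_integral_suminf[of "\<lambda>i j. f j i" "count_space UNIV"]
  by (simp add: nn_integral_count_space_nat)

lemma norm_parallelogram: "(cmod (x + y))\<^sup>2 + (cmod (x - y))\<^sup>2 = 2 * (cmod x)\<^sup>2 + 2 * (cmod y)\<^sup>2"
  unfolding cmod_power2 by (simp add: power2_eq_square algebra_simps)

lemma norm_add_square_le: "(cmod (x + y))\<^sup>2 \<le> 2 * (cmod x)\<^sup>2 + 2 * (cmod y)\<^sup>2"
  using norm_parallelogram[of x y] zero_le_power2[of "cmod (x - y)"] by linarith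

lemma conv_add: "conv c (\<lambda>i. a i + b i) k = conv c a k + conv c b k"
  by (simp add: conv_def algebra_simps sum.distrib)

lemma conv_diff: "conv c (\<lambda>i. a i - b i) k = conv c a k - conv c b k"
  by (simp add: conv_def algebra_simps sum_subtractf)

lemma conv_scale: "conv c (\<lambda>i. s * a i) k = s * conv c a k"
  by (simp add: conv_def sum_distrib_left mult_ac)

lemma ennreal_add_square_le:
  assumes "w \<ge> 0"
  shows "ennreal (w * (cmod (x + y))\<^sup>2) \<le> 2 * ennreal (w * (cmod x)\<^sup>2) + 2 * ennreal (w * (cmod y)\<^sup>2)"
proof -
  have "w * (cmod (x + y))\<^sup>2 \<le> w * (2 * (cmod x)\<^sup>2 + 2 * (cmod y)\<^sup>2)"
    using assms norm_add_square_le by (intro mult_left_mono)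
  also have "\<dots> = 2 * (w * (cmod x)\<^sup>2) + 2 * (w * (cmod y)\<^sup>2)" by (simp add: algebra_simps)
  finally have "ennreal (w * (cmod (x + y))\<^sup>2) \<le> ennreal (2 * (w * (cmod x)\<^sup>2) + 2 * (w * (cmod y)\<^sup>2))"
    by (rule ennreal_leI)
  also have "\<dots> = 2 * ennreal (w * (cmod x)\<^sup>2) + 2 * ennreal (w * (cmod y)\<^sup>2)"
    using assms by (simp add: ennreal_mult)
  finally show ?thesis .
qed

lemma wnorm_add_le:
  assumes "\<And>k. w k \<ge> 0"
  shows "wnorm w (\<lambda>k. a k + b k) \<le> 2 * wnorm w a + 2 * wnorm w b"
proof -
  have "wnorm w (\<lambda>k. a k + b k) \<le> (\<Sum>k. 2 * ennreal (w k * (cmod (a k))\<^sup>2) + 2 * ennreal (w k * (cmod (b k))\<^sup>2))"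
    unfolding wnorm_def by (intro suminf_le ennreal_add_square_le assms summableI)
  also have "\<dots> = 2 * wnorm w a + 2 * wnorm w b"
    unfolding wnorm_def by (subst suminf_add[symmetric]) (auto simp: summableI)
  finally show ?thesis .
qed

lemma wnorm_scale:
  "wnorm w (\<lambda>k. s * a k) = ennreal ((cmod s)\<^sup>2) * wnorm w a"
  unfolding wnorm_def ennreal_suminf_cmult[symmetric]
proof (intro suminf_cong)
  fix k
  have "w k * (cmod (s * a k))\<^sup>2 = (cmod s)\<^sup>2 * (w k * (cmod (a k))\<^sup>2)"
    by (simp add: norm_mult power_mult_distrib mult_ac)
  then show "ennreal (w k * (cmod (s * a k))\<^sup>2) = ennreal ((cmod s)\<^sup>2) * ennreal (w k * (cmod (a k))\<^sup>2)"
    by (simp only: ennreal_mult'[OF zero_le_power2])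
qed

lemma ennreal_sum_le_suminf:
  assumes "\<And>k. f k \<ge> 0"
  shows "ennreal (\<Sum>k<K. f k) \<le> (\<Sum>k. ennreal (f k))"
proof -
  have "(\<Sum>k<K. ennreal (f k)) \<le> (\<Sum>k. ennreal (f k))"
    by (rule sum_le_suminf[OF summableI]) auto
  then show ?thesis using assms by simp
qed

lemma sum_le_wnorm:
  assumes "\<And>k. w k \<ge> 0"
  shows "ennreal (\<Sum>k<K. w k * (cmod (a k))\<^sup>2) \<le> wnorm w a"
  unfolding wnorm_def using assms by (intro ennreal_sum_le_suminf) simp

section \<open>Convolution operators that preserve finite weighted norm are bounded\<close>

lemma suminf_half_power: "(\<Sum>i. (1 / 2) ^ Suc i) = (1 :: real)" "summable (\<lambda>i. (1 / 2 :: real) ^ Suc i)"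
  by (rule sums_unique[OF power_half_series, symmetric], rule sums_summable[OF power_half_series])

text \<open>Cauchy-Schwarz with the weights 2^(-(m+1)) against their inverses; the first family has
  sum 1, so no constant appears.\<close>

lemma norm_suminf_square_le:
  fixes x :: "nat \<Rightarrow> complex"
  assumes fin: "(\<Sum>m. ennreal (2 ^ Suc m * (cmod (x m))\<^sup>2)) < \<infinity>"
  shows "summable (\<lambda>m. cmod (x m))"
    and "ennreal ((cmod (\<Sum>m. x m))\<^sup>2) \<le> (\<Sum>m. ennreal (2 ^ Suc m * (cmod (x m))\<^sup>2))"
proof -
  obtain B where B: "(\<Sum>m. ennreal (2 ^ Suc m * (cmod (x m))\<^sup>2)) = ennreal B" "B \<ge> 0"
    using fin by (cases "\<Sum>m. ennreal (2 ^ Suc m * (cmod (x m))\<^sup>2)") auto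
  have part: "(\<Sum>m<M. cmod (x m)) \<le> sqrt B" for M
  proof -
    have "ennreal (\<Sum>m<M. 2 ^ Suc m * (cmod (x m))\<^sup>2) \<le> ennreal B"
      unfolding B(1)[symmetric] by (rule ennreal_sum_le_suminf) simp
    then have le: "(\<Sum>m<M. 2 ^ Suc m * (cmod (x m))\<^sup>2) \<le> B" using B(2) by (simp only: ennreal_le_iff)
    have "(\<Sum>m<M. cmod (x m))\<^sup>2 = (\<Sum>m<M. sqrt ((1 / 2) ^ Suc m) * (sqrt (2 ^ Suc m) * cmod (x m)))\<^sup>2"
      by (simp only: mult.assoc[symmetric] real_sqrt_mult[symmetric] power_mult_distrib[symmetric]) simp
    also have "\<dots> \<le> (\<Sum>m<M. (sqrt ((1 / 2) ^ Suc m))\<^sup>2) * (\<Sum>m<M. (sqrt (2 ^ Suc m) * cmod (x m))\<^sup>2)"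
      by (rule Cauchy_Schwarz_ineq_sum)
    also have "\<dots> = (\<Sum>m<M. (1 / 2) ^ Suc m) * (\<Sum>m<M. 2 ^ Suc m * (cmod (x m))\<^sup>2)"
      by (simp only: power_mult_distrib real_sqrt_pow2 zero_le_power zero_le_divide_1_iff zero_le_numeral)
    also have "\<dots> \<le> 1 * B"
    proof (rule mult_mono[OF _ le])
      show "(\<Sum>m<M. (1 / 2) ^ Suc m) \<le> (1 :: real)"
        using sum_le_suminf[OF suminf_half_power(2), of "{..<M}"] suminf_half_power(1) by simp
    qed (auto intro: sum_nonneg)
    finally show ?thesis by (simp add: real_le_rsqrt)
  qed
  show sm: "summable (\<lambda>m. cmod (x m))"
    by (rule bounded_imp_summable[where B="sqrt B"]) (simp_all only: norm_ge_zero lessThan_Suc_atMost[symmetric] part)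
  have "cmod (\<Sum>m. x m) \<le> (\<Sum>m. cmod (x m))" using sm by (rule summable_norm)
  also have "\<dots> \<le> sqrt B" using sm part by (rule suminf_le_const)
  finally have "(cmod (\<Sum>m. x m))\<^sup>2 \<le> (sqrt B)\<^sup>2" by (intro power_mono) auto
  then show "ennreal ((cmod (\<Sum>m. x m))\<^sup>2) \<le> (\<Sum>m. ennreal (2 ^ Suc m * (cmod (x m))\<^sup>2))"
    unfolding B(1) using B(2) by (intro ennreal_leI) simp
qed

text \<open>The form of completeness needed for the gliding hump: increments whose squared norms are
  summable against 2^(m+1) can be added coordinate by coordinate. It follows from the scalar case by
  exchanging the two sums.\<close>

lemma wnorm_suminf_le:
  assumes w: "\<And>k. w k > 0"
    and fin: "(\<Sum>m. 2 ^ Suc m * wnorm w (p m)) < \<infinity>"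
  shows "summable (\<lambda>m. p m k)"
    and "wnorm w (\<lambda>k. \<Sum>m. p m k) \<le> (\<Sum>m. 2 ^ Suc m * wnorm w (p m))"
proof -
  have eq: "(\<Sum>m. 2 ^ Suc m * wnorm w (p m)) = (\<Sum>k. ennreal (w k) * (\<Sum>m. ennreal (2 ^ Suc m * (cmod (p m k))\<^sup>2)))"
  proof -
    have "2 ^ Suc m * ennreal (w k * (cmod (p m k))\<^sup>2) = ennreal (w k) * ennreal (2 ^ Suc m * (cmod (p m k))\<^sup>2)" for k m
    proof -
      have "(2::ennreal) ^ Suc m = ennreal (2 ^ Suc m)"
        by (metis ennreal_numeral ennreal_power zero_le_numeral)
      then have "2 ^ Suc m * ennreal (w k * (cmod (p m k))\<^sup>2) = ennreal (2 ^ Suc m * (w k * (cmod (p m k))\<^sup>2))"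
        by (simp only: ennreal_mult' zero_le_power zero_le_numeral)
      also have "\<dots> = ennreal (w k) * ennreal (2 ^ Suc m * (cmod (p m k))\<^sup>2)"
        using w[of k] by (simp only: mult.left_commute[of _ "w k"] ennreal_mult' less_imp_le)
      finally show ?thesis .
    qed
    then have "(\<Sum>m. 2 ^ Suc m * wnorm w (p m)) = (\<Sum>m. \<Sum>k. ennreal (w k) * ennreal (2 ^ Suc m * (cmod (p m k))\<^sup>2))"
      by (simp only: wnorm_def ennreal_suminf_cmult[symmetric])
    then show ?thesis
      by (subst (asm) suminf_ennreal_commute) (simp only: ennreal_suminf_cmult)
  qed
  have fink: "(\<Sum>m. ennreal (2 ^ Suc m * (cmod (p m k))\<^sup>2)) < \<infinity>" for k
  proof -
    define g where "g k = ennreal (w k) * (\<Sum>m. ennreal (2 ^ Suc m * (cmod (p m k))\<^sup>2))" for k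
    have "g k \<le> (\<Sum>k. g k)" using sum_le_suminf[of g "{k}"] by (simp add: summableI)
    then have "g k \<le> (\<Sum>m. 2 ^ Suc m * wnorm w (p m))" unfolding eq g_def .
    then have "ennreal (w k) * (\<Sum>m. ennreal (2 ^ Suc m * (cmod (p m k))\<^sup>2)) < \<infinity>"
      using fin unfolding g_def by (rule le_less_trans)
    then show ?thesis using w[of k] by (auto simp: ennreal_mult_less_top simp del: power_Suc)
  qed
  show "summable (\<lambda>m. p m k)" by (rule summable_norm_cancel[OF norm_suminf_square_le(1)[OF fink]])
  show "wnorm w (\<lambda>k. \<Sum>m. p m k) \<le> (\<Sum>m. 2 ^ Suc m * wnorm w (p m))"
    unfolding eq unfolding wnorm_def
  proof (intro suminf_le summableI)
    fix k
    have "ennreal (w k * (cmod (\<Sum>m. p m k))\<^sup>2) = ennreal (w k) * ennreal ((cmod (\<Sum>m. p m k))\<^sup>2)"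
      using w[of k] by (simp add: ennreal_mult')
    also have "\<dots> \<le> ennreal (w k) * (\<Sum>m. ennreal (2 ^ Suc m * (cmod (p m k))\<^sup>2))"
      by (intro mult_left_mono norm_suminf_square_le(2)[OF fink]) auto
    finally show "ennreal (w k * (cmod (\<Sum>m. p m k))\<^sup>2) \<le> ennreal (w k) * (\<Sum>m. ennreal (2 ^ Suc m * (cmod (p m k))\<^sup>2))" .
  qed
qed

text \<open>The coordinates of the convolution below K involve only the finitely many a_i with i <
  K, and each of these is controlled by the norm since its weight is positive.\<close>

lemma truncated_conv_bounded:
  assumes w: "\<And>k. w k > 0"
  shows "\<exists>M. M \<ge> 0 \<and> (\<forall>a. ennreal (\<Sum>k<K. w k * (cmod (conv c a k))\<^sup>2) \<le> ennreal M * wnorm w a)"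
proof -
  have coeff: "ennreal ((cmod (a k))\<^sup>2) \<le> ennreal (1 / w k) * wnorm w a" for a k
  proof -
    have "ennreal (w k * (cmod (a k))\<^sup>2) \<le> wnorm w a"
      unfolding wnorm_def using sum_le_suminf[of "\<lambda>k. ennreal (w k * (cmod (a k))\<^sup>2)" "{k}"] by (auto simp: summableI)
    then have "ennreal (1 / w k) * ennreal (w k * (cmod (a k))\<^sup>2) \<le> ennreal (1 / w k) * wnorm w a"
      by (intro mult_left_mono) auto
    then show ?thesis using w[of k] by (simp flip: ennreal_mult')
  qed
  have w0: "w k \<ge> 0" for k using w[of k] by simp
  define M where "M = (\<Sum>k<K. w k * (\<Sum>i\<le>k. (cmod (c i))\<^sup>2) * (\<Sum>i\<le>k. 1 / w (k - i)))"
  show ?thesis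
  proof (intro exI[of _ M] conjI allI)
    show "M \<ge> 0" unfolding M_def using w by (intro sum_nonneg mult_nonneg_nonneg) (auto simp: less_imp_le)
    fix a
    have "ennreal (w k * (cmod (conv c a k))\<^sup>2) \<le> ennreal (w k * (\<Sum>i\<le>k. (cmod (c i))\<^sup>2) * (\<Sum>i\<le>k. 1 / w (k - i))) * wnorm w a" for k
    proof -
      have "(cmod (conv c a k))\<^sup>2 \<le> (\<Sum>i\<le>k. cmod (c i) * cmod (a (k - i)))\<^sup>2"
        unfolding conv_def by (intro power_mono order_trans[OF norm_sum]) (auto simp: norm_mult)
      also have "\<dots> \<le> (\<Sum>i\<le>k. (cmod (c i))\<^sup>2) * (\<Sum>i\<le>k. (cmod (a (k - i)))\<^sup>2)"
        by (rule Cauchy_Schwarz_ineq_sum)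
      finally have "w k * (cmod (conv c a k))\<^sup>2 \<le> w k * ((\<Sum>i\<le>k. (cmod (c i))\<^sup>2) * (\<Sum>i\<le>k. (cmod (a (k - i)))\<^sup>2))"
        using w[of k] by (intro mult_left_mono) auto
      then have "ennreal (w k * (cmod (conv c a k))\<^sup>2) \<le> ennreal ((w k * (\<Sum>i\<le>k. (cmod (c i))\<^sup>2)) * (\<Sum>i\<le>k. (cmod (a (k - i)))\<^sup>2))"
        by (intro ennreal_leI) (simp add: mult.assoc)
      also have "\<dots> = ennreal (w k * (\<Sum>i\<le>k. (cmod (c i))\<^sup>2)) * (\<Sum>i\<le>k. ennreal ((cmod (a (k - i)))\<^sup>2))"
        using w[of k] by (subst ennreal_mult) (auto intro!: sum_nonneg mult_nonneg_nonneg simp: less_imp_le)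
      also have "\<dots> \<le> ennreal (w k * (\<Sum>i\<le>k. (cmod (c i))\<^sup>2)) * (\<Sum>i\<le>k. ennreal (1 / w (k - i)) * wnorm w a)"
        by (intro mult_left_mono sum_mono coeff) auto
      also have "\<dots> = ennreal (w k * (\<Sum>i\<le>k. (cmod (c i))\<^sup>2)) * ennreal (\<Sum>i\<le>k. 1 / w (k - i)) * wnorm w a"
        using w0 by (subst sum_ennreal[symmetric]) (auto simp: sum_distrib_right mult.assoc simp del: sum_ennreal)
      also have "\<dots> = ennreal (w k * (\<Sum>i\<le>k. (cmod (c i))\<^sup>2) * (\<Sum>i\<le>k. 1 / w (k - i))) * wnorm w a"
        using w0 by (subst ennreal_mult[symmetric]) (auto intro!: sum_nonneg mult_nonneg_nonneg)
      finally show ?thesis .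
    qed
    then have "(\<Sum>k<K. ennreal (w k * (cmod (conv c a k))\<^sup>2)) \<le> (\<Sum>k<K. ennreal (w k * (\<Sum>i\<le>k. (cmod (c i))\<^sup>2) * (\<Sum>i\<le>k. 1 / w (k - i))) * wnorm w a)"
      by (intro sum_mono)
    also have "\<dots> = ennreal M * wnorm w a"
      unfolding M_def sum_distrib_right[symmetric] using w0
      by (subst sum_ennreal) (auto intro!: sum_nonneg mult_nonneg_nonneg)
    finally show "ennreal (\<Sum>k<K. w k * (cmod (conv c a k))\<^sup>2) \<le> ennreal M * wnorm w a"
      using w0 by (subst sum_ennreal[symmetric]) auto
  qed
qed

text \<open>Sokal's gliding hump: along partial sums \<open>h m\<close> with increments of size at most \<open>\<epsilon> m\<close>,
  a sign choice and the parallelogram law keep the truncated norms of \<open>conv c (h m)\<close> large.\<close>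
theorem conv_bounded:
  assumes w: "\<And>k. w k > 0"
    and fin: "\<And>a. wnorm w a < \<infinity> \<Longrightarrow> wnorm w (conv c a) < \<infinity>"
  shows "\<exists>C>0. \<forall>a. wnorm w (conv c a) \<le> ennreal C * wnorm w a"
proof -
  have w0: "w k \<ge> 0" for k using w[of k] by simp
  define q where "q K a = (\<Sum>k<K. w k * (cmod (conv c a k))\<^sup>2)" for K a
  have q0: "q K a \<ge> 0" for K a unfolding q_def using w0 by (intro sum_nonneg) auto
  have q_par: "q K (\<lambda>i. a i + b i) + q K (\<lambda>i. a i - b i) = 2 * q K a + 2 * q K b" for K a b
    unfolding q_def conv_add conv_diff sum.distrib[symmetric] distrib_left[symmetric] norm_parallelogram
    by (simp add: sum.distrib sum_distrib_left algebra_simps)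
  have q_le: "ennreal (q K a) \<le> wnorm w (conv c a)" for K a
    unfolding q_def using w0 by (rule sum_le_wnorm)
  obtain M where M: "\<And>K. M K \<ge> 0" "\<And>K a. ennreal (q K a) \<le> ennreal (M K) * wnorm w a"
  proof -
    have "\<forall>K. \<exists>M. M \<ge> 0 \<and> (\<forall>a. ennreal (q K a) \<le> ennreal M * wnorm w a)"
      unfolding q_def by (intro allI truncated_conv_bounded w)
    from choice[OF this] obtain M where M: "\<forall>K. M K \<ge> 0 \<and> (\<forall>a. ennreal (q K a) \<le> ennreal (M K) * wnorm w a)" ..
    show ?thesis by (rule that[of M]) (use M in auto)
  qed
  show ?thesis
  proof (rule ccontr)
    assume "\<not> ?thesis"
    then have unb: "\<exists>a. ennreal C * wnorm w a < wnorm w (conv c a)" if "C > 0" for C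
      using that by (meson not_le)
    \<comment> \<open>A sequence violating the bound with constant B / \<epsilon> + 1 is scaled to
      squared norm exactly \<epsilon>; its image then has squared norm above B, and so does some
      finite truncation of it.\<close>
    have big: "\<exists>a K. wnorm w a \<le> ennreal \<epsilon> \<and> q K a > B" if "\<epsilon> > 0" "B \<ge> 0" for \<epsilon> B
    proof -
      have Bp: "B / \<epsilon> + 1 > 0" using that by (intro add_nonneg_pos) auto
      obtain a where a: "ennreal (B / \<epsilon> + 1) * wnorm w a < wnorm w (conv c a)"
        using unb[OF Bp] by blast
      have "wnorm w a \<noteq> \<infinity>" using a Bp by (auto simp: ennreal_mult_top)
      then obtain N where N: "wnorm w a = ennreal N" "N \<ge> 0" by (cases "wnorm w a") auto
      have "N \<noteq> 0"
      proof
        assume "N = 0"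
        then have "ennreal (q K a) = 0" for K using M(2)[of K a] N by simp
        then have "q K a = 0" for K
          using q0[of K a] by (metis antisym ennreal_eq_0_iff)
        then have "(\<Sum>k<K. w k * (cmod (conv c a k))\<^sup>2) = 0" for K
          by (simp only: q_def)
        then have "w k * (cmod (conv c a k))\<^sup>2 = 0" for k
          by (metis add_0 sum.lessThan_Suc)
        then have "wnorm w (conv c a) = 0" by (simp only: wnorm_def) simp
        then show False using a by simp
      qed
      then have Npos: "N > 0" using N by simp
      define s where "s = sqrt (\<epsilon> / N)"
      have s2: "s\<^sup>2 = \<epsilon> / N" using Npos that by (simp add: s_def)
      define b where "b = (\<lambda>i. complex_of_real s * a i)"
      have nb: "wnorm w b = ennreal \<epsilon>"
        unfolding b_def wnorm_scale N(1) using s2 Npos that by (simp flip: ennreal_mult')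
      have "ennreal B \<le> ennreal (s\<^sup>2) * (ennreal (B / \<epsilon> + 1) * ennreal N)"
        using s2 Npos that by (auto simp: field_simps simp flip: ennreal_mult' intro!: ennreal_leI)
      also have "\<dots> < ennreal (s\<^sup>2) * wnorm w (conv c a)"
        using a s2 Npos that unfolding N(1)
        by (intro ennreal_mult_strict_left_mono) auto
      also have "\<dots> = wnorm w (conv c b)"
        using wnorm_scale[of w "complex_of_real s" "conv c a"] by (simp add: b_def conv_scale[abs_def])
      finally have lt: "ennreal B < wnorm w (conv c b)" .
      have "\<exists>K. ennreal B < (\<Sum>k<K. ennreal (w k * (cmod (conv c b k))\<^sup>2))"
        using lt unfolding wnorm_def suminf_eq_SUP less_SUP_iff by auto
      then obtain K where "ennreal B < ennreal (q K b)"
        unfolding q_def using w0 by (auto simp: sum_ennreal)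
      then have "B < q K b" using that by (simp add: ennreal_less_iff)
      then show ?thesis using nb by (intro exI[of _ b] exI[of _ K]) simp
    qed
    have step: "\<exists>p K. wnorm w p \<le> ennreal \<epsilon> \<and> q K (\<lambda>i. h i + p i) > B" if "\<epsilon> > 0" "B \<ge> 0" for \<epsilon> B h
    proof -
      from big[OF that] obtain a K where a: "wnorm w a \<le> ennreal \<epsilon>" "q K a > B" by blast
      have "q K (\<lambda>i. h i + a i) + q K (\<lambda>i. h i - a i) \<ge> 2 * q K a"
        using q_par[of K h a] q0[of K h] by simp
      then have "q K (\<lambda>i. h i + a i) > B \<or> q K (\<lambda>i. h i - a i) > B"
        using a(2) by linarith
      then show ?thesis
      proof
        assume "q K (\<lambda>i. h i + a i) > B"
        then show ?thesis using a(1) by (intro exI[of _ a] exI[of _ K]) simp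
      next
        assume "q K (\<lambda>i. h i - a i) > B"
        moreover have "wnorm w (\<lambda>i. - a i) = wnorm w a" by (simp add: wnorm_def)
        ultimately show ?thesis using a(1) by (intro exI[of _ "\<lambda>i. - a i"] exI[of _ K]) simp
      qed
    qed
    \<comment> \<open>A state consists of the current partial sum, the squared size allowed for the
      next increment, and the truncation length at which the partial sum was made large.\<close>
    define R where "R = (\<lambda>(m::nat) (x :: (nat \<Rightarrow> complex) \<times> real \<times> nat) y. 
       wnorm w (\<lambda>i. fst y i - fst x i) \<le> ennreal (fst (snd x)) \<and> 
       q (snd (snd y)) (fst y) > real m \<and> fst (snd y) \<le> fst (snd x) / 4 \<and> 4 * fst (snd y) * M (snd (snd y)) \<le> 1)"
    define P where "P = (\<lambda>(m::nat) (x :: (nat \<Rightarrow> complex) \<times> real \<times> nat). fst (snd x) > 0 \<and> (m = 0 \<longrightarrow> fst x = (\<lambda>_. 0)))"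
    have "\<exists>f. \<forall>n. P n (f n) \<and> R n (f n) (f (Suc n))"
    proof (rule dependent_nat_choice)
      show "\<exists>x. P 0 x" by (rule exI[of _ "(\<lambda>_. 0, 1, 0)"]) (simp add: P_def)
      fix x n assume "P n x"
      then have e: "fst (snd x) > 0" by (simp add: P_def)
      obtain p K where p: "wnorm w p \<le> ennreal (fst (snd x))" "q K (\<lambda>i. fst x i + p i) > real n"
        using step[OF e, of "real n" "fst x"] by auto
      \<comment> \<open>The quarter makes all later increments summable against powers of 2. The
        second bound protects the present truncation: the later increments together have squared
        norm at most 4 e', so they change it by a vector of squared truncated norm at most
        1.\<close>
      define e' where "e' = min (fst (snd x) / 4) (1 / (4 * (M K + 1)))"
      have "e' > 0" using e M(1)[of K] by (simp add: e'_def)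
      moreover have "4 * e' * M K \<le> 1"
      proof -
        have "4 * e' * M K \<le> 4 * (1 / (4 * (M K + 1))) * M K"
          using M(1)[of K] by (intro mult_right_mono mult_left_mono) (auto simp: e'_def)
        also have "\<dots> \<le> 1" using M(1)[of K] by (simp add: divide_simps)
        finally show ?thesis .
      qed
      ultimately show "\<exists>y. P (Suc n) y \<and> R n x y"
        using p by (intro exI[of _ "(\<lambda>i. fst x i + p i, e', K)"]) (auto simp: P_def R_def e'_def)
    qed
    then obtain f where f: "\<And>n. P n (f n)" "\<And>n. R n (f n) (f (Suc n))" by blast
    define h where "h n = fst (f n)" for n
    define \<epsilon> where "\<epsilon> n = fst (snd (f n))" for n
    define K where "K n = snd (snd (f n))" for n
    have e0: "\<epsilon> n > 0" for n using f(1)[of n] by (simp add: P_def \<epsilon>_def)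
    have h0: "h 0 = (\<lambda>_. 0)" using f(1)[of 0] by (simp add: P_def h_def)
    have hd: "wnorm w (\<lambda>i. h (Suc n) i - h n i) \<le> ennreal (\<epsilon> n)"
      and hq: "q (K (Suc n)) (h (Suc n)) > real n" and e4: "\<epsilon> (Suc n) \<le> \<epsilon> n / 4"
      and eM: "4 * \<epsilon> (Suc n) * M (K (Suc n)) \<le> 1" for n
      using f(2)[of n] by (auto simp: R_def h_def \<epsilon>_def K_def)
    have ei: "\<epsilon> (n + i) \<le> \<epsilon> n * (1 / 4) ^ i" for n i
    proof (induction i)
      case (Suc i)
      then show ?case using e4[of "n + i"] by simp
    qed simp
    \<comment> \<open>The factor 2^(i+1) 4^(-i) equals 4 times 2^(-(i+1)), and these halves sum to
      1.\<close>
    have tail_sum: "(\<Sum>i. 2 ^ Suc i * wnorm w (\<lambda>k. h (Suc (n + i)) k - h (n + i) k)) \<le> ennreal (4 * \<epsilon> n)" for n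
    proof -
      have "(\<Sum>i. 2 ^ Suc i * wnorm w (\<lambda>k. h (Suc (n + i)) k - h (n + i) k)) \<le> (\<Sum>i. ennreal (4 * \<epsilon> n * (1 / 2) ^ Suc i))"
      proof (intro suminf_le summableI)
        fix i
        have "2 ^ Suc i * wnorm w (\<lambda>k. h (Suc (n + i)) k - h (n + i) k) \<le> 2 ^ Suc i * ennreal (\<epsilon> n * (1 / 4) ^ i)"
          using hd[of "n + i"] ennreal_leI[OF ei[of n i]] by (intro mult_left_mono) auto
        also have two: "(2 :: ennreal) ^ Suc i = ennreal (2 ^ Suc i)"
          by (metis ennreal_numeral ennreal_power zero_le_numeral)
        also have "ennreal (2 ^ Suc i) * ennreal (\<epsilon> n * (1 / 4) ^ i) = ennreal (2 ^ Suc i * (\<epsilon> n * (1 / 4) ^ i))"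
          by (rule ennreal_mult'[symmetric]) simp
        also have "2 ^ Suc i * (\<epsilon> n * (1 / 4) ^ i) = 4 * \<epsilon> n * (1 / 2) ^ Suc i"
        proof -
          have "(4::real) ^ i = 2 ^ i * 2 ^ i" by (simp flip: power_mult_distrib)
          then show ?thesis by (simp add: power_one_over divide_simps)
        qed
        finally show "2 ^ Suc i * wnorm w (\<lambda>k. h (Suc (n + i)) k - h (n + i) k) \<le> ennreal (4 * \<epsilon> n * (1 / 2) ^ Suc i)"
          by (simp only: two)
      qed
      also have "\<dots> = ennreal (4 * \<epsilon> n)"
        using suminf_half_power sums_mult[of "\<lambda>i. (1 / 2 :: real) ^ Suc i" 1 "4 * \<epsilon> n"] e0[of n]
        by (intro suminf_ennreal_eq) (auto simp: sums_iff)
      finally show ?thesis .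
    qed
    then have tail_fin: "(\<Sum>i. 2 ^ Suc i * wnorm w (\<lambda>k. h (Suc (n + i)) k - h (n + i) k)) < \<infinity>" for n
      by (rule le_less_trans) simp
    define H where "H k = (\<Sum>i. h (Suc (0 + i)) k - h (0 + i) k)" for k
    have H_eq: "(\<Sum>i. h (Suc (n + i)) k - h (n + i) k) = H k - h n k" for n k
    proof -
      have sm: "summable (\<lambda>i. h (Suc (0 + i)) k - h (0 + i) k)"
        using wnorm_suminf_le(1)[where w=w, OF w tail_fin[of 0]] .
      have "(\<Sum>i<n. h (Suc (0 + i)) k - h (0 + i) k) = h n k"
        using sum_lessThan_telescope[of "\<lambda>i. h i k" n] h0 by simp
      then show ?thesis
        using suminf_split_initial_segment[OF sm, of n] by (simp add: H_def add.commute)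
    qed
    have H_tail: "wnorm w (\<lambda>k. H k - h n k) \<le> ennreal (4 * \<epsilon> n)" for n
      using order_trans[OF wnorm_suminf_le(2)[where w=w, OF w tail_fin[of n]] tail_sum[of n]] by (simp only: H_eq)
    have "wnorm w H < \<infinity>"
      using H_tail[of 0] by (simp add: h0 le_less_trans)
    then obtain B where B: "wnorm w (conv c H) = ennreal B" "B \<ge> 0"
      using fin[of H] by (cases "wnorm w (conv c H)") auto
    \<comment> \<open>Since h = H - (H - h), the parallelogram law gives q(h) <= 2 q(H) + 2 q(H -
      h), and the two values on the right are at most B and 1.\<close>
    have "real n < 2 * B + 2" for n
    proof -
      let ?K = "K (Suc n)"
      have "ennreal (q ?K (\<lambda>k. H k - h (Suc n) k)) \<le> ennreal (M ?K) * ennreal (4 * \<epsilon> (Suc n))"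
        by (rule order_trans[OF M(2) mult_left_mono[OF H_tail]]) simp
      also have "\<dots> = ennreal (4 * \<epsilon> (Suc n) * M ?K)"
        using M(1)[of ?K] by (simp add: mult.commute flip: ennreal_mult')
      also have "\<dots> \<le> ennreal 1" using eM by (intro ennreal_leI)
      finally have 1: "q ?K (\<lambda>k. H k - h (Suc n) k) \<le> 1" by (simp del: ennreal_1)
      have "ennreal (q ?K H) \<le> ennreal B" using q_le[of ?K H] B by simp
      then have 2: "q ?K H \<le> B" using B by simp
      have "q ?K (\<lambda>k. H k + (H k - h (Suc n) k)) + q ?K (\<lambda>k. H k - (H k - h (Suc n) k)) \<le> 2 * B + 2"
        unfolding q_par using 1 2 by simp
      then have "q ?K (h (Suc n)) \<le> 2 * B + 2"
        using q0[of ?K "\<lambda>k. H k + (H k - h (Suc n) k)"] by simp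
      then show ?thesis using hq[of n] by simp
    qed
    then show False using reals_Archimedean2[of "2 * B + 2"] by (meson less_asym)
  qed
qed

text \<open>The triangular factor of the matrix r^|k-l|. It is the moving-average form of a
  stationary autoregressive process: \<open>ar_weight r m k\<close> is the coefficient in X_k of the
  innovation introduced at time m, where X_0 has unit variance and X_k is r X_{k-1} plus sqrt (1 -
  r^2) times a new innovation.\<close>

definition ar_weight :: "real \<Rightarrow> nat \<Rightarrow> nat \<Rightarrow> real" where
  "ar_weight r m k = (if k < m then 0 else if m = 0 then r ^ k else sqrt (1 - r\<^sup>2) * r ^ (k - m))"

text \<open>Passing from l to l + 1 multiplies the old innovations by r and adds one with variance 1
  - r^2; the two contributions r^2 and 1 - r^2 recombine to the next power.\<close>

lemma sum_ar_weight:
  assumes r: "0 \<le> r" "r < 1" and "l \<le> k"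
  shows "(\<Sum>m\<le>l. ar_weight r m k * ar_weight r m l) = r ^ (k - l)"
  using \<open>l \<le> k\<close>
proof (induction l)
  case 0
  then show ?case by (simp add: ar_weight_def)
next
  case (Suc l)
  have r2: "r\<^sup>2 \<le> 1" using r by (simp add: power_le_one)
  have step: "ar_weight r m (Suc l) = r * ar_weight r m l" if "m \<le> l" for m
    using that by (simp add: ar_weight_def Suc_diff_le)
  have "(\<Sum>m\<le>Suc l. ar_weight r m k * ar_weight r m (Suc l))
    = r * (\<Sum>m\<le>l. ar_weight r m k * ar_weight r m l) + ar_weight r (Suc l) k * ar_weight r (Suc l) (Suc l)"
    by (simp add: step sum_distrib_left mult_ac)
  also have "\<dots> = r * r ^ (k - l) + (1 - r\<^sup>2) * r ^ (k - Suc l)"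
  proof -
    have "sqrt (1 - r\<^sup>2) * sqrt (1 - r\<^sup>2) = 1 - r\<^sup>2" using r2 by simp
    then show ?thesis using Suc by (simp add: ar_weight_def)
  qed
  also have "k - l = Suc (k - Suc l)" using Suc.prems by simp
  also have "r * r ^ Suc (k - Suc l) + (1 - r\<^sup>2) * r ^ (k - Suc l) = r ^ (k - Suc l)"
    by (simp add: power2_eq_square algebra_simps)
  finally show ?case .
qed

lemma sum_ar_weight':
  assumes r: "0 \<le> r" "r < 1" and "l \<le> k"
  shows "(\<Sum>m\<le>k. ar_weight r m k * ar_weight r m l) = r ^ (k - l)"
proof -
  have "(\<Sum>m\<le>k. ar_weight r m k * ar_weight r m l) = (\<Sum>m\<le>l. ar_weight r m k * ar_weight r m l)"
    by (rule sum.mono_neutral_right) (use assms in \<open>auto simp: ar_weight_def\<close>)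
  then show ?thesis using sum_ar_weight[OF assms] by simp
qed

text \<open>By \<open>sum_ar_weight'\<close> the matrix \<open>r\<^bsup>\<bar>k - l\<bar>\<^esup>\<close> is a Gram matrix with unit diagonal,
  hence a contractive Schur multiplier.\<close>
lemma conv_dilation_bounded:
  assumes w: "\<And>k. w k \<ge> 0" and C: "\<And>a. wnorm w (conv c a) \<le> ennreal C * wnorm w a"
    and r: "0 \<le> r" "r < 1"
  shows "wnorm w (conv (\<lambda>k. c k * of_real (r ^ k)) a) \<le> ennreal C * wnorm w a"
proof -
  define u where "u m k = ar_weight r m k" for m k
  define b where "b m = (\<lambda>k. of_real (u m k) * a k)" for m
  \<comment> \<open>The entry at (k, k - i) is multiplied by r^i, the inner product of the Gram
    vectors of k and k - i. One vector acts on the output, and the other is absorbed into the input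
    as \<open>b m\<close>.\<close>
  have eq: "conv (\<lambda>k. c k * of_real (r ^ k)) a k = (\<Sum>m\<le>k. of_real (u m k) * conv c (b m) k)" for k
  proof -
    have "(\<Sum>m\<le>k. of_real (u m k) * conv c (b m) k) = (\<Sum>m\<le>k. \<Sum>i\<le>k. c i * a (k - i) * of_real (u m k * u m (k - i)))"
      by (simp add: conv_def b_def sum_distrib_left mult_ac)
    also have "\<dots> = (\<Sum>i\<le>k. c i * a (k - i) * of_real (\<Sum>m\<le>k. u m k * u m (k - i)))"
      by (subst sum.swap) (simp only: sum_distrib_left of_real_sum)
    also have "\<dots> = (\<Sum>i\<le>k. c i * a (k - i) * of_real (r ^ i))"
      unfolding u_def using sum_ar_weight'[OF r] by (intro sum.cong refl) simp
    finally show ?thesis by (simp add: conv_def mult_ac)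
  qed
  have usq: "(\<Sum>m\<le>k. (u m k)\<^sup>2) = 1" for k
    using sum_ar_weight'[OF r, of k k] by (simp add: u_def power2_eq_square)
  \<comment> \<open>Unit length of the Gram vector at k, used on the output side; the same fact on
    the input side later recombines the norms of the \<open>b m\<close> into the norm of a.\<close>
  have coord: "(cmod (conv (\<lambda>k. c k * of_real (r ^ k)) a k))\<^sup>2 \<le> (\<Sum>m\<le>k. (cmod (conv c (b m) k))\<^sup>2)" for k
  proof -
    have "cmod (conv (\<lambda>k. c k * of_real (r ^ k)) a k) \<le> (\<Sum>m\<le>k. \<bar>u m k\<bar> * cmod (conv c (b m) k))"
      unfolding eq by (rule order_trans[OF norm_sum]) (simp add: norm_mult)
    then have "(cmod (conv (\<lambda>k. c k * of_real (r ^ k)) a k))\<^sup>2 \<le> (\<Sum>m\<le>k. \<bar>u m k\<bar> * cmod (conv c (b m) k))\<^sup>2"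
      by (intro power_mono) auto
    also have "\<dots> \<le> (\<Sum>m\<le>k. \<bar>u m k\<bar>\<^sup>2) * (\<Sum>m\<le>k. (cmod (conv c (b m) k))\<^sup>2)"
      by (rule Cauchy_Schwarz_ineq_sum)
    finally show ?thesis by (simp add: usq)
  qed
  have "wnorm w (conv (\<lambda>k. c k * of_real (r ^ k)) a) \<le> (\<Sum>k. \<Sum>m. ennreal (w k * (cmod (conv c (b m) k))\<^sup>2))"
    unfolding wnorm_def
  proof (intro suminf_le summableI)
    fix k
    have "ennreal (w k * (cmod (conv (\<lambda>k. c k * of_real (r ^ k)) a k))\<^sup>2) \<le> ennreal (\<Sum>m<Suc k. w k * (cmod (conv c (b m) k))\<^sup>2)"
      unfolding lessThan_Suc_atMost sum_distrib_left[symmetric]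
      by (intro ennreal_leI mult_left_mono coord w)
    also have "\<dots> \<le> (\<Sum>m. ennreal (w k * (cmod (conv c (b m) k))\<^sup>2))"
      by (rule ennreal_sum_le_suminf) (simp add: w)
    finally show "ennreal (w k * (cmod (conv (\<lambda>k. c k * of_real (r ^ k)) a k))\<^sup>2) \<le> (\<Sum>m. ennreal (w k * (cmod (conv c (b m) k))\<^sup>2))" .
  qed
  also have "\<dots> = (\<Sum>m. wnorm w (conv c (b m)))"
    unfolding wnorm_def by (rule suminf_ennreal_commute)
  also have "\<dots> \<le> (\<Sum>m. ennreal C * wnorm w (b m))"
    by (intro suminf_le summableI C)
  also have "\<dots> = ennreal C * (\<Sum>k. \<Sum>m. ennreal (w k * (cmod (b m k))\<^sup>2))"
    unfolding wnorm_def by (subst suminf_ennreal_commute) simp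
  also have "(\<Sum>k. \<Sum>m. ennreal (w k * (cmod (b m k))\<^sup>2)) = wnorm w a"
    unfolding wnorm_def
  proof (intro suminf_cong)
    fix k
    have "(\<Sum>m. ennreal (w k * (cmod (b m k))\<^sup>2)) = (\<Sum>m\<le>k. ennreal (w k * (cmod (b m k))\<^sup>2))"
      by (rule suminf_finite) (auto simp: b_def u_def ar_weight_def)
    also have "\<dots> = ennreal (\<Sum>m\<le>k. w k * (cmod (b m k))\<^sup>2)"
      using w by (intro sum_ennreal) auto
    also have "(\<Sum>m\<le>k. w k * (cmod (b m k))\<^sup>2) = w k * (cmod (a k))\<^sup>2 * (\<Sum>m\<le>k. (u m k)\<^sup>2)"
      by (simp add: b_def norm_mult power_mult_distrib sum_distrib_left mult_ac)
    finally show "(\<Sum>m. ennreal (w k * (cmod (b m k))\<^sup>2)) = ennreal (w k * (cmod (a k))\<^sup>2)"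
      by (simp add: usq)
  qed
  finally show ?thesis .
qed

text \<open>Multiplying c_k by \<zeta>^k conjugates the convolution operator with the diagonal
  unitary of entries \<zeta>^k, so the norm is unchanged.\<close>

lemma conv_rotation_bounded:
  assumes C: "\<And>a. wnorm w (conv c a) \<le> ennreal C * wnorm w a" and \<zeta>: "cmod \<zeta> = 1"
  shows "wnorm w (conv (\<lambda>k. c k * \<zeta> ^ k) a) \<le> ennreal C * wnorm w a"
proof -
  have \<zeta>0: "\<zeta> \<noteq> 0" using \<zeta> by auto
  have "conv (\<lambda>k. c k * \<zeta> ^ k) a k = \<zeta> ^ k * conv c (\<lambda>i. a i / \<zeta> ^ i) k" for k
    unfolding conv_def sum_distrib_left using \<zeta>0
    by (intro sum.cong refl) (simp add: power_diff)
  then have "wnorm w (conv (\<lambda>k. c k * \<zeta> ^ k) a) = wnorm w (conv c (\<lambda>i. a i / \<zeta> ^ i))"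
    by (simp add: wnorm_def norm_mult norm_power \<zeta>)
  also have "\<dots> \<le> ennreal C * wnorm w (\<lambda>i. a i / \<zeta> ^ i)" by (rule C)
  also have "wnorm w (\<lambda>i. a i / \<zeta> ^ i) = wnorm w a"
    by (simp add: wnorm_def norm_divide norm_power \<zeta>)
  finally show ?thesis .
qed

lemma coeff_le_wnorm:
  assumes "\<And>k. w k \<ge> 1"
  shows "ennreal ((cmod (a k))\<^sup>2) \<le> wnorm w a"
proof -
  have "ennreal ((cmod (a k))\<^sup>2) \<le> ennreal (w k * (cmod (a k))\<^sup>2)"
    using assms[of k] by (intro ennreal_leI) (simp add: mult_le_cancel_right1)
  also have "\<dots> \<le> wnorm w a"
    unfolding wnorm_def using sum_le_suminf[of "\<lambda>k. ennreal (w k * (cmod (a k))\<^sup>2)" "{k}"] by (simp add: summableI)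
  finally show ?thesis .
qed

text \<open>A multiplier of norm \<open>sqrt C\<close> is bounded by \<open>sqrt C\<close>: compare the growth of \<open>F z ^ m\<close> at a fixed \<open>z\<close> with \<open>C ^ m\<close>.\<close>
lemma multiplier_bounded:
  assumes w: "\<And>k. w k \<ge> 1" and C0: "C > 0"
    and C: "\<And>a. wnorm w (conv c a) \<le> ennreal C * wnorm w a"
    and F: "\<And>z. cmod z < 1 \<Longrightarrow> (\<lambda>k. c k * z ^ k) sums F z"
    and z: "cmod z < 1"
  shows "(cmod (F z))\<^sup>2 \<le> C"
proof -
  \<comment> \<open>The Taylor coefficients of the powers F^m, obtained by applying the operator m
    times to the constant function 1.\<close>
  define p where "p m = (conv c ^^ m) (\<lambda>k. if k = 0 then 1 else 0)" for m
  have p0: "p 0 = (\<lambda>k. if k = 0 then 1 else 0)" and pS: "p (Suc m) = conv c (p m)" for m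
    by (simp_all add: p_def)
  have n0: "wnorm w (p 0) = ennreal (w 0)"
  proof -
    have "wnorm w (p 0) = (\<Sum>k\<in>{0}. ennreal (w k * (cmod (p 0 k))\<^sup>2))"
      unfolding wnorm_def by (rule suminf_finite) (auto simp: p0)
    then show ?thesis by (simp add: p0)
  qed
  have np: "wnorm w (p m) \<le> ennreal (C ^ m * w 0)" for m
  proof (induction m)
    case (Suc m)
    have "wnorm w (p (Suc m)) \<le> ennreal C * ennreal (C ^ m * w 0)"
      unfolding pS using order_trans[OF C mult_left_mono[OF Suc]] by simp
    also have "\<dots> = ennreal (C ^ Suc m * w 0)" using C0 by (simp add: mult.assoc flip: ennreal_mult')
    finally show ?case .
  qed (simp add: n0)
  have w00: "w 0 \<ge> 0" using w[of 0] by simp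
  have coeff: "cmod (p m k) \<le> sqrt (C ^ m * w 0)" for m k
  proof -
    have "ennreal ((cmod (p m k))\<^sup>2) \<le> ennreal (C ^ m * w 0)"
      using coeff_le_wnorm[where w=w, OF w] np[of m] by (rule order_trans)
    then show ?thesis using w00 C0 by (simp add: real_le_rsqrt)
  qed
  define z' where "z' = cmod z"
  have z': "0 \<le> z'" "z' < 1" using z by (auto simp: z'_def)
  have sp: "summable (\<lambda>k. cmod (p m k * z ^ k))" for m
  proof (rule summable_comparison_test')
    show "summable (\<lambda>k. sqrt (C ^ m * w 0) * z' ^ k)" using z' by (intro summable_mult summable_geometric) auto
    show "norm (cmod (p m k * z ^ k)) \<le> sqrt (C ^ m * w 0) * z' ^ k" for k
      using coeff[of m k] by (auto simp: norm_mult norm_power z'_def intro!: mult_right_mono)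
  qed
  \<comment> \<open>Here \<open>p 1\<close> is c itself, so the coefficient bound for the powers
    already yields absolute convergence of the series of F.\<close>
  have sc: "summable (\<lambda>k. cmod (c k * z ^ k))"
    using sp[of 1] by (simp add: pS[of 0, simplified] p0 conv_def if_distrib cong: if_cong)
  have Fm: "(\<Sum>k. p m k * z ^ k) = F z ^ m" for m
  proof (induction m)
    case 0
    have "(\<Sum>k. p 0 k * z ^ k) = (\<Sum>k\<in>{0}. p 0 k * z ^ k)"
      by (rule suminf_finite) (auto simp: p0)
    then show ?case by (simp add: p0)
  next
    case (Suc m)
    have "(\<Sum>k. p (Suc m) k * z ^ k) = (\<Sum>k. \<Sum>i\<le>k. (c i * z ^ i) * (p m (k - i) * z ^ (k - i)))"
      unfolding pS conv_def sum_distrib_right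
      by (intro suminf_cong sum.cong refl) (simp add: mult_ac flip: power_add)
    also have "\<dots> = (\<Sum>k. c k * z ^ k) * (\<Sum>k. p m k * z ^ k)"
      by (rule Cauchy_product[OF sc sp, symmetric])
    finally show ?case using F[OF z] Suc by (simp add: sums_iff)
  qed
  have bound: "cmod (F z) ^ m \<le> sqrt (C ^ m * w 0) / (1 - z')" for m
  proof -
    have "cmod (F z) ^ m = cmod (\<Sum>k. p m k * z ^ k)" by (simp add: Fm norm_power)
    also have "\<dots> \<le> (\<Sum>k. cmod (p m k * z ^ k))" by (rule summable_norm[OF sp])
    also have "\<dots> \<le> (\<Sum>k. sqrt (C ^ m * w 0) * z' ^ k)"
      using coeff[of m] z' sp
      by (intro suminf_le summable_mult summable_geometric) (auto simp: norm_mult norm_power z'_def intro!: mult_right_mono)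
    also have "\<dots> = sqrt (C ^ m * w 0) / (1 - z')"
      using z' by (simp add: suminf_mult summable_geometric suminf_geometric)
    finally show ?thesis .
  qed
  have bound2: "((cmod (F z))\<^sup>2 / C) ^ m \<le> w 0 / (1 - z')\<^sup>2" for m
  proof -
    have "(cmod (F z) ^ m)\<^sup>2 \<le> (sqrt (C ^ m * w 0) / (1 - z'))\<^sup>2"
      by (rule power_mono[OF bound]) simp
    also have "\<dots> = C ^ m * (w 0 / (1 - z')\<^sup>2)"
      using C0 w00 by (simp add: power_divide)
    finally have "((cmod (F z))\<^sup>2) ^ m \<le> C ^ m * (w 0 / (1 - z')\<^sup>2)"
      by (simp add: mult.commute flip: power_mult)
    then show ?thesis using C0 by (simp add: power_divide field_simps)
  qed
  show ?thesis
  proof (rule ccontr)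
    assume "\<not> ?thesis"
    then have "1 < (cmod (F z))\<^sup>2 / C" using C0 by (simp add: field_simps)
    then obtain m where "w 0 / (1 - z')\<^sup>2 < ((cmod (F z))\<^sup>2 / C) ^ m"
      using real_arch_pow by blast
    then show False using bound2[of m] by simp
  qed
qed

section \<open>Multipliers of \<open>H_sigma j\<close>\<close>

lemma summable_norm_conv:
  assumes x: "summable (\<lambda>k. cmod (x k))" and y: "summable (\<lambda>k. cmod (y k))"
  shows "summable (conv x y)" "suminf (conv x y) = suminf x * suminf y"
  using Cauchy_product_sums[OF x y] by (auto simp: sums_iff conv_def[abs_def])

lemma tail_sum_eq:
  assumes "summable y"
  shows "tail_sum y j = suminf y - (\<Sum>i\<le>j. y i)"
  using suminf_split_initial_segment[OF assms, of "Suc j"]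
  by (simp only: tail_sum_def lessThan_Suc_atMost) simp

text \<open>The sequence form of \<open>F G - F(\<zeta>) G(\<zeta>) = F (G - G(\<zeta>)) + G(\<zeta>) (F - F(\<zeta>))\<close>.\<close>
lemma tail_sum_conv:
  assumes x: "summable (\<lambda>k. cmod (x k))" and y: "summable (\<lambda>k. cmod (y k))"
  shows "tail_sum (conv x y) j = conv x (tail_sum y) j + suminf y * tail_sum x j"
proof -
  have sx: "summable x" and sy: "summable y" using x y by (auto intro: summable_norm_cancel)
  have "(\<Sum>k\<le>j. conv x y k) = (\<Sum>i\<le>j. x i * (\<Sum>l\<le>j - i. y l))"
  proof -
    have "(\<Sum>k\<le>j. conv x y k) = (\<Sum>(k, i)\<in>(SIGMA k:{..j}. {..k}). x i * y (k - i))"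
      unfolding conv_def by (subst sum.Sigma) auto
    also have "\<dots> = (\<Sum>(i, l)\<in>(SIGMA i:{..j}. {..j - i}). x i * y l)"
      by (rule sum.reindex_bij_witness[of _ "\<lambda>(i, l). (i + l, i)" "\<lambda>(k, i). (i, k - i)"]) auto
    also have "\<dots> = (\<Sum>i\<le>j. x i * (\<Sum>l\<le>j - i. y l))"
      unfolding sum_distrib_left by (subst sum.Sigma) auto
    finally show ?thesis .
  qed
  also have "\<dots> = (\<Sum>i\<le>j. x i * (suminf y - tail_sum y (j - i)))"
    by (simp add: tail_sum_eq[OF sy])
  also have "\<dots> = suminf y * (\<Sum>i\<le>j. x i) - conv x (tail_sum y) j"
    by (simp add: conv_def algebra_simps sum_subtractf sum_distrib_left)
  finally show ?thesis
    unfolding tail_sum_eq[OF summable_norm_conv(1)[OF x y]] tail_sum_eq[OF sx] summable_norm_conv(2)[OF x y]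
    by (simp add: algebra_simps)
qed

text \<open>The binomial weight is zero for k < j. Raising it to 1 there gives a genuine norm with
  weights at least 1, as \<open>conv_bounded\<close> and \<open>multiplier_bounded\<close> require,
  and changes only finitely many terms, so the space stays the same.\<close>

definition sigma_weight :: "nat \<Rightarrow> nat \<Rightarrow> real" where
  "sigma_weight j k = real (max 1 (k choose j))"

lemma sigma_weight_ge_1: "sigma_weight j k \<ge> 1"
  by (simp add: sigma_weight_def)

lemma wnorm_sigma_weight_le:
  "wnorm (sigma_weight j) a \<le> (\<Sum>k. ennreal (real (k choose j) * (cmod (a k))\<^sup>2)) + (\<Sum>k<j. ennreal ((cmod (a k))\<^sup>2))"
proof -
  have "wnorm (sigma_weight j) a \<le> (\<Sum>k. ennreal (real (k choose j) * (cmod (a k))\<^sup>2) + (if k < j then ennreal ((cmod (a k))\<^sup>2) else 0))"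
    unfolding wnorm_def
  proof (intro suminf_le summableI)
    fix k
    have "sigma_weight j k = real (k choose j)" if "\<not> k < j"
    proof -
      have "1 \<le> k choose j" using that zero_less_binomial[of j k] by linarith
      then show ?thesis by (simp only: sigma_weight_def max_absorb2)
    qed
    moreover have "sigma_weight j k = 1" if "k < j"
      using that by (simp add: sigma_weight_def binomial_eq_0)
    ultimately show "ennreal (sigma_weight j k * (cmod (a k))\<^sup>2)
      \<le> ennreal (real (k choose j) * (cmod (a k))\<^sup>2) + (if k < j then ennreal ((cmod (a k))\<^sup>2) else 0)"
      by (cases "k < j") auto
  qed
  also have "\<dots> = (\<Sum>k. ennreal (real (k choose j) * (cmod (a k))\<^sup>2)) + (\<Sum>k. if k < j then ennreal ((cmod (a k))\<^sup>2) else 0)"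
    by (rule suminf_add[symmetric]) (auto intro: summableI)
  also have "(\<Sum>k. if k < j then ennreal ((cmod (a k))\<^sup>2) else 0) = (\<Sum>k<j. ennreal ((cmod (a k))\<^sup>2))"
    by (subst suminf_finite[of "{..<j}"]) auto
  finally show ?thesis .
qed

lemma sum_binomial_le_wnorm:
  "(\<Sum>k. ennreal (real (k choose j) * (cmod (a k))\<^sup>2)) \<le> wnorm (sigma_weight j) a"
  unfolding wnorm_def
  by (intro suminf_le summableI ennreal_leI mult_right_mono) (auto simp: sigma_weight_def)

lemma H_sigma_iff:
  "f \<in> H_sigma j \<longleftrightarrow> f holomorphic_on ball 0 1 \<and> wnorm (sigma_weight j) (taylor_coeff f) < \<infinity>"
proof -
  have "D_sigma j f < \<infinity> \<longleftrightarrow> wnorm (sigma_weight j) (taylor_coeff f) < \<infinity>"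
  proof
    assume "D_sigma j f < \<infinity>"
    then show "wnorm (sigma_weight j) (taylor_coeff f) < \<infinity>"
      unfolding D_sigma_def by (intro le_less_trans[OF wnorm_sigma_weight_le]) (simp add: ennreal_add_eq_top)
  next
    assume "wnorm (sigma_weight j) (taylor_coeff f) < \<infinity>"
    then show "D_sigma j f < \<infinity>"
      unfolding D_sigma_def by (rule le_less_trans[OF sum_binomial_le_wnorm])
  qed
  then show ?thesis by (auto simp: H_sigma_def)
qed

lemma taylor_coeff_eqI: "f has_fps_expansion F \<Longrightarrow> taylor_coeff f k = fps_nth F k"
  by (simp add: taylor_coeff_def fps_nth_fps_expansion)

lemma taylor_coeff_mult:
  assumes "f holomorphic_on ball 0 1" "g holomorphic_on ball 0 1"
  shows "taylor_coeff (\<lambda>z. f z * g z) = conv (taylor_coeff f) (taylor_coeff g)"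
proof
  fix k
  have F: "f has_fps_expansion fps_expansion f 0" and G: "g has_fps_expansion fps_expansion g 0"
    using assms by (auto intro!: has_fps_expansion_fps_expansion[of "ball 0 1"])
  show "taylor_coeff (\<lambda>z. f z * g z) k = conv (taylor_coeff f) (taylor_coeff g) k"
    using taylor_coeff_eqI[OF F] taylor_coeff_eqI[OF G] taylor_coeff_eqI[OF has_fps_expansion_mult[OF F G]]
    by (simp add: fps_mult_nth conv_def atLeast0AtMost)
qed

lemma taylor_coeff_dilation:
  assumes "f holomorphic_on ball 0 1" "cmod u \<le> 1"
  shows "taylor_coeff (\<lambda>z. f (u * z)) k = u ^ k * taylor_coeff f k"
proof -
  have "(deriv ^^ k) (\<lambda>z. f (u * z)) 0 = u ^ k * (deriv ^^ k) f (u * 0)"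
  proof (rule higher_deriv_compose_linear[OF assms(1), where S="ball 0 1"])
    fix z :: complex assume "z \<in> ball 0 1"
    then show "u * z \<in> ball 0 1"
      using assms(2) mult_left_le_one_le[of "cmod z" "cmod u"] by (simp add: norm_mult)
  qed auto
  then show ?thesis by (simp add: taylor_coeff_def)
qed

text \<open>Weights at least 1 keep the coefficients bounded, so the power series converges in the
  disc. This lets \<open>Mult_H_sigma_bounded\<close> pass from arbitrary sequences of finite norm,
  as in \<open>conv_bounded\<close>, to functions in the space.\<close>

lemma ex_holomorphic_taylor_coeff:
  assumes w: "\<And>k. w k \<ge> 1" and "wnorm w a < \<infinity>"
  shows "\<exists>f. f holomorphic_on ball 0 1 \<and> taylor_coeff f = a"
proof -
  obtain B where B: "wnorm w a = ennreal B" "B \<ge> 0" using assms(2) by (cases "wnorm w a") auto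
  have "cmod (a k) \<le> sqrt B" for k
    using coeff_le_wnorm[of w a k, OF w] B by (simp add: real_le_rsqrt)
  then have le: "norm (norm (a n * of_real r ^ n)) \<le> sqrt B * r ^ n" if "0 < r" for r n
    using that by (auto simp: norm_mult norm_power intro!: mult_right_mono)
  have sm: "summable (\<lambda>n. a n * of_real r ^ n)" if "0 < r" "r < 1" for r
  proof (rule summable_norm_cancel, rule summable_comparison_test')
    show "summable (\<lambda>n. sqrt B * r ^ n)" using that by (intro summable_mult summable_geometric) auto
  qed (rule le[OF that(1)])
  have rad: "fps_conv_radius (Abs_fps a) \<ge> 1"
    unfolding fps_conv_radius_def by (rule conv_radius_geI_ex') (use sm in \<open>simp add: one_ereal_def\<close>)
  have "eval_fps (Abs_fps a) holomorphic_on ball 0 1"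
  proof (rule holomorphic_on_eval_fps, rule subsetI)
    fix z :: complex assume "z \<in> ball 0 1"
    then have "ereal (cmod z) < 1" by (simp add: one_ereal_def)
    then show "z \<in> eball 0 (fps_conv_radius (Abs_fps a))"
      using less_le_trans[OF _ rad] by (simp add: in_eball_iff)
  qed
  moreover have "eval_fps (Abs_fps a) has_fps_expansion Abs_fps a"
    using rad by (intro eval_fps_has_fps_expansion) (auto intro: less_le_trans[of 0 1])
  then have "taylor_coeff (eval_fps (Abs_fps a)) = a"
    by (simp add: fun_eq_iff taylor_coeff_eqI)
  ultimately show ?thesis by blast
qed

lemma Mult_H_sigma_bounded:
  assumes "f \<in> Mult (H_sigma j)"
  shows "\<exists>C>0. \<forall>a. wnorm (sigma_weight j) (conv (taylor_coeff f) a) \<le> ennreal C * wnorm (sigma_weight j) a"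
proof (rule conv_bounded)
  fix k show "sigma_weight j k > 0" using sigma_weight_ge_1[of j k] by simp
next
  fix a assume a: "wnorm (sigma_weight j) a < \<infinity>"
  obtain g where g: "g holomorphic_on ball 0 1" "taylor_coeff g = a"
    using ex_holomorphic_taylor_coeff[OF sigma_weight_ge_1 a] by blast
  then have "g \<in> H_sigma j" using a by (simp add: H_sigma_iff)
  then have "(\<lambda>z. f z * g z) \<in> H_sigma j" and f: "f holomorphic_on ball 0 1"
    using assms by (auto simp: Mult_def)
  then show "wnorm (sigma_weight j) (conv (taylor_coeff f) a) < \<infinity>"
    using g by (simp add: H_sigma_iff taylor_coeff_mult)
qed

section \<open>Algebraic closure of the multipliers and their inclusion in \<open>H2\<close>\<close>

lemma H_sigma_add:
  assumes "f \<in> H_sigma j" "g \<in> H_sigma j"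
  shows "(\<lambda>z. f z + g z) \<in> H_sigma j"
proof -
  have h: "f holomorphic_on ball 0 1" "g holomorphic_on ball 0 1" using assms by (auto simp: H_sigma_def)
  have "taylor_coeff (\<lambda>z. f z + g z) = (\<lambda>k. taylor_coeff f k + taylor_coeff g k)"
    using h by (auto simp: fun_eq_iff taylor_coeff_def higher_deriv_add[where S="ball 0 1"] add_divide_distrib)
  then have "wnorm (sigma_weight j) (taylor_coeff (\<lambda>z. f z + g z)) 
      \<le> 2 * wnorm (sigma_weight j) (taylor_coeff f) + 2 * wnorm (sigma_weight j) (taylor_coeff g)"
    using wnorm_add_le[of "sigma_weight j"] order_trans[OF zero_le_one sigma_weight_ge_1] by simp
  also have "\<dots> < \<infinity>" using assms by (simp add: H_sigma_iff ennreal_mult_less_top)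
  finally show ?thesis using h by (auto simp: H_sigma_iff intro!: holomorphic_intros)
qed

lemma H_sigma_cmult:
  assumes "f \<in> H_sigma j"
  shows "(\<lambda>z. c * f z) \<in> H_sigma j"
proof -
  have h: "f holomorphic_on ball 0 1" using assms by (auto simp: H_sigma_def)
  have "taylor_coeff (\<lambda>z. c * f z) = (\<lambda>k. c * taylor_coeff f k)"
    using h by (auto simp: fun_eq_iff taylor_coeff_def higher_deriv_cmult[where A="ball 0 1"])
  then show ?thesis using assms h
    by (auto simp: H_sigma_iff wnorm_scale ennreal_mult_less_top intro!: holomorphic_intros)
qed

lemma Mult_add:
  assumes "f \<in> Mult (H_sigma j)" "g \<in> Mult (H_sigma j)"
  shows "(\<lambda>z. f z + g z) \<in> Mult (H_sigma j)"
  using assms H_sigma_add by (auto simp: Mult_def distrib_right intro!: holomorphic_intros)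

lemma Mult_cmult:
  assumes "f \<in> Mult (H_sigma j)"
  shows "(\<lambda>z. c * f z) \<in> Mult (H_sigma j)"
  using assms H_sigma_cmult by (auto simp: Mult_def mult.assoc intro!: holomorphic_intros)

lemma Mult_mult:
  assumes "f \<in> Mult H" "g \<in> Mult H"
  shows "(\<lambda>z. f z * g z) \<in> Mult H"
  using assms by (auto simp: Mult_def mult.assoc intro!: holomorphic_intros)

text \<open>A multiplier is its own product with the constant 1, which lies in the space.\<close>

lemma Mult_subset_H_sigma: "Mult (H_sigma j) \<subseteq> H_sigma j"
proof
  fix f assume f: "f \<in> Mult (H_sigma j)"
  have "taylor_coeff (\<lambda>z. 1) = (\<lambda>k. if k = 0 then 1 else 0)"
    using taylor_coeff_eqI[OF has_fps_expansion_1] by (auto simp: fun_eq_iff)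
  moreover have "wnorm (sigma_weight j) (\<lambda>k. if k = 0 then 1 else 0) = (\<Sum>k\<in>{0}. ennreal (sigma_weight j k * (cmod (if k = 0 then 1 else 0))\<^sup>2))"
    unfolding wnorm_def by (rule suminf_finite) auto
  ultimately have "(\<lambda>z. 1) \<in> H_sigma j" by (simp add: H_sigma_iff)
  then show "f \<in> H_sigma j" using f by (force simp: Mult_def)
qed

lemma one_in_Mult: "(\<lambda>z. 1) \<in> Mult (H_sigma j)"
  by (auto simp: Mult_def)

lemma H_sigma_subset_H2: "H_sigma j \<subseteq> H2"
proof
  fix f assume f: "f \<in> H_sigma j"
  have "(\<Sum>k. ennreal ((cmod (taylor_coeff f k))\<^sup>2)) \<le> wnorm (sigma_weight j) (taylor_coeff f)"
    unfolding wnorm_def using sigma_weight_ge_1[of j]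
    by (intro suminf_le summableI ennreal_leI) (simp add: mult_le_cancel_right1)
  also have "\<dots> < \<infinity>" using f by (simp add: H_sigma_iff)
  finally have "summable (\<lambda>k. (cmod (taylor_coeff f k))\<^sup>2)"
    by (intro summable_suminf_not_top) auto
  then show "f \<in> H2" using f by (simp add: H2_def H_sigma_def)
qed

section \<open>Weighted Dirichlet integrals of measures on the circle\<close>

lemma dilation_in_disc:
  fixes z :: complex
  assumes "0 < r" "r < 1" "cmod z < 1"
  shows "cmod (of_real r * z) < 1"
  using assms mult_left_le_one_le[of "cmod z" r] by (simp add: norm_mult)

lemma holomorphic_dilation:
  assumes "f holomorphic_on ball 0 1" "0 < r" "r < 1"
  shows "(\<lambda>z. f (of_real r * z)) holomorphic_on ball 0 1"
proof -
  have "(f \<circ> (\<lambda>z. of_real r * z)) holomorphic_on ball 0 1"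
    by (rule holomorphic_on_compose_gen[OF _ assms(1)])
       (use dilation_in_disc[OF assms(2,3)] in \<open>auto intro!: holomorphic_intros\<close>)
  then show ?thesis by (simp add: o_def)
qed

lemma higher_deriv_dilation:
  assumes "f holomorphic_on ball 0 1" "0 < r" "r < 1" "cmod z < 1"
  shows "(deriv ^^ n) (\<lambda>z. f (of_real r * z)) z = of_real (r ^ n) * (deriv ^^ n) f (of_real r * z)"
proof -
  have "(deriv ^^ n) (\<lambda>z. f (of_real r * z)) z = of_real r ^ n * (deriv ^^ n) f (of_real r * z)"
    by (rule higher_deriv_compose_linear[OF assms(1), where S="ball 0 1"])
       (use assms dilation_in_disc[OF assms(2,3)] in auto)
  then show ?thesis by simp
qed

text \<open>With w = r z, p = 1 - |z|^2, d = |z - \<zeta>| and p', d' their values at w, the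
  triangle inequality d' <= d + (1 - r)|z| together with p <= 2 d and (1 - r)|z| <= p' gives p d' <=
  3 p' d. The exponent \<open>Suc m\<close> supplies the second factor p that allows squaring p / d;
  the remaining p^m only grows under dilation.\<close>

lemma dilation_kernel_le:
  fixes z \<zeta> :: complex
  assumes z: "cmod z < 1" and r: "0 < r" "r < 1" and \<zeta>: "cmod \<zeta> = 1"
  shows "(1 - (cmod z)\<^sup>2) ^ Suc m * ((1 - (cmod z)\<^sup>2) / (cmod (z - \<zeta>))\<^sup>2)
    \<le> 9 * ((1 - (cmod (of_real r * z))\<^sup>2) ^ Suc m * ((1 - (cmod (of_real r * z))\<^sup>2) / (cmod (of_real r * z - \<zeta>))\<^sup>2))"
proof -
  define w where "w = of_real r * z"
  define p where "p = 1 - (cmod z)\<^sup>2"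
  define p' where "p' = 1 - (cmod w)\<^sup>2"
  define d where "d = cmod (z - \<zeta>)"
  define d' where "d' = cmod (w - \<zeta>)"
  have w: "cmod w = r * cmod z" using r by (simp add: w_def norm_mult)
  have wz: "cmod w \<le> cmod z" unfolding w using r by (simp add: mult_left_le_one_le)
  then have w1: "cmod w < 1" using z by simp
  have p: "0 \<le> p" "p \<le> p'" using z wz by (auto simp: p_def p'_def power_le_one intro: power_mono)
  have tri: "1 - cmod y \<le> cmod (y - \<zeta>)" for y
    using norm_triangle_ineq2[of \<zeta> y] \<zeta> by (simp add: norm_minus_commute)
  have d: "d \<ge> 1 - cmod z" "d' \<ge> 1 - cmod w" using tri by (auto simp: d_def d'_def)
  then have dpos: "d > 0" "d' > 0" using z w1 by auto
  have "d' \<le> d + (1 - r) * cmod z"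
  proof -
    have "w - \<zeta> = (z - \<zeta>) - of_real (1 - r) * z" by (simp add: w_def algebra_simps)
    then have "d' \<le> cmod (z - \<zeta>) + cmod (of_real (1 - r) * z)"
      unfolding d'_def by (metis norm_triangle_ineq4)
    then show ?thesis using r by (simp add: d_def norm_mult del: of_real_diff)
  qed
  then have "p * d' \<le> p * d + p * ((1 - r) * cmod z)"
    using p by (metis distrib_left mult_left_mono)
  also have "p * d \<le> p' * d" using p dpos by (intro mult_right_mono) auto
  also have "p * ((1 - r) * cmod z) \<le> (2 * d) * p'"
  proof (rule mult_mono)
    have "p = (1 + cmod z) * (1 - cmod z)" by (simp add: p_def power2_eq_square algebra_simps)
    also have "\<dots> \<le> 2 * (1 - cmod z)" using z by (intro mult_right_mono) auto
    finally show "p \<le> 2 * d" using d by simp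
    have "(1 - r) * cmod z \<le> 1 - cmod w" using z w by (simp add: algebra_simps)
    also have "\<dots> \<le> p'" unfolding p'_def using w1 by (simp add: power2_eq_square mult_left_le_one_le)
    finally show "(1 - r) * cmod z \<le> p'" .
  qed (use dpos r in auto)
  finally have "p * d' \<le> 3 * (p' * d)" by (simp add: algebra_simps)
  then have "p / d \<le> 3 * (p' / d')" using dpos by (simp add: field_simps)
  then have "(p / d)\<^sup>2 \<le> (3 * (p' / d'))\<^sup>2" using p dpos by (intro power_mono) auto
  then have "p ^ m * (p / d)\<^sup>2 \<le> p' ^ m * (3 * (p' / d'))\<^sup>2"
    using p by (intro mult_mono[OF power_mono]) auto
  then show ?thesis
    unfolding p_def[symmetric] w_def[symmetric] p'_def[symmetric] d_def[symmetric] d'_def[symmetric]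
    by (simp add: power_divide power2_eq_square mult_ac)
qed

section \<open>Dirichlet integrals of measures carried by the circle\<close>

definition circle_measure :: "complex measure \<Rightarrow> bool" where
  "circle_measure \<mu> \<longleftrightarrow> finite_measure \<mu> \<and> sets \<mu> = sets borel \<and> emeasure \<mu> (- sphere 0 1) = 0"

lemma circle_measureD:
  assumes "circle_measure \<mu>"
  shows "sigma_finite_measure \<mu>" "sets \<mu> = sets borel" "emeasure \<mu> (- sphere 0 1) = 0"
    and "emeasure \<mu> (space \<mu>) < top"
proof -
  have fin: "finite_measure \<mu>" using assms by (simp add: circle_measure_def)
  show "sigma_finite_measure \<mu>" by (rule finite_measure.axioms(1)[OF fin])
  show "emeasure \<mu> (space \<mu>) < top"
    using finite_measure.emeasure_finite[OF fin] by (metis infinity_ennreal_def top.not_eq_extremum)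
qed (use assms in \<open>auto simp: circle_measure_def\<close>)

lemma AE_circle:
  assumes \<mu>: "circle_measure \<mu>"
  shows "AE \<zeta> in \<mu>. cmod \<zeta> = 1"
proof (rule AE_I)
  have "space \<mu> = UNIV" using sets_eq_imp_space_eq[OF circle_measureD(2)[OF \<mu>]] by simp
  then show "{\<zeta> \<in> space \<mu>. cmod \<zeta> \<noteq> 1} \<subseteq> - sphere 0 1" by auto
  show "- sphere 0 1 \<in> sets \<mu>" unfolding circle_measureD(2)[OF \<mu>] by (rule borel_open) (simp add: open_Compl)
qed (rule circle_measureD(3)[OF \<mu>])

lemma borel_measurable_poisson_kernel:
  assumes \<mu>: "circle_measure \<mu>"
  shows "(\<lambda>(z, \<zeta>). ennreal ((1 - (cmod z)\<^sup>2) / (cmod (z - \<zeta>))\<^sup>2)) \<in> borel_measurable (borel \<Otimes>\<^sub>M \<mu>)"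
proof -
  have "(\<lambda>(z, \<zeta>). ennreal ((1 - (cmod z)\<^sup>2) / (cmod (z - \<zeta>))\<^sup>2)) \<in> borel_measurable (borel \<Otimes>\<^sub>M borel)"
    by measurable
  also have "borel_measurable (borel \<Otimes>\<^sub>M borel) = borel_measurable (borel \<Otimes>\<^sub>M \<mu>)"
    by (intro measurable_cong_sets sets_pair_measure_cong) (auto simp: circle_measureD(2)[OF \<mu>])
  finally show ?thesis .
qed

lemma borel_measurable_poisson:
  assumes \<mu>: "circle_measure \<mu>"
  shows "poisson \<mu> \<in> borel_measurable borel"
  unfolding poisson_def[abs_def]
  by (rule sigma_finite_measure.borel_measurable_nn_integral[OF circle_measureD(1)[OF \<mu>]])
     (rule borel_measurable_poisson_kernel[OF \<mu>])

lemma poisson_finite: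
  assumes \<mu>: "circle_measure \<mu>"
    and z: "cmod z < 1"
  shows "poisson \<mu> z < \<infinity>"
proof -
  have "poisson \<mu> z \<le> (\<integral>\<^sup>+ \<zeta>. ennreal ((1 - (cmod z)\<^sup>2) / (1 - cmod z)\<^sup>2) \<partial>\<mu>)"
    unfolding poisson_def
  proof (rule nn_integral_mono_AE, use AE_circle[OF \<mu>] in eventually_elim)
    fix \<zeta> :: complex assume "cmod \<zeta> = 1"
    then have "1 - cmod z \<le> cmod (z - \<zeta>)" using norm_triangle_ineq2[of \<zeta> z] by (simp add: norm_minus_commute)
    then have "(1 - cmod z)\<^sup>2 \<le> (cmod (z - \<zeta>))\<^sup>2" using z by (intro power_mono) auto
    then show "ennreal ((1 - (cmod z)\<^sup>2) / (cmod (z - \<zeta>))\<^sup>2) \<le> ennreal ((1 - (cmod z)\<^sup>2) / (1 - cmod z)\<^sup>2)"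
      using z by (intro ennreal_leI divide_left_mono) (auto simp: power_le_one intro!: mult_pos_pos)
  qed
  also have "\<dots> < \<infinity>"
    using circle_measureD(4)[OF \<mu>] by (simp add: ennreal_mult_less_top)
  finally show ?thesis .
qed

text \<open>Everything in \<open>D_mu\<close> except the derivative of f, with the disc built in as
  an indicator: scaling and Fatou can then be applied to integrals over the whole plane.\<close>

definition dweight :: "complex measure \<Rightarrow> nat \<Rightarrow> complex \<Rightarrow> ennreal" where
  "dweight \<mu> n z = ennreal ((1 - (cmod z)\<^sup>2) ^ (n - 1) / (fact n * fact (n - 1) * pi)) * poisson \<mu> z * indicator (ball 0 1) z"

lemma borel_measurable_dweight:
  assumes \<mu>: "circle_measure \<mu>"
  shows "dweight \<mu> n \<in> borel_measurable borel"
  unfolding dweight_def[abs_def]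
  by (intro borel_measurable_times_ennreal borel_measurable_indicator borel_measurable_poisson[OF \<mu>]) auto

lemma dweight_finite:
  assumes \<mu>: "circle_measure \<mu>"
  shows "dweight \<mu> n z < top"
  using poisson_finite[OF \<mu>, of z] by (auto simp: dweight_def ennreal_mult_less_top split: split_indicator)

lemma D_mu_eq_dweight: "D_mu \<mu> n f = (\<integral>\<^sup>+ z. ennreal ((cmod ((deriv ^^ n) f z))\<^sup>2) * dweight \<mu> n z \<partial>lborel)"
  unfolding D_mu_def
proof (intro nn_integral_cong)
  fix z :: complex
  have "ennreal ((cmod ((deriv ^^ n) f z))\<^sup>2 * (1 - (cmod z)\<^sup>2) ^ (n - 1) / (fact n * fact (n - 1) * pi))
    = ennreal ((cmod ((deriv ^^ n) f z))\<^sup>2) * ennreal ((1 - (cmod z)\<^sup>2) ^ (n - 1) / (fact n * fact (n - 1) * pi))"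
    by (subst ennreal_mult'[symmetric]) auto
  then show "ennreal ((cmod ((deriv ^^ n) f z))\<^sup>2 * (1 - (cmod z)\<^sup>2) ^ (n - 1) / (fact n * fact (n - 1) * pi)) * poisson \<mu> z * indicator (ball 0 1) z
    = ennreal ((cmod ((deriv ^^ n) f z))\<^sup>2) * dweight \<mu> n z"
    by (simp only: dweight_def mult.assoc)
qed

lemma borel_measurable_deriv_dweight:
  assumes \<mu>: "circle_measure \<mu>"
    and "f holomorphic_on ball 0 1"
  shows "(\<lambda>z. ennreal ((cmod ((deriv ^^ n) f z))\<^sup>2) * dweight \<mu> n z) \<in> borel_measurable borel"
proof -
  have "(\<lambda>z. ennreal ((cmod ((deriv ^^ n) f z))\<^sup>2) * indicator (ball 0 1) z) \<in> borel_measurable borel"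
    using holomorphic_on_imp_continuous_on[OF holomorphic_higher_deriv[OF assms(2)]]
    by (intro borel_measurable_ennreal_times_indicator continuous_intros) auto
  then have "(\<lambda>z. ennreal ((cmod ((deriv ^^ n) f z))\<^sup>2) * indicator (ball 0 1) z * dweight \<mu> n z) \<in> borel_measurable borel"
    by (rule borel_measurable_times_ennreal[OF _ borel_measurable_dweight[OF \<mu>]])
  also have "(\<lambda>z. ennreal ((cmod ((deriv ^^ n) f z))\<^sup>2) * indicator (ball 0 1) z * dweight \<mu> n z)
    = (\<lambda>z. ennreal ((cmod ((deriv ^^ n) f z))\<^sup>2) * dweight \<mu> n z)"
    by (auto simp: fun_eq_iff dweight_def split: split_indicator)
  finally show ?thesis .
qed

text \<open>A single pointwise comparison that serves sums, scalar multiples and the product rule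
  for n = 1.\<close>

lemma D_mu_combination_le:
  assumes \<mu>: "circle_measure \<mu>"
    and f: "f holomorphic_on ball 0 1" and g: "g holomorphic_on ball 0 1" and AB: "A \<ge> 0" "B \<ge> 0"
    and le: "\<And>z. cmod z < 1 \<Longrightarrow> (cmod ((deriv ^^ n) h z))\<^sup>2 \<le> A * (cmod ((deriv ^^ n) f z))\<^sup>2 + B * (cmod ((deriv ^^ n) g z))\<^sup>2"
  shows "D_mu \<mu> n h \<le> ennreal A * D_mu \<mu> n f + ennreal B * D_mu \<mu> n g"
proof -
  have "D_mu \<mu> n h \<le> (\<integral>\<^sup>+ z. ennreal A * (ennreal ((cmod ((deriv ^^ n) f z))\<^sup>2) * dweight \<mu> n z)
       + ennreal B * (ennreal ((cmod ((deriv ^^ n) g z))\<^sup>2) * dweight \<mu> n z) \<partial>lborel)"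
    unfolding D_mu_eq_dweight
  proof (intro nn_integral_mono)
    fix z :: complex
    show "ennreal ((cmod ((deriv ^^ n) h z))\<^sup>2) * dweight \<mu> n z \<le> ennreal A * (ennreal ((cmod ((deriv ^^ n) f z))\<^sup>2) * dweight \<mu> n z)
       + ennreal B * (ennreal ((cmod ((deriv ^^ n) g z))\<^sup>2) * dweight \<mu> n z)"
    proof (cases "cmod z < 1")
      case True
      have "ennreal ((cmod ((deriv ^^ n) h z))\<^sup>2) \<le> ennreal A * ennreal ((cmod ((deriv ^^ n) f z))\<^sup>2) + ennreal B * ennreal ((cmod ((deriv ^^ n) g z))\<^sup>2)"
        using ennreal_leI[OF le[OF True]] AB by (simp add: ennreal_mult)
      then have "ennreal ((cmod ((deriv ^^ n) h z))\<^sup>2) * dweight \<mu> n z \<le> (ennreal A * ennreal ((cmod ((deriv ^^ n) f z))\<^sup>2) + ennreal B * ennreal ((cmod ((deriv ^^ n) g z))\<^sup>2)) * dweight \<mu> n z"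
        by (rule mult_right_mono) simp
      then show ?thesis by (simp add: distrib_right mult.assoc)
    qed (simp add: dweight_def)
  qed
  also have "\<dots> = ennreal A * D_mu \<mu> n f + ennreal B * D_mu \<mu> n g"
    unfolding D_mu_eq_dweight using borel_measurable_deriv_dweight[OF \<mu> f] borel_measurable_deriv_dweight[OF \<mu> g]
    by (simp add: nn_integral_add nn_integral_cmult)
  finally show ?thesis .
qed

text \<open>Tonelli's theorem; it reduces estimates for \<mu> to estimates at a single boundary
  point.\<close>

lemma D_mu_eq_local_dirichlet:
  assumes \<mu>: "circle_measure \<mu>"
    and f: "f holomorphic_on ball 0 1"
  shows "D_mu \<mu> n f = (\<integral>\<^sup>+ \<zeta>. local_dirichlet n f \<zeta> \<partial>\<mu>)"
    and "local_dirichlet n f \<in> borel_measurable \<mu>"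
proof -
  have P: "pair_sigma_finite (lborel :: complex measure) \<mu>"
    by (intro pair_sigma_finite.intro sigma_finite_lborel circle_measureD(1)[OF \<mu>])
  define A where "A z = ennreal ((cmod ((deriv ^^ n) f z))\<^sup>2 * (1 - (cmod z)\<^sup>2) ^ (n - 1) / (fact n * fact (n - 1) * pi)) * indicator (ball 0 1) z" for z
  define k where "k z \<zeta> = ennreal ((1 - (cmod z)\<^sup>2) / (cmod (z - \<zeta>))\<^sup>2)" for z \<zeta> :: complex
  have [measurable]: "A \<in> borel_measurable borel"
    unfolding A_def[abs_def]
    using holomorphic_on_imp_continuous_on[OF holomorphic_higher_deriv[OF f]]
    by (intro borel_measurable_ennreal_times_indicator continuous_intros) auto
  have [measurable]: "case_prod k \<in> borel_measurable (borel \<Otimes>\<^sub>M \<mu>)"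
    unfolding k_def[abs_def] by (rule borel_measurable_poisson_kernel[OF \<mu>])
  have kz: "k z \<in> borel_measurable \<mu>" for z
    using measurable_Pair2[OF \<open>case_prod k \<in> _\<close>, of z] by simp
  have sp: "sets (lborel \<Otimes>\<^sub>M \<mu>) = sets (borel \<Otimes>\<^sub>M \<mu>)"
    by (intro sets_pair_measure_cong) auto
  have meas: "(\<lambda>(z, \<zeta>). A z * k z \<zeta>) \<in> borel_measurable (lborel \<Otimes>\<^sub>M \<mu>)"
    unfolding measurable_cong_sets[OF sp refl] by measurable
  have ld: "local_dirichlet n f = (\<lambda>\<zeta>. \<integral>\<^sup>+z. A z * k z \<zeta> \<partial>lborel)"
    unfolding local_dirichlet_def A_def k_def by (auto simp: fun_eq_iff mult_ac intro!: nn_integral_cong)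
  have "D_mu \<mu> n f = (\<integral>\<^sup>+z. A z * (\<integral>\<^sup>+\<zeta>. k z \<zeta> \<partial>\<mu>) \<partial>lborel)"
    unfolding D_mu_def poisson_def A_def k_def by (auto simp: mult_ac intro!: nn_integral_cong)
  also have "\<dots> = (\<integral>\<^sup>+z. (\<integral>\<^sup>+\<zeta>. A z * k z \<zeta> \<partial>\<mu>) \<partial>lborel)"
    by (intro nn_integral_cong nn_integral_cmult[symmetric] kz)
  also have "\<dots> = (\<integral>\<^sup>+\<zeta>. (\<integral>\<^sup>+z. A z * k z \<zeta> \<partial>lborel) \<partial>\<mu>)"
    by (rule pair_sigma_finite.Fubini'[OF P meas, symmetric])
  finally show "D_mu \<mu> n f = (\<integral>\<^sup>+ \<zeta>. local_dirichlet n f \<zeta> \<partial>\<mu>)" unfolding ld .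
  have "(\<lambda>\<zeta>. \<integral>\<^sup>+z. (\<lambda>\<zeta> z. A z * k z \<zeta>) \<zeta> z \<partial>lborel) \<in> borel_measurable \<mu>"
    by (rule lborel.borel_measurable_nn_integral) (use measurable_pair_swap[OF meas] in \<open>simp add: case_prod_beta\<close>)
  then show "local_dirichlet n f \<in> borel_measurable \<mu>" unfolding ld by simp
qed

lemma dweight_dilation_le:
  assumes \<mu>: "circle_measure \<mu>"
    and r: "0 < r" "r < 1"
  shows "dweight \<mu> (Suc (Suc m)) z \<le> 9 * dweight \<mu> (Suc (Suc m)) (of_real r * z)"
proof (cases "cmod z < 1")
  case True
  define w where "w = of_real r * z"
  have w: "cmod w < 1" unfolding w_def by (rule dilation_in_disc[OF r True])
  define c where "c = fact (Suc (Suc m)) * fact (Suc m) * pi"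
  have c: "c > 0" by (simp add: c_def)
  have meas: "(\<lambda>\<zeta>. ennreal ((1 - (cmod z)\<^sup>2) / (cmod (z - \<zeta>))\<^sup>2)) \<in> borel_measurable \<mu>" for z
    using measurable_Pair2[OF borel_measurable_poisson_kernel[OF \<mu>], of z] by simp
  have eq: "dweight \<mu> (Suc (Suc m)) z = (\<integral>\<^sup>+\<zeta>. ennreal (1 / c * ((1 - (cmod z)\<^sup>2) ^ Suc m * ((1 - (cmod z)\<^sup>2) / (cmod (z - \<zeta>))\<^sup>2))) \<partial>\<mu>)"
    if "cmod z < 1" for z
  proof -
    have "0 \<le> (1 - (cmod z)\<^sup>2) ^ Suc m" using that by (simp add: power_le_one)
    then have "ennreal (1 / c * ((1 - (cmod z)\<^sup>2) ^ Suc m * ((1 - (cmod z)\<^sup>2) / (cmod (z - \<zeta>))\<^sup>2)))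
      = ennreal ((1 - (cmod z)\<^sup>2) ^ Suc m / c) * ennreal ((1 - (cmod z)\<^sup>2) / (cmod (z - \<zeta>))\<^sup>2)" for \<zeta>
      using c by (subst ennreal_mult'[symmetric]) auto
    then show ?thesis using that by (simp add: dweight_def poisson_def c_def nn_integral_cmult[OF meas])
  qed
  have "dweight \<mu> (Suc (Suc m)) z \<le> (\<integral>\<^sup>+\<zeta>. 9 * ennreal (1 / c * ((1 - (cmod w)\<^sup>2) ^ Suc m * ((1 - (cmod w)\<^sup>2) / (cmod (w - \<zeta>))\<^sup>2))) \<partial>\<mu>)"
    unfolding eq[OF True]
  proof (rule nn_integral_mono_AE, use AE_circle[OF \<mu>] in eventually_elim)
    fix \<zeta> :: complex assume \<zeta>: "cmod \<zeta> = 1"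
    have "1 / c * ((1 - (cmod z)\<^sup>2) ^ Suc m * ((1 - (cmod z)\<^sup>2) / (cmod (z - \<zeta>))\<^sup>2)) \<le>
       1 / c * (9 * ((1 - (cmod w)\<^sup>2) ^ Suc m * ((1 - (cmod w)\<^sup>2) / (cmod (w - \<zeta>))\<^sup>2)))"
      unfolding w_def using c by (intro mult_left_mono dilation_kernel_le True r \<zeta>) auto
    also have "\<dots> = 9 * (1 / c * ((1 - (cmod w)\<^sup>2) ^ Suc m * ((1 - (cmod w)\<^sup>2) / (cmod (w - \<zeta>))\<^sup>2)))"
      by simp
    finally have "ennreal (1 / c * ((1 - (cmod z)\<^sup>2) ^ Suc m * ((1 - (cmod z)\<^sup>2) / (cmod (z - \<zeta>))\<^sup>2))) \<le>
       ennreal (9 * (1 / c * ((1 - (cmod w)\<^sup>2) ^ Suc m * ((1 - (cmod w)\<^sup>2) / (cmod (w - \<zeta>))\<^sup>2))))"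
      by (rule ennreal_leI)
    then show "ennreal (1 / c * ((1 - (cmod z)\<^sup>2) ^ Suc m * ((1 - (cmod z)\<^sup>2) / (cmod (z - \<zeta>))\<^sup>2))) \<le>
       9 * ennreal (1 / c * ((1 - (cmod w)\<^sup>2) ^ Suc m * ((1 - (cmod w)\<^sup>2) / (cmod (w - \<zeta>))\<^sup>2)))"
      by (subst (asm) ennreal_mult'[of 9]) (simp_all only: ennreal_numeral zero_le_numeral)
  qed
  also have "\<dots> = 9 * dweight \<mu> (Suc (Suc m)) w"
  proof (subst nn_integral_cmult)
    have "(\<lambda>\<zeta>. ennreal (1 / c * (1 - (cmod w)\<^sup>2) ^ Suc m) * ennreal ((1 - (cmod w)\<^sup>2) / (cmod (w - \<zeta>))\<^sup>2)) \<in> borel_measurable \<mu>"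
      by (intro borel_measurable_times_ennreal meas) auto
    also have "(\<lambda>\<zeta>. ennreal (1 / c * (1 - (cmod w)\<^sup>2) ^ Suc m) * ennreal ((1 - (cmod w)\<^sup>2) / (cmod (w - \<zeta>))\<^sup>2))
      = (\<lambda>\<zeta>. ennreal (1 / c * ((1 - (cmod w)\<^sup>2) ^ Suc m * ((1 - (cmod w)\<^sup>2) / (cmod (w - \<zeta>))\<^sup>2))))"
      using w c by (subst ennreal_mult'[symmetric]) (auto simp: power_le_one mult.assoc)
    finally show "(\<lambda>\<zeta>. ennreal (1 / c * ((1 - (cmod w)\<^sup>2) ^ Suc m * ((1 - (cmod w)\<^sup>2) / (cmod (w - \<zeta>))\<^sup>2)))) \<in> borel_measurable \<mu>" .
  qed (simp only: eq[OF w])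
  finally show ?thesis unfolding w_def .
qed (simp add: dweight_def)

lemma D_mu_dilation_le:
  assumes \<mu>: "circle_measure \<mu>"
    and f: "f holomorphic_on ball 0 1" and r: "0 < r" "r < 1" and n: "n \<ge> 2"
  shows "D_mu \<mu> n (\<lambda>z. f (of_real r * z)) \<le> 9 * D_mu \<mu> n f"
proof -
  obtain m where m: "n = Suc (Suc m)" using n by (metis add_2_eq_Suc le_Suc_ex)
  define h where "h z = ennreal ((cmod ((deriv ^^ n) f z))\<^sup>2) * dweight \<mu> n z" for z
  have hm: "h \<in> borel_measurable borel" unfolding h_def[abs_def] by (rule borel_measurable_deriv_dweight[OF \<mu> f])
  have hm': "(\<lambda>z. h (of_real r * z)) \<in> borel_measurable borel"
    by (rule measurable_compose[OF _ hm]) measurable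
  have "D_mu \<mu> n (\<lambda>z. f (of_real r * z)) \<le> (\<integral>\<^sup>+ z. (9 * ennreal (r\<^sup>2)) * h (of_real r * z) \<partial>lborel)"
    unfolding D_mu_eq_dweight
  proof (intro nn_integral_mono)
    fix z :: complex
    show "ennreal ((cmod ((deriv ^^ n) (\<lambda>z. f (of_real r * z)) z))\<^sup>2) * dweight \<mu> n z \<le> (9 * ennreal (r\<^sup>2)) * h (of_real r * z)"
    proof (cases "cmod z < 1")
      case True
      \<comment> \<open>The chain rule produces r^(2n); exactly r^2 of it is kept, to pay for the
        change of area under z -> r z.\<close>
      have "r ^ (2 * n) \<le> r\<^sup>2" using r n by (intro power_decreasing) auto
      then have "(cmod ((deriv ^^ n) (\<lambda>z. f (of_real r * z)) z))\<^sup>2 \<le> r\<^sup>2 * (cmod ((deriv ^^ n) f (of_real r * z)))\<^sup>2"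
        unfolding higher_deriv_dilation[OF f r True] using r
        by (simp add: norm_mult power_mult_distrib norm_power mult_right_mono mult.commute[of n] flip: power_mult)
      then have "ennreal ((cmod ((deriv ^^ n) (\<lambda>z. f (of_real r * z)) z))\<^sup>2) \<le> ennreal (r\<^sup>2) * ennreal ((cmod ((deriv ^^ n) f (of_real r * z)))\<^sup>2)"
        using ennreal_leI by (simp add: ennreal_mult'[OF zero_le_power2, symmetric])
      then have "ennreal ((cmod ((deriv ^^ n) (\<lambda>z. f (of_real r * z)) z))\<^sup>2) * dweight \<mu> n z 
        \<le> (ennreal (r\<^sup>2) * ennreal ((cmod ((deriv ^^ n) f (of_real r * z)))\<^sup>2)) * (9 * dweight \<mu> n (of_real r * z))"
        unfolding m by (intro mult_mono dweight_dilation_le \<mu> r) auto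
      then show ?thesis by (simp add: h_def mult_ac)
    qed (simp add: dweight_def)
  qed
  also have "\<dots> = 9 * (ennreal (r\<^sup>2) * (\<integral>\<^sup>+ z. h (of_real r * z) \<partial>lborel))"
    by (subst nn_integral_cmult) (use hm' in \<open>auto simp: mult.assoc\<close>)
  also have "\<dots> = 9 * D_mu \<mu> n f"
    using nn_integral_lborel_scale[OF hm r(1)] by (simp add: D_mu_eq_dweight h_def[abs_def])
  finally show ?thesis .
qed

text \<open>Fatou along radii tending to 1. The integrands converge pointwise because the n-th
  derivative is continuous in the disc and \<open>dweight\<close> is finite there.\<close>

lemma D_mu_le_of_dilations:
  assumes \<mu>: "circle_measure \<mu>"
    and h: "h holomorphic_on ball 0 1"
    and B: "\<And>r. 0 < r \<Longrightarrow> r < 1 \<Longrightarrow> D_mu \<mu> n (\<lambda>z. h (of_real r * z)) \<le> B"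
  shows "D_mu \<mu> n h \<le> B"
proof -
  define r where "r i = 1 - 1 / (real i + 2)" for i
  have r: "0 < r i" "r i < 1" for i by (auto simp: r_def field_simps)
  have rlim: "r \<longlonglongrightarrow> 1" unfolding r_def by real_asymp
  define H where "H i z = ennreal ((cmod ((deriv ^^ n) (\<lambda>z. h (of_real (r i) * z)) z))\<^sup>2) * dweight \<mu> n z" for i z
  note hr = holomorphic_dilation[OF h r]
  have lim: "(\<lambda>i. H i z) \<longlonglongrightarrow> ennreal ((cmod ((deriv ^^ n) h z))\<^sup>2) * dweight \<mu> n z" for z
  proof (cases "cmod z < 1")
    case True
    have "isCont ((deriv ^^ n) h) z"
      using holomorphic_on_imp_continuous_on[OF holomorphic_higher_deriv[OF h]] True
      by (auto simp: continuous_on_eq_continuous_at)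
    moreover have "(\<lambda>i. of_real (r i) * z) \<longlonglongrightarrow> of_real 1 * z"
      by (intro tendsto_intros rlim)
    ultimately have "(\<lambda>i. (deriv ^^ n) h (of_real (r i) * z)) \<longlonglongrightarrow> (deriv ^^ n) h z"
      by (auto intro: isCont_tendsto_compose)
    then have "(\<lambda>i. of_real (r i ^ n) * (deriv ^^ n) h (of_real (r i) * z)) \<longlonglongrightarrow> of_real (1 ^ n) * (deriv ^^ n) h z"
      by (intro tendsto_intros rlim)
    then have "(\<lambda>i. (deriv ^^ n) (\<lambda>z. h (of_real (r i) * z)) z) \<longlonglongrightarrow> (deriv ^^ n) h z"
      by (simp add: higher_deriv_dilation[OF h r True])
    then have "(\<lambda>i. ennreal ((cmod ((deriv ^^ n) (\<lambda>z. h (of_real (r i) * z)) z))\<^sup>2)) \<longlonglongrightarrow> ennreal ((cmod ((deriv ^^ n) h z))\<^sup>2)"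
      by (intro tendsto_ennrealI tendsto_intros)
    from ennreal_tendsto_cmult[OF dweight_finite[OF \<mu>] this, of n z] show ?thesis
      by (simp add: H_def mult.commute)
  qed (simp add: H_def dweight_def)
  have "D_mu \<mu> n h = (\<integral>\<^sup>+z. liminf (\<lambda>i. H i z) \<partial>lborel)"
    unfolding D_mu_eq_dweight
    by (intro nn_integral_cong lim_imp_Liminf[symmetric] lim) simp
  also have "\<dots> \<le> liminf (\<lambda>i. \<integral>\<^sup>+z. H i z \<partial>lborel)"
    by (intro nn_integral_liminf) (use borel_measurable_deriv_dweight[OF \<mu> hr] in \<open>simp add: H_def[abs_def]\<close>)
  also have "\<dots> \<le> liminf (\<lambda>i::nat. B)"
    using B[OF r] by (intro Liminf_mono always_eventually) (simp add: D_mu_eq_dweight H_def[abs_def])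
  also have "\<dots> = B" by (simp add: Liminf_const)
  finally show ?thesis .
qed

section \<open>Local estimate for products of dilated functions\<close>

lemma taylor_coeff_dilation_summable:
  assumes f: "f holomorphic_on ball 0 1" and r: "0 < r" "r < 1"
  shows "\<exists>s>1. summable (\<lambda>k. cmod (taylor_coeff (\<lambda>z. f (of_real r * z)) k) * s ^ k)"
proof -
  \<comment> \<open>Chosen so that s > 1 while r s = sqrt r is still below 1.\<close>
  define s where "s = 1 / sqrt r"
  have s: "s > 1" "r * s = sqrt r" using r by (auto simp: s_def real_div_sqrt)
  have sq: "0 < sqrt r" "sqrt r < 1" using r by auto
  then obtain \<rho> where \<rho>: "sqrt r < \<rho>" "\<rho> < 1" using dense by blast
  have "summable (\<lambda>k. taylor_coeff f k * of_real \<rho> ^ k)"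
    using taylor_sums[OF f, of "of_real \<rho>"] \<rho> sq by (auto simp: sums_iff)
  then have "summable (\<lambda>k. norm (taylor_coeff f k * of_real (r * s) ^ k))"
    by (rule powser_insidea) (use \<rho> sq s in auto)
  moreover have td: "taylor_coeff (\<lambda>z. f (of_real r * z)) k = of_real r ^ k * taylor_coeff f k" for k
    using r by (intro taylor_coeff_dilation[OF f]) simp
  have "norm (taylor_coeff f k * of_real (r * s) ^ k) = cmod (taylor_coeff (\<lambda>z. f (of_real r * z)) k) * s ^ k" for k
    unfolding td using r s(1) by (simp add: norm_mult norm_power power_mult_distrib)
  ultimately have "summable (\<lambda>k. cmod (taylor_coeff (\<lambda>z. f (of_real r * z)) k) * s ^ k)"
    by simp
  then show ?thesis using s(1) by blast
qed

lemma taylor_coeff_dilation_norm_summable: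
  assumes f: "f holomorphic_on ball 0 1" and r: "0 < r" "r < 1" and \<zeta>: "cmod \<zeta> = 1"
  defines "y \<equiv> \<lambda>k. taylor_coeff (\<lambda>z. f (of_real r * z)) k * \<zeta> ^ k"
  shows "summable (\<lambda>k. cmod (y k))" and "suminf y = f (of_real r * \<zeta>)"
    and "y k = taylor_coeff f k * (of_real r * \<zeta>) ^ k"
proof -
  have td: "taylor_coeff (\<lambda>z. f (of_real r * z)) k = of_real r ^ k * taylor_coeff f k" for k
    using r by (intro taylor_coeff_dilation[OF f]) simp
  have yk: "y k = taylor_coeff f k * (of_real r * \<zeta>) ^ k" for k
    unfolding y_def td by (simp add: power_mult_distrib)
  then show "y k = taylor_coeff f k * (of_real r * \<zeta>) ^ k" .
  obtain \<rho> where \<rho>: "r < \<rho>" "\<rho> < 1" using r dense by blast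
  have "summable (\<lambda>k. taylor_coeff f k * of_real \<rho> ^ k)"
    using taylor_sums[OF f, of "of_real \<rho>"] \<rho> r by (auto simp: sums_iff)
  then show "summable (\<lambda>k. cmod (y k))"
    unfolding yk by (rule powser_insidea) (use \<rho> r \<zeta> in \<open>auto simp: norm_mult\<close>)
  show "suminf y = f (of_real r * \<zeta>)"
  proof -
    have "y = (\<lambda>k. taylor_coeff f k * (of_real r * \<zeta>) ^ k)" by (rule ext) (rule yk)
    then show ?thesis
      using taylor_sums[OF f, of "of_real r * \<zeta>"] r \<zeta> by (simp add: norm_mult sums_iff)
  qed
qed

text \<open>The Douglas formula sees only the tail sums with index at least m. Each of the m others
  is f(r \<zeta>) minus a partial sum, hence at most sqrt C plus the moduli of the first
  coefficients of f; this bound depends neither on r nor on \<zeta>.\<close>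

lemma wnorm_tail_sum_le_local_dirichlet:
  assumes f: "f holomorphic_on ball 0 1" and r: "0 < r" "r < 1" and \<zeta>: "cmod \<zeta> = 1"
    and C: "\<And>z. cmod z < 1 \<Longrightarrow> (cmod (f z))\<^sup>2 \<le> C"
  shows "wnorm (sigma_weight m) (tail_sum (\<lambda>k. taylor_coeff (\<lambda>z. f (of_real r * z)) k * \<zeta> ^ k))
    \<le> local_dirichlet (Suc m) (\<lambda>z. f (of_real r * z)) \<zeta> + ennreal (real m * (sqrt C + (\<Sum>i\<le>m. cmod (taylor_coeff f i)))\<^sup>2)"
proof -
  define y where "y k = taylor_coeff (\<lambda>z. f (of_real r * z)) k * \<zeta> ^ k" for k
  note y = taylor_coeff_dilation_norm_summable[OF f r \<zeta>, folded y_def]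
  obtain s where s: "s > 1" "summable (\<lambda>k. cmod (taylor_coeff (\<lambda>z. f (of_real r * z)) k) * s ^ k)"
    using taylor_coeff_dilation_summable[OF f r] by blast
  define T where "T = sqrt C + (\<Sum>i\<le>m. cmod (taylor_coeff f i))"
  have tail: "cmod (tail_sum y k) \<le> T" if "k < m" for k
  proof -
    have "cmod (tail_sum y k) \<le> cmod (suminf y) + cmod (\<Sum>i\<le>k. y i)"
      using tail_sum_eq[OF summable_norm_cancel[OF y(1)], of k] norm_triangle_ineq4[of "suminf y" "\<Sum>i\<le>k. y i"] by simp
    also have "cmod (suminf y) \<le> sqrt C"
      unfolding y(2) using C[of "of_real r * \<zeta>"] r \<zeta> by (intro real_le_rsqrt) (simp add: norm_mult)
    also have "cmod (\<Sum>i\<le>k. y i) \<le> (\<Sum>i\<le>k. cmod (taylor_coeff f i))"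
      unfolding y(3) using r \<zeta>
      by (intro order_trans[OF norm_sum] sum_mono) (simp add: norm_mult norm_power power_le_one mult_right_le_one_le)
    also have "\<dots> \<le> (\<Sum>i\<le>m. cmod (taylor_coeff f i))"
      using that by (intro sum_mono2) auto
    finally show ?thesis by (simp add: T_def)
  qed
  have "wnorm (sigma_weight m) (tail_sum y) \<le> (\<Sum>k. ennreal (real (k choose m) * (cmod (tail_sum y k))\<^sup>2)) + (\<Sum>k<m. ennreal ((cmod (tail_sum y k))\<^sup>2))"
    by (rule wnorm_sigma_weight_le)
  also have "(\<Sum>k. ennreal (real (k choose m) * (cmod (tail_sum y k))\<^sup>2)) = local_dirichlet (Suc m) (\<lambda>z. f (of_real r * z)) \<zeta>"
    unfolding y_def by (rule local_dirichlet_eq_tail_sum[OF holomorphic_dilation[OF f r] s \<zeta>, symmetric])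
  also have "(\<Sum>k<m. ennreal ((cmod (tail_sum y k))\<^sup>2)) \<le> (\<Sum>k<m. ennreal (T\<^sup>2))"
    using tail by (intro sum_mono ennreal_leI power_mono) auto
  also have "\<dots> = ennreal (real m * T\<^sup>2)"
    by (simp add: ennreal_mult' ennreal_of_nat_eq_real_of_nat)
  finally show ?thesis unfolding y_def[symmetric] T_def by (simp add: add_left_mono)
qed

text \<open>In \<open>tail_sum_conv\<close> the first term is handled by the multiplier bound of f
  and the second by the value g(r \<zeta>). The factors 2 come from \<open>wnorm_add_le\<close>,
  while L and K account for the tail sums below index m of G and F.\<close>

lemma local_dirichlet_dilation_mult_le:
  assumes f: "f holomorphic_on ball 0 1" and g: "g holomorphic_on ball 0 1"
    and r: "0 < r" "r < 1" and \<zeta>: "cmod \<zeta> = 1"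
    and Cf0: "C > 0" and Cf: "\<And>a. wnorm (sigma_weight m) (conv (taylor_coeff f) a) \<le> ennreal C * wnorm (sigma_weight m) a"
    and Cg: "\<And>z. cmod z < 1 \<Longrightarrow> (cmod (g z))\<^sup>2 \<le> D"
  defines "F \<equiv> \<lambda>z. f (of_real r * z)" and "G \<equiv> \<lambda>z. g (of_real r * z)"
  defines "K \<equiv> real m * (sqrt C + (\<Sum>i\<le>m. cmod (taylor_coeff f i)))\<^sup>2"
    and "L \<equiv> real m * (sqrt D + (\<Sum>i\<le>m. cmod (taylor_coeff g i)))\<^sup>2"
  shows "local_dirichlet (Suc m) (\<lambda>z. F z * G z) \<zeta>
    \<le> ennreal (2 * C) * (local_dirichlet (Suc m) G \<zeta> + ennreal L) + ennreal (2 * D) * (local_dirichlet (Suc m) F \<zeta> + ennreal K)"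
proof -
  define x where "x k = taylor_coeff F k * \<zeta> ^ k" for k
  define y where "y k = taylor_coeff G k * \<zeta> ^ k" for k
  note x = taylor_coeff_dilation_norm_summable[OF f r \<zeta>, folded F_def, folded x_def]
  note y = taylor_coeff_dilation_norm_summable[OF g r \<zeta>, folded G_def, folded y_def]
  have hF: "F holomorphic_on ball 0 1" and hG: "G holomorphic_on ball 0 1"
    unfolding F_def G_def using f g r by (auto intro: holomorphic_dilation)
  have D0: "D \<ge> 0" using order_trans[OF zero_le_power2 Cg[of 0]] by simp
  have Cf': "(cmod (f z))\<^sup>2 \<le> C" if "cmod z < 1" for z
    by (rule multiplier_bounded[OF sigma_weight_ge_1 Cf0 Cf taylor_sums[OF f] that])
  have hFG: "(\<lambda>z. f z * g z) holomorphic_on ball 0 1" using f g by (intro holomorphic_intros)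
  obtain s where s: "s > 1" "summable (\<lambda>k. cmod (taylor_coeff (\<lambda>z. F z * G z) k) * s ^ k)"
    using taylor_coeff_dilation_summable[OF hFG r] by (auto simp: F_def G_def)
  have tw: "(\<lambda>k. taylor_coeff (\<lambda>z. F z * G z) k * \<zeta> ^ k) = conv x y"
    unfolding taylor_coeff_mult[OF hF hG] conv_def x_def y_def sum_distrib_right
    by (intro ext sum.cong refl) (simp add: mult_ac flip: power_add)
  have "local_dirichlet (Suc m) (\<lambda>z. F z * G z) \<zeta> = (\<Sum>j. ennreal (real (j choose m) * (cmod (tail_sum (conv x y) j))\<^sup>2))"
    using local_dirichlet_eq_tail_sum[OF _ s \<zeta>, of m] hF hG unfolding tw by (auto intro: holomorphic_intros)
  also have "\<dots> \<le> wnorm (sigma_weight m) (tail_sum (conv x y))"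
    by (rule sum_binomial_le_wnorm)
  also have "tail_sum (conv x y) = (\<lambda>j. conv x (tail_sum y) j + suminf y * tail_sum x j)"
    using tail_sum_conv[OF x(1) y(1)] by auto
  also have "wnorm (sigma_weight m) \<dots> \<le> 2 * wnorm (sigma_weight m) (conv x (tail_sum y)) + 2 * wnorm (sigma_weight m) (\<lambda>j. suminf y * tail_sum x j)"
    using order_trans[OF zero_le_one sigma_weight_ge_1] by (rule wnorm_add_le)
  also have "\<dots> \<le> 2 * (ennreal C * wnorm (sigma_weight m) (tail_sum y)) + 2 * (ennreal D * wnorm (sigma_weight m) (tail_sum x))"
  proof (intro add_mono mult_left_mono)
    \<comment> \<open>The sequence of f is first dilated and then rotated; neither operation
      enlarges the constant C.\<close>
    have x_eq: "x = (\<lambda>k. taylor_coeff f k * of_real (r ^ k) * \<zeta> ^ k)"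
      by (simp add: fun_eq_iff x(3) power_mult_distrib)
    show "wnorm (sigma_weight m) (conv x (tail_sum y)) \<le> ennreal C * wnorm (sigma_weight m) (tail_sum y)"
      unfolding x_eq
      by (rule conv_rotation_bounded[OF conv_dilation_bounded[OF _ Cf] \<zeta>])
         (use r order_trans[OF zero_le_one sigma_weight_ge_1] in auto)
    have "(cmod (suminf y))\<^sup>2 \<le> D"
      unfolding y(2) using r \<zeta> by (intro Cg) (simp add: norm_mult)
    then show "wnorm (sigma_weight m) (\<lambda>j. suminf y * tail_sum x j) \<le> ennreal D * wnorm (sigma_weight m) (tail_sum x)"
      unfolding wnorm_scale by (intro mult_right_mono ennreal_leI) auto
  qed auto
  also have "\<dots> = ennreal (2 * C) * wnorm (sigma_weight m) (tail_sum y) + ennreal (2 * D) * wnorm (sigma_weight m) (tail_sum x)"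
    using Cf0 D0 by (simp add: ennreal_mult mult.assoc)
  also have "\<dots> \<le> ennreal (2 * C) * (local_dirichlet (Suc m) G \<zeta> + ennreal L) + ennreal (2 * D) * (local_dirichlet (Suc m) F \<zeta> + ennreal K)"
  proof (intro add_mono mult_left_mono)
    show "wnorm (sigma_weight m) (tail_sum y) \<le> local_dirichlet (Suc m) G \<zeta> + ennreal L"
      using wnorm_tail_sum_le_local_dirichlet[OF g r \<zeta> Cg] unfolding y_def[abs_def] G_def L_def .
    show "wnorm (sigma_weight m) (tail_sum x) \<le> local_dirichlet (Suc m) F \<zeta> + ennreal K"
      using wnorm_tail_sum_le_local_dirichlet[OF f r \<zeta> Cf'] unfolding x_def[abs_def] F_def K_def .
  qed auto
  finally show ?thesis .
qed

lemma D_mu_mult_finite: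
  assumes \<mu>: "circle_measure \<mu>"
    and f: "f holomorphic_on ball 0 1" and g: "g holomorphic_on ball 0 1" and n: "n \<ge> 1"
    and Df: "D_mu \<mu> n f < \<infinity>" and Dg: "D_mu \<mu> n g < \<infinity>"
    and C0: "C > 0" and C: "\<And>a. wnorm (sigma_weight (n - 1)) (conv (taylor_coeff f) a) \<le> ennreal C * wnorm (sigma_weight (n - 1)) a"
    and D: "\<And>z. cmod z < 1 \<Longrightarrow> (cmod (g z))\<^sup>2 \<le> D"
  shows "D_mu \<mu> n (\<lambda>z. f z * g z) < \<infinity>"
proof (cases "n = 1")
  case True
  have Cf: "(cmod (f z))\<^sup>2 \<le> C" if "cmod z < 1" for z
    by (rule multiplier_bounded[OF sigma_weight_ge_1 C0 C taylor_sums[OF f] that])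
  have D0: "D \<ge> 0" using order_trans[OF zero_le_power2 D[of 0]] by simp
  have "D_mu \<mu> n (\<lambda>z. f z * g z) \<le> ennreal (2 * D) * D_mu \<mu> n f + ennreal (2 * C) * D_mu \<mu> n g"
  proof (rule D_mu_combination_le[OF \<mu> f g])
    fix z :: complex assume z: "cmod z < 1"
    have "deriv (\<lambda>z. f z * g z) z = f z * deriv g z + deriv f z * g z"
      using f g z by (intro deriv_mult) (auto intro!: holomorphic_on_imp_differentiable_at[of _ "ball 0 1"])
    then have "(cmod (deriv (\<lambda>z. f z * g z) z))\<^sup>2 \<le> 2 * (cmod (f z * deriv g z))\<^sup>2 + 2 * (cmod (deriv f z * g z))\<^sup>2"
      using norm_add_square_le by simp
    also have "\<dots> = 2 * ((cmod (f z))\<^sup>2 * (cmod (deriv g z))\<^sup>2) + 2 * ((cmod (g z))\<^sup>2 * (cmod (deriv f z))\<^sup>2)"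
      by (simp add: norm_mult power_mult_distrib)
    also have "\<dots> \<le> 2 * (C * (cmod (deriv g z))\<^sup>2) + 2 * (D * (cmod (deriv f z))\<^sup>2)"
      by (intro add_mono mult_left_mono mult_right_mono Cf D z) auto
    finally show "(cmod ((deriv ^^ n) (\<lambda>z. f z * g z) z))\<^sup>2 \<le> 2 * D * (cmod ((deriv ^^ n) f z))\<^sup>2 + 2 * C * (cmod ((deriv ^^ n) g z))\<^sup>2"
      by (simp add: True)
  qed (use C0 D0 in auto)
  also have "\<dots> < \<infinity>" using Df Dg by (simp add: ennreal_mult_less_top)
  finally show ?thesis .
next
  case False
  define m where "m = n - 1"
  have nm: "n = Suc m" and n2: "n \<ge> 2" using n False by (auto simp: m_def)
  define K where "K = real m * (sqrt C + (\<Sum>i\<le>m. cmod (taylor_coeff f i)))\<^sup>2"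
  define L where "L = real m * (sqrt D + (\<Sum>i\<le>m. cmod (taylor_coeff g i)))\<^sup>2"
  \<comment> \<open>A bound free of r: 9 is the dilation constant, and K and L, being independent of
    \<zeta>, integrate to multiples of the total mass of \<mu>.\<close>
  define B where "B = ennreal (2 * C) * (9 * D_mu \<mu> n g + ennreal L * emeasure \<mu> (space \<mu>))
     + ennreal (2 * D) * (9 * D_mu \<mu> n f + ennreal K * emeasure \<mu> (space \<mu>))"
  have "emeasure \<mu> (space \<mu>) < top" by (rule circle_measureD(4)[OF \<mu>])
  then have "B < \<infinity>" using Df Dg by (simp add: B_def ennreal_mult_less_top)
  have hfg: "(\<lambda>z. f z * g z) holomorphic_on ball 0 1" using f g by (intro holomorphic_intros)
  have "D_mu \<mu> n (\<lambda>z. f z * g z) \<le> B"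
  proof (rule D_mu_le_of_dilations[OF \<mu> hfg])
    fix r :: real assume r: "0 < r" "r < 1"
    define F where "F = (\<lambda>z. f (of_real r * z))"
    define G where "G = (\<lambda>z. g (of_real r * z))"
    have hF: "F holomorphic_on ball 0 1" and hG: "G holomorphic_on ball 0 1"
      unfolding F_def G_def using f g r by (auto intro: holomorphic_dilation)
    have hFG: "(\<lambda>z. F z * G z) holomorphic_on ball 0 1" using hF hG by (intro holomorphic_intros)
    have [measurable]: "local_dirichlet n F \<in> borel_measurable \<mu>" "local_dirichlet n G \<in> borel_measurable \<mu>"
      using D_mu_eq_local_dirichlet(2)[OF \<mu>] hF hG by auto
    have "D_mu \<mu> n (\<lambda>z. F z * G z) = (\<integral>\<^sup>+ \<zeta>. local_dirichlet n (\<lambda>z. F z * G z) \<zeta> \<partial>\<mu>)"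
      by (rule D_mu_eq_local_dirichlet(1)[OF \<mu> hFG])
    also have "\<dots> \<le> (\<integral>\<^sup>+ \<zeta>. ennreal (2 * C) * (local_dirichlet n G \<zeta> + ennreal L) + ennreal (2 * D) * (local_dirichlet n F \<zeta> + ennreal K) \<partial>\<mu>)"
    proof (rule nn_integral_mono_AE, use AE_circle[OF \<mu>] in eventually_elim)
      fix \<zeta> :: complex assume \<zeta>: "cmod \<zeta> = 1"
      show "local_dirichlet n (\<lambda>z. F z * G z) \<zeta> \<le> ennreal (2 * C) * (local_dirichlet n G \<zeta> + ennreal L) + ennreal (2 * D) * (local_dirichlet n F \<zeta> + ennreal K)"
        using local_dirichlet_dilation_mult_le[OF f g r \<zeta> C0 C[folded m_def] D]
        unfolding nm K_def L_def F_def G_def .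
    qed
    also have "\<dots> = ennreal (2 * C) * (D_mu \<mu> n G + ennreal L * emeasure \<mu> (space \<mu>))
        + ennreal (2 * D) * (D_mu \<mu> n F + ennreal K * emeasure \<mu> (space \<mu>))"
      using D_mu_eq_local_dirichlet(1)[OF \<mu> hF] D_mu_eq_local_dirichlet(1)[OF \<mu> hG]
      by (simp add: nn_integral_add nn_integral_cmult)
    also have "\<dots> \<le> B"
      unfolding B_def F_def G_def
      by (intro add_mono mult_left_mono D_mu_dilation_le \<mu> f g r n2) auto
    finally show "D_mu \<mu> n (\<lambda>z. f (of_real r * z) * g (of_real r * z)) \<le> B"
      by (simp add: F_def G_def)
  qed
  then show ?thesis using \<open>B < \<infinity>\<close> by (rule le_less_trans)
qed

section \<open>Closure of the intersection under the algebra operations for nonzero measures\<close>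

lemma H_mu_add:
  assumes \<mu>: "circle_measure \<mu>"
    and "f \<in> H_mu \<mu> n" "g \<in> H_mu \<mu> n" "emeasure \<mu> (space \<mu>) \<noteq> 0"
  shows "(\<lambda>z. f z + g z) \<in> H_mu \<mu> n"
proof -
  have f: "f holomorphic_on ball 0 1" "D_mu \<mu> n f < \<infinity>" and g: "g holomorphic_on ball 0 1" "D_mu \<mu> n g < \<infinity>"
    using assms by (auto simp: H_mu_def)
  have "D_mu \<mu> n (\<lambda>z. f z + g z) \<le> ennreal 2 * D_mu \<mu> n f + ennreal 2 * D_mu \<mu> n g"
  proof (rule D_mu_combination_le[OF \<mu> f(1) g(1)])
    fix z :: complex assume "cmod z < 1"
    then have "(deriv ^^ n) (\<lambda>z. f z + g z) z = (deriv ^^ n) f z + (deriv ^^ n) g z"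
      by (intro higher_deriv_add[OF f(1) g(1)]) auto
    then show "(cmod ((deriv ^^ n) (\<lambda>z. f z + g z) z))\<^sup>2 \<le> 2 * (cmod ((deriv ^^ n) f z))\<^sup>2 + 2 * (cmod ((deriv ^^ n) g z))\<^sup>2"
      using norm_add_square_le by simp
  qed auto
  also have "\<dots> < \<infinity>" using f g by (simp add: ennreal_mult_less_top)
  finally show ?thesis using f g assms(4) by (auto simp: H_mu_def intro!: holomorphic_intros)
qed

lemma H_mu_cmult:
  assumes \<mu>: "circle_measure \<mu>"
    and "f \<in> H_mu \<mu> n" "emeasure \<mu> (space \<mu>) \<noteq> 0"
  shows "(\<lambda>z. c * f z) \<in> H_mu \<mu> n"
proof -
  have f: "f holomorphic_on ball 0 1" "D_mu \<mu> n f < \<infinity>"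
    using assms by (auto simp: H_mu_def)
  have "D_mu \<mu> n (\<lambda>z. c * f z) \<le> ennreal ((cmod c)\<^sup>2) * D_mu \<mu> n f + ennreal 0 * D_mu \<mu> n f"
  proof (rule D_mu_combination_le[OF \<mu> f(1) f(1)])
    fix z :: complex assume "cmod z < 1"
    then have "(deriv ^^ n) (\<lambda>z. c * f z) z = c * (deriv ^^ n) f z"
      by (intro higher_deriv_cmult[OF f(1)]) auto
    then show "(cmod ((deriv ^^ n) (\<lambda>z. c * f z) z))\<^sup>2 \<le> (cmod c)\<^sup>2 * (cmod ((deriv ^^ n) f z))\<^sup>2 + 0 * (cmod ((deriv ^^ n) f z))\<^sup>2"
      by (simp add: norm_mult power_mult_distrib)
  qed auto
  also have "\<dots> < \<infinity>" using f by (simp add: ennreal_mult_less_top)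
  finally show ?thesis using f assms(3) by (auto simp: H_mu_def intro!: holomorphic_intros)
qed

lemma one_in_H_mu:
  assumes \<mu>: "circle_measure \<mu>"
    and "n \<ge> 1" "emeasure \<mu> (space \<mu>) \<noteq> 0"
  shows "(\<lambda>z. 1) \<in> H_mu \<mu> n"
proof -
  have "(deriv ^^ n) (\<lambda>z. 1 :: complex) = (\<lambda>z. 0)"
    using assms(2) by (simp add: higher_deriv_const fun_eq_iff)
  then show ?thesis using assms(3) by (simp add: H_mu_def D_mu_eq_dweight)
qed

text \<open>The two factors play different roles: f enters through its operator bound C, whereas the
  operator bound of g serves only to produce the sup bound D.\<close>

lemma H_mu_Int_Mult_mult:
  assumes \<mu>: "circle_measure \<mu>"
    and f: "f \<in> H_mu \<mu> n \<inter> Mult (H_sigma (n - 1))" and g: "g \<in> H_mu \<mu> n \<inter> Mult (H_sigma (n - 1))"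
    and "n \<ge> 1" "emeasure \<mu> (space \<mu>) \<noteq> 0"
  shows "(\<lambda>z. f z * g z) \<in> H_mu \<mu> n"
proof -
  have f': "f holomorphic_on ball 0 1" "D_mu \<mu> n f < \<infinity>" and g': "g holomorphic_on ball 0 1" "D_mu \<mu> n g < \<infinity>"
    using assms by (auto simp: H_mu_def)
  obtain C where C: "C > 0" "\<And>a. wnorm (sigma_weight (n - 1)) (conv (taylor_coeff f) a) \<le> ennreal C * wnorm (sigma_weight (n - 1)) a"
    using Mult_H_sigma_bounded f by blast
  obtain D where D: "D > 0" "\<And>a. wnorm (sigma_weight (n - 1)) (conv (taylor_coeff g) a) \<le> ennreal D * wnorm (sigma_weight (n - 1)) a"
    using Mult_H_sigma_bounded g by blast
  have "(cmod (g z))\<^sup>2 \<le> D" if "cmod z < 1" for z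
    by (rule multiplier_bounded[OF sigma_weight_ge_1 D taylor_sums[OF g'(1)] that])
  then have "D_mu \<mu> n (\<lambda>z. f z * g z) < \<infinity>"
    using D_mu_mult_finite[OF \<mu> f'(1) g'(1) assms(4) f'(2) g'(2) C] by blast
  then show ?thesis using f' g' assms(5) by (auto simp: H_mu_def intro!: holomorphic_intros)
qed

theorem theorem1p2:
  fixes \<mu> :: "complex measure" and n :: nat
  assumes "sets \<mu> = sets borel"
    and "finite_measure \<mu>"
    and "emeasure \<mu> (- sphere 0 1) = 0"
    and "n \<ge> 1"
  defines "A \<equiv> H_mu \<mu> n \<inter> Mult (H_sigma (n - 1))"
  shows "(\<lambda>z. 1) \<in> A
    \<and> (\<forall>f\<in>A. \<forall>g\<in>A. (\<lambda>z. f z + g z) \<in> A)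
    \<and> (\<forall>f\<in>A. \<forall>c::complex. (\<lambda>z. c * f z) \<in> A)
    \<and> (\<forall>f\<in>A. \<forall>g\<in>A. (\<lambda>z. f z * g z) \<in> A)"
proof (cases "emeasure \<mu> (space \<mu>) = 0")
  case True
  \<comment> \<open>For the zero measure the first space is \<open>H2\<close> by convention, and it
    contains all the multipliers, so the intersection is the multiplier algebra itself.\<close>
  have "A = Mult (H_sigma (n - 1))"
    using True Mult_subset_H_sigma H_sigma_subset_H2 by (auto simp: A_def H_mu_def)
  then show ?thesis
    using one_in_Mult Mult_add Mult_cmult Mult_mult by simp
next
  case False
  have \<mu>: "circle_measure \<mu>" using assms by (simp add: circle_measure_def)
  show ?thesis
    unfolding A_def
  proof (intro conjI ballI allI)
    show "(\<lambda>z. 1) \<in> H_mu \<mu> n \<inter> Mult (H_sigma (n - 1))"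
      using one_in_H_mu[OF \<mu> assms(4) False] one_in_Mult by blast
  next
    fix f g
    assume f: "f \<in> H_mu \<mu> n \<inter> Mult (H_sigma (n - 1))" and g: "g \<in> H_mu \<mu> n \<inter> Mult (H_sigma (n - 1))"
    then show "(\<lambda>z. f z + g z) \<in> H_mu \<mu> n \<inter> Mult (H_sigma (n - 1))"
      using False by (intro IntI H_mu_add[OF \<mu>] Mult_add) auto
    show "(\<lambda>z. f z * g z) \<in> H_mu \<mu> n \<inter> Mult (H_sigma (n - 1))"
      using H_mu_Int_Mult_mult[OF \<mu> f g assms(4) False] f g by (intro IntI Mult_mult) auto
  next
    fix f c
    assume "f \<in> H_mu \<mu> n \<inter> Mult (H_sigma (n - 1))"
    then show "(\<lambda>z. c * f z) \<in> H_mu \<mu> n \<inter> Mult (H_sigma (n - 1))"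
      using False by (intro IntI H_mu_cmult[OF \<mu>] Mult_cmult) auto
  qed
qed

end
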